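(* Let $1<p<\infty$ and let $K\subset\mathbb{R}^n$ be a compact set whose convex hull has non-empty interior. For $R$ with $K\subset B_R$ (the open ball of radius $R$ centered at the origin), let $u_K$ be a minimizer of $$I(v)=\int_{B_R}|\nabla v|^p\,dx+\mathrm{Per}(\{v>0\})$$ over the set $\{v\in H^1_0(B_R)\mid v\equiv 1\text{ on }K\}$. Then for all large enough $R$, $$\{u_K>0\}\Subset B_R.$$
   Context: $\mathrm{Per}(E)$ denotes the perimeter of $E$ in $\mathbb{R}^n$; one sets $\mathrm{Per}(\{v>0\})=+\infty$ if $\chi_{\{v>0\}}\notin BV(\mathbb{R}^n)$. Functions in $H^1_0(B_R)$ are extended by zero to $\mathbb{R}^n$. Minimizers are understood through their continuous representatives. $A\Subset B_R$ means that the closure of $A$ is a compact subset of $B_R$.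
   Formalization: The dimension is assumed to satisfy n ≥ 2; for n = 1 the claim is false: with K = [-1,1] the perimeter stays 2 while the gradient energy falls as the support grows, so the minimizer is positive on all of (-R,R). *)

theory Defs
  imports "HOL-Analysis.Analysis"
begin

definition compactly_contained :: "'a::topological_space set \<Rightarrow> 'a set \<Rightarrow> bool"
  where "compactly_contained A U \<longleftrightarrow> compact (closure A) \<and> closure A \<subseteq> U"

text \<open>Directional derivatives; only used where the function is differentiable.\<close>

definition dir_deriv :: "'a::euclidean_space \<Rightarrow> ('a \<Rightarrow> 'b::real_normed_vector) \<Rightarrow> 'a \<Rightarrow> 'b"
  where "dir_deriv i f x = frechet_derivative f (at x) i"

definition divergence :: "('a::euclidean_space \<Rightarrow> 'a) \<Rightarrow> 'a \<Rightarrow> real"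
  where "divergence T x = (\<Sum>i\<in>Basis. dir_deriv i T x \<bullet> i)"

fun continuously_diff :: "nat \<Rightarrow> ('a::euclidean_space \<Rightarrow> 'b::real_normed_vector) \<Rightarrow> bool"
  where
    "continuously_diff 0 f \<longleftrightarrow> continuous_on UNIV f"
  | "continuously_diff (Suc k) f \<longleftrightarrow>
       f differentiable_on UNIV \<and> (\<forall>i\<in>Basis. continuously_diff k (dir_deriv i f))"

text \<open>\<open>C\<^sub>c\<^sup>\<infinity>(U)\<close>, each function being extended by zero to the whole space.\<close>

definition test_functions :: "'a::euclidean_space set \<Rightarrow> ('a \<Rightarrow> real) set"
  where "test_functions U =
    {\<phi>. (\<forall>k. continuously_diff k \<phi>) \<and> compactly_contained {x. \<phi> x \<noteq> 0} U}"

subsection \<open>Sobolev functions\<close>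

definition locally_integrable ::
    "'a::euclidean_space set \<Rightarrow> ('a \<Rightarrow> 'b::euclidean_space) \<Rightarrow> bool"
  where "locally_integrable U f \<longleftrightarrow> (\<forall>C. compact C \<and> C \<subseteq> U \<longrightarrow> set_integrable lebesgue C f)"

definition square_integrable ::
    "'a::euclidean_space set \<Rightarrow> ('a \<Rightarrow> 'b::euclidean_space) \<Rightarrow> bool"
  where "square_integrable U f \<longleftrightarrow>
    set_borel_measurable lebesgue U f \<and> set_integrable lebesgue U (\<lambda>x. (norm (f x))\<^sup>2)"

definition has_weak_gradient ::
    "'a::euclidean_space set \<Rightarrow> ('a \<Rightarrow> real) \<Rightarrow> ('a \<Rightarrow> 'a) \<Rightarrow> bool"
  where "has_weak_gradient U v G \<longleftrightarrow>
    locally_integrable U v \<and> locally_integrable U G \<and>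
    (\<forall>\<phi>\<in>test_functions U. \<forall>i\<in>Basis.
       (LINT x:U|lebesgue. v x * dir_deriv i \<phi> x) = - (LINT x:U|lebesgue. (G x \<bullet> i) * \<phi> x))"

text \<open>On an open set \<open>U\<close> the weak gradient is unique up to null sets; it is only ever
  integrated over \<open>U\<close>, so the choice of representative is immaterial.\<close>

definition weak_gradient :: "'a::euclidean_space set \<Rightarrow> ('a \<Rightarrow> real) \<Rightarrow> 'a \<Rightarrow> 'a"
  where "weak_gradient U v = (SOME G. has_weak_gradient U v G)"

definition H1 :: "'a::euclidean_space set \<Rightarrow> ('a \<Rightarrow> real) set"
  where "H1 U =
    {v. square_integrable U v \<and> (\<exists>G. has_weak_gradient U v G \<and> square_integrable U G)}"

definition H1_norm :: "'a::euclidean_space set \<Rightarrow> ('a \<Rightarrow> real) \<Rightarrow> real"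
  where "H1_norm U v =
    sqrt ((LINT x:U|lebesgue. (v x)\<^sup>2) + (LINT x:U|lebesgue. (norm (weak_gradient U v x))\<^sup>2))"

definition H1_closure :: "'a::euclidean_space set \<Rightarrow> ('a \<Rightarrow> real) set \<Rightarrow> ('a \<Rightarrow> real) set"
  where "H1_closure U A =
    {v \<in> H1 U. \<exists>\<phi>. (\<forall>k::nat. \<phi> k \<in> A) \<and> (\<lambda>k. H1_norm U (\<lambda>x. \<phi> k x - v x)) \<longlonglongrightarrow> 0}"

text \<open>Elements are functions on the whole space, extended by zero outside \<open>U\<close>.\<close>

definition H10 :: "'a::euclidean_space set \<Rightarrow> ('a \<Rightarrow> real) set"
  where "H10 U = {v \<in> H1_closure U (test_functions U). \<forall>x. x \<notin> U \<longrightarrow> v x = 0}"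

text \<open>The condition \<open>v \<equiv> 1\<close> on \<open>K\<close> for an element of \<open>H\<^sub>0\<^sup>1(U)\<close>, where \<open>K\<close> may be a null set,
  is understood in the sense of \<open>H\<^sup>1\<close>: \<open>v\<close> is a limit of test functions equal to one near \<open>K\<close>.
  This depends only on the a.e. class of \<open>v\<close> and amounts to \<open>v = 1\<close> quasi-everywhere on \<open>K\<close>.
  Asking for test functions equal to one merely on \<open>K\<close> gives the same class (truncate at
  level one and mollify), and a continuous element of \<open>H\<^sub>0\<^sup>1(U)\<close> equal to one at each point
  of \<open>K\<close> belongs to it.\<close>

definition eq_one_on :: "'a::euclidean_space set \<Rightarrow> 'a set \<Rightarrow> ('a \<Rightarrow> real) \<Rightarrow> bool"
  where "eq_one_on U K v \<longleftrightarrow>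
    v \<in> H1_closure U {\<phi> \<in> test_functions U. \<exists>V. open V \<and> K \<subseteq> V \<and> (\<forall>x\<in>V. \<phi> x = 1)}"

subsection \<open>Perimeter\<close>

text \<open>Fields of class \<open>C\<^sub>c\<^sup>1\<close> with norm at most one.\<close>

definition perimeter_fields :: "('a::euclidean_space \<Rightarrow> 'a) set"
  where "perimeter_fields =
    {T. continuously_diff 1 T \<and> compactly_contained {x. T x \<noteq> 0} UNIV \<and> (\<forall>x. norm (T x) \<le> 1)}"

text \<open>\<open>ennreal\<close> sends negative reals to zero, which does not affect the supremum because
  the zero field is admissible.\<close>

definition total_variation :: "('a::euclidean_space \<Rightarrow> real) \<Rightarrow> ennreal"
  where "total_variation f =
    (SUP T\<in>perimeter_fields. ennreal (LINT x|lebesgue. f x * divergence T x))"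

definition BV :: "('a::euclidean_space \<Rightarrow> real) set"
  where "BV = {f. integrable lebesgue f \<and> total_variation f < \<infinity>}"

definition perimeter :: "'a::euclidean_space set \<Rightarrow> ennreal"
  where "perimeter E =
    (if (indicator E :: 'a \<Rightarrow> real) \<in> BV then total_variation (indicator E) else \<infinity>)"

subsection \<open>The variational problem\<close>

definition functional_I :: "real \<Rightarrow> real \<Rightarrow> ('a::euclidean_space \<Rightarrow> real) \<Rightarrow> ennreal"
  where "functional_I p R v =
    (\<integral>\<^sup>+x\<in>ball 0 R. ennreal (norm (weak_gradient (ball 0 R) v x) powr p) \<partial>lebesgue)
    + perimeter {x. v x > 0}"

definition admissible :: "real \<Rightarrow> 'a::euclidean_space set \<Rightarrow> ('a \<Rightarrow> real) set"
  where "admissible R K = {v \<in> H10 (ball 0 R). eq_one_on (ball 0 R) K v}"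

text \<open>Admissible functions are otherwise only determined up to null sets, so the continuous
  representative in \<open>B\<^sub>R\<close> is singled out here.\<close>

definition continuous_minimizer ::
    "real \<Rightarrow> real \<Rightarrow> 'a::euclidean_space set \<Rightarrow> ('a \<Rightarrow> real) \<Rightarrow> bool"
  where "continuous_minimizer p R K u \<longleftrightarrow>
    u \<in> admissible R K \<and> (\<forall>v\<in>admissible R K. functional_I p R u \<le> functional_I p R v) \<and>
    continuous_on (ball 0 R) u"

end

theory Submission
  imports Defs
begin

text \<open>Let \<open>E\<close> be the positivity set of a minimizer \<open>u\<close> and \<open>m t\<close> the volume of \<open>E\<close> outside the ball of radius
  \<open>t\<close>. A fixed test function bounds the energy, hence the perimeter and the volume of \<open>E\<close>, independently
  of the radius \<open>R\<close>. The competitor \<open>\<Phi> u * \<eta>\<close>, with a smooth truncation \<open>\<Phi>\<close> close to \<open>min 1 (max 0 u)\<close> and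
  a cutoff \<open>\<eta>\<close> of a ball of radius \<open>s \<in> [t + h/2, t + h]\<close>, has the positivity set \<open>E\<close> intersected with
  that ball, and by convexity its gradient energy exceeds that of \<open>u\<close> by at most a multiple of
  \<open>h powr - p\<close> times the volume of \<open>E\<close> in the shell. For a good choice of \<open>s\<close>, cutting \<open>E\<close> creates
  perimeter at most a multiple of \<open>(m t - m (t + h)) / h\<close>. So the part of \<open>E\<close> outside the ball has small
  perimeter, and the isoperimetric inequality gives
  \<open>m (t + h) powr (1 - 1/n) \<le> C * h powr - p * (m t - m (t + h))\<close> for \<open>h \<le> 1\<close>. Unit steps make \<open>m\<close> small
  and a De Giorgi iteration with steps \<open>2\<^sup>-\<^sup>k\<close> makes it vanish at a radius that does not depend on \<open>R\<close>.\<close>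

subsection \<open>Smooth functions\<close>

text \<open>Nothing bounds \<open>u\<close> a priori, which is why the competitor truncates it:
  where \<open>\<eta>\<close> varies, the product rule then costs only volume and not an integral of
  a power of \<open>u\<close>. The truncation is smooth because admissible functions are limits in
  \<open>H1\<close> of test functions equal to one near \<open>K\<close>, and composing these with
  \<open>\<Phi>\<close> and multiplying by \<open>\<eta>\<close> gives such test functions again.
  The price is a slope \<open>c > 1\<close>, removed by letting \<open>c\<close> tend to 1 once the
  finite energy of \<open>u\<close> can be cancelled.

  The perimeter outside is never compared directly. Minimality bounds the perimeter of
  \<open>E\<close> by that of its inner part plus a shell term; cutting bounds the sum of the inner
  and outer perimeters by that of \<open>E\<close> plus a shell term. Added, these leave only shell
  terms for the outer part. Taking \<open>s\<close> in the outer half of the step leaves a width of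
  at least \<open>h / 2\<close> for the cutoff.

  The inequality for \<open>m\<close> forces vanishing because its exponent is less than one; the
  exponent is positive because the dimension is at least two. Continuity of \<open>u\<close> makes
  \<open>E\<close> open, so that zero volume outside a ball leaves no point beyond its
  closure.\<close>

lemma dir_deriv_eq:
  assumes "(f has_derivative f') (at x)"
  shows "dir_deriv i f x = f' i"
  using frechet_derivative_at[OF assms] unfolding dir_deriv_def by simp

lemma dir_deriv_has_derivative:
  assumes "f differentiable (at x)"
  shows "(f has_derivative (\<lambda>h. dir_deriv h f x)) (at x)"
  using assms frechet_derivative_works[of f "at x"] unfolding dir_deriv_def by simp

text \<open>The regularity half of membership in \<open>test_functions\<close>, split off so that it
  also applies to functions without compact support, such as the truncation and the squared
  norm.\<close>

definition smooth :: "('a::euclidean_space \<Rightarrow> 'b::real_normed_vector) \<Rightarrow> bool"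
  where "smooth f \<longleftrightarrow> (\<forall>k. continuously_diff k f)"

lemma smooth_differentiable: "smooth f \<Longrightarrow> f differentiable (at x)"
  unfolding smooth_def by (metis UNIV_I at_within_open continuously_diff.simps(2) differentiable_on_def open_UNIV)

lemma smooth_continuous: "smooth f \<Longrightarrow> continuous_on S f"
  unfolding smooth_def by (metis continuous_on_subset continuously_diff.simps(1) top_greatest)

lemma smooth_dir_deriv: "smooth f \<Longrightarrow> i \<in> Basis \<Longrightarrow> smooth (dir_deriv i f)"
  unfolding smooth_def by (metis continuously_diff.simps(2))

text \<open>Lets inductions on the order of differentiability work with an explicit derivative
  \<open>f'\<close> instead of the choice made by \<open>frechet_derivative\<close>.\<close>

lemma continuously_diff_SucI:
  assumes "\<And>x. (f has_derivative f' x) (at x)"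
    and "\<And>i. i \<in> Basis \<Longrightarrow> continuously_diff k (\<lambda>x. f' x i)"
  shows "continuously_diff (Suc k) f"
proof -
  have "dir_deriv i f = (\<lambda>x. f' x i)" for i
    using dir_deriv_eq[OF assms(1)] by auto
  moreover have "f differentiable_on UNIV"
    using assms(1) differentiable_on_def differentiable_def by (metis has_derivative_at_withinI)
  ultimately show ?thesis using assms(2) by simp
qed

lemma smoothI:
  assumes "\<And>x. (f has_derivative f' x) (at x)"
    and "\<And>i. i \<in> Basis \<Longrightarrow> smooth (\<lambda>x. f' x i)"
  shows "smooth f"
  unfolding smooth_def
proof
  fix k
  have "continuous_on UNIV f"
    using assms(1) has_derivative_continuous continuous_on_eq_continuous_within by blast
  then show "continuously_diff k f"
    using continuously_diff_SucI[OF assms(1)] assms(2) unfolding smooth_def by (cases k) auto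
qed

lemma continuously_diff_const [simp]: "continuously_diff k (\<lambda>x. c)"
proof (induction k arbitrary: c)
  case (Suc k)
  then show ?case by (intro continuously_diff_SucI[where f'="\<lambda>x h. 0"]) auto
qed simp

lemma smooth_const [simp]: "smooth (\<lambda>x. c)"
  by (simp add: smooth_def)

lemma smooth_bounded_linear:
  assumes "bounded_linear f"
  shows "smooth f"
  by (rule smoothI[where f'="\<lambda>x. f"]) (auto intro: assms bounded_linear_imp_has_derivative)

lemma continuously_diff_Suc_imp: "continuously_diff (Suc k) f \<Longrightarrow> continuously_diff k f"
proof (induction k arbitrary: f)
  case 0
  then show ?case by (simp add: differentiable_imp_continuous_on)
qed simp

lemma continuously_diff_differentiable:
  "continuously_diff (Suc k) f \<Longrightarrow> f differentiable (at x)"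
  by (simp add: differentiable_on_def)

lemma continuously_diff_add:
  "continuously_diff k f \<Longrightarrow> continuously_diff k g \<Longrightarrow> continuously_diff k (\<lambda>x. f x + g x)"
proof (induction k arbitrary: f g)
  case 0
  then show ?case by (auto intro: continuous_on_add)
next
  case (Suc k)
  have d: "f differentiable at x" "g differentiable at x" for x
    using Suc.prems continuously_diff_differentiable by auto
  show ?case
    by (rule continuously_diff_SucI[OF has_derivative_add[OF
          dir_deriv_has_derivative[OF d(1)] dir_deriv_has_derivative[OF d(2)]]])
      (use Suc in auto)
qed

lemma continuously_diff_mult:
  fixes f g :: "'a::euclidean_space \<Rightarrow> real"
  shows "continuously_diff k f \<Longrightarrow> continuously_diff k g \<Longrightarrow> continuously_diff k (\<lambda>x. f x * g x)"
proof (induction k arbitrary: f g)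
  case 0
  then show ?case by (auto intro: continuous_on_mult)
next
  case (Suc k)
  have d: "f differentiable at x" "g differentiable at x" for x
    using Suc.prems continuously_diff_differentiable by auto
  have c: "continuously_diff k f" "continuously_diff k g"
    using Suc.prems continuously_diff_Suc_imp by auto
  show ?case
    by (rule continuously_diff_SucI[OF has_derivative_mult[OF
          dir_deriv_has_derivative[OF d(1)] dir_deriv_has_derivative[OF d(2)]]])
      (use Suc c in \<open>auto intro!: continuously_diff_add\<close>)
qed

lemma has_derivative_compose_real:
  fixes f :: "'a::euclidean_space \<Rightarrow> real" and g :: "real \<Rightarrow> real"
  assumes "g differentiable (at (f x))" "f differentiable (at x)"
  shows "((\<lambda>x. g (f x)) has_derivative (\<lambda>h. dir_deriv 1 g (f x) * dir_deriv h f x)) (at x)"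
proof -
  have lin: "dir_deriv h g (f x) = h * dir_deriv 1 g (f x)" for h
    using linear_scale[OF has_derivative_linear[OF dir_deriv_has_derivative[OF assms(1)]], of h 1] by simp
  have "((\<lambda>x. g (f x)) has_derivative (\<lambda>h. dir_deriv (dir_deriv h f x) g (f x))) (at x)"
    using has_derivative_compose[OF dir_deriv_has_derivative[OF assms(2)] dir_deriv_has_derivative[OF assms(1)]] .
  then show ?thesis by (subst (asm) lin) (simp add: mult.commute)
qed

lemma continuously_diff_compose:
  fixes f :: "'a::euclidean_space \<Rightarrow> real" and g :: "real \<Rightarrow> real"
  shows "continuously_diff k g \<Longrightarrow> continuously_diff k f \<Longrightarrow> continuously_diff k (\<lambda>x. g (f x))"
proof (induction k arbitrary: f g)
  case 0
  then show ?case by (auto intro: continuous_on_compose2)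
next
  case (Suc k)
  have d: "f differentiable at x" "g differentiable at y" for x y
    using Suc.prems continuously_diff_differentiable by blast+
  have c: "continuously_diff k f"
    using Suc.prems continuously_diff_Suc_imp by blast
  show ?case
    by (rule continuously_diff_SucI[OF has_derivative_compose_real[OF d(2,1)]])
       (use Suc c in \<open>auto intro!: continuously_diff_mult\<close>)
qed

lemma smooth_add: "smooth f \<Longrightarrow> smooth g \<Longrightarrow> smooth (\<lambda>x. f x + g x)"
  by (simp add: smooth_def continuously_diff_add)

lemma smooth_mult:
  fixes f g :: "'a::euclidean_space \<Rightarrow> real"
  shows "smooth f \<Longrightarrow> smooth g \<Longrightarrow> smooth (\<lambda>x. f x * g x)"
  by (simp add: smooth_def continuously_diff_mult)

lemma smooth_compose:
  fixes f :: "'a::euclidean_space \<Rightarrow> real" and g :: "real \<Rightarrow> real"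
  shows "smooth g \<Longrightarrow> smooth f \<Longrightarrow> smooth (\<lambda>x. g (f x))"
  by (simp add: smooth_def continuously_diff_compose)

lemma smooth_diff:
  fixes f g :: "'a::euclidean_space \<Rightarrow> real"
  assumes "smooth f" "smooth g"
  shows "smooth (\<lambda>x. f x - g x)"
  using smooth_add[OF assms(1) smooth_mult[OF smooth_const[of "-1"] assms(2)]] by simp

lemma smooth_power:
  fixes f :: "'a::euclidean_space \<Rightarrow> real"
  shows "smooth f \<Longrightarrow> smooth (\<lambda>x. f x ^ n)"
  by (induction n) (auto intro: smooth_mult)

lemma smooth_prod:
  fixes f :: "'i \<Rightarrow> 'a::euclidean_space \<Rightarrow> real"
  shows "(\<And>i. i \<in> I \<Longrightarrow> smooth (f i)) \<Longrightarrow> smooth (\<lambda>x. \<Prod>i\<in>I. f i x)"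
  by (induction I rule: infinite_finite_induct) (auto intro: smooth_mult)

lemma has_derivative_norm_sq:
  fixes c x :: "'a::euclidean_space"
  shows "((\<lambda>x. (norm (x - c))\<^sup>2) has_derivative (\<lambda>h. 2 * (h \<bullet> (x - c)))) (at x)"
  unfolding power2_norm_eq_inner
  by (auto intro!: derivative_eq_intros simp: inner_commute)

lemma smooth_norm_sq:
  fixes c :: "'a::euclidean_space"
  shows "smooth (\<lambda>x. (norm (x - c))\<^sup>2)"
proof (rule smoothI[OF has_derivative_norm_sq])
  show "smooth (\<lambda>x. 2 * (i \<bullet> (x - c)))" for i
    by (intro smooth_mult smooth_const)
       (simp add: inner_diff_right smooth_diff smooth_bounded_linear bounded_linear_inner_right)
qed

lemma smooth_realI:
  fixes g :: "real \<Rightarrow> real"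
  assumes "\<And>x. (g has_real_derivative g' x) (at x)" "smooth g'"
  shows "smooth g"
proof (rule smoothI)
  show "(g has_derivative (\<lambda>h. g' x * h)) (at x)" for x
    using assms(1) by (simp add: has_field_derivative_def)
qed (use assms(2) in simp)

lemma dir_deriv_real:
  fixes g :: "real \<Rightarrow> real"
  assumes "(g has_real_derivative g') (at x)"
  shows "dir_deriv 1 g x = g'"
  using assms dir_deriv_eq[of g _ x 1] by (auto simp: has_field_derivative_def)

subsection \<open>A smooth step\<close>

text \<open>The classical flat function \<open>exp (-1/x)\<close>, multiplied by a polynomial in
  \<open>1/x\<close>. This family is closed under differentiation, so that smoothness becomes an
  induction over all \<open>q\<close> at once.\<close>

definition flat :: "real poly \<Rightarrow> real \<Rightarrow> real"
  where "flat q x = (if x > 0 then poly q (1/x) * exp (-1/x) else 0)"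


lemma tendsto_poly_exp: "((\<lambda>y. poly q y * exp (- y)) \<longlongrightarrow> (0::real)) at_top"
proof -
  have "((\<lambda>y. \<Sum>i\<le>degree q. coeff q i * (y ^ i / exp y)) \<longlongrightarrow> (\<Sum>i\<le>degree q. coeff q i * 0)) at_top"
    by (intro tendsto_intros tendsto_power_div_exp_0)
  then show ?thesis
    by (simp add: poly_altdef sum_distrib_right exp_minus divide_inverse mult.assoc)
qed

lemma flat_has_derivative:
  "(flat q has_real_derivative flat ([:0,0,1:] * (q - pderiv q)) x) (at x)"
proof -
  consider "x > 0" | "x < 0" | "x = 0" by linarith
  then show ?thesis
  proof cases
    case 1
    have "((\<lambda>x. poly q (1/x) * exp (-1/x)) has_real_derivative flat ([:0,0,1:] * (q - pderiv q)) x) (at x)"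
      using 1 by (auto intro!: derivative_eq_intros DERIV_chain2[OF poly_DERIV]
          simp: flat_def field_simps power2_eq_square)
    moreover have "\<forall>\<^sub>F y in nhds x. flat q y = poly q (1/y) * exp (-1/y)"
      using eventually_nhds_in_open[of "{0<..}" x] 1 by (auto elim!: eventually_mono simp: flat_def)
    ultimately show ?thesis
      by (simp only: DERIV_cong_ev[OF refl _ refl])
  next
    case 2
    have "\<forall>\<^sub>F y in nhds x. flat q y = 0"
      using eventually_nhds_in_open[of "{..<0}" x] 2 by (auto elim!: eventually_mono simp: flat_def)
    then have "(flat q has_real_derivative 0) (at x) \<longleftrightarrow> ((\<lambda>y. 0) has_real_derivative 0) (at x)"
      by (intro DERIV_cong_ev) auto
    then show ?thesis using 2 by (simp add: flat_def)
  next
    case 3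
    \<comment> \<open>At the origin the right difference quotient is
      \<open>y * poly q y * exp (- y)\<close> with \<open>y = 1/h\<close>, which explains the extra
      factor \<open>[:0,1:]\<close>; the exponential wins as \<open>y\<close> grows.\<close>
    have "((\<lambda>h. poly ([:0,1:] * q) (inverse h) * exp (- inverse h)) \<longlongrightarrow> 0) (at_right (0::real))"
      by (rule filterlim_compose[OF tendsto_poly_exp filterlim_inverse_at_top_right])
    then have "((\<lambda>h. flat q h / h) \<longlongrightarrow> 0) (at_right 0)"
      by (rule Lim_transform_eventually)
         (auto simp: eventually_at_right_less flat_def field_simps
            intro!: eventually_mono[OF eventually_at_right_less])
    moreover have "((\<lambda>h. flat q h / h) \<longlongrightarrow> 0) (at_left 0)"
      by (rule Lim_transform_eventually[OF tendsto_const])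
         (auto simp: flat_def eventually_at_left_field intro!: exI[of _ "-1"])
    ultimately have "((\<lambda>h. flat q h / h) \<longlongrightarrow> 0) (at 0)"
      by (simp add: filterlim_split_at)
    then show ?thesis using 3 by (simp add: DERIV_def flat_def)
  qed
qed

lemma smooth_flat: "smooth (flat q)"
  unfolding smooth_def
proof
  fix k show "continuously_diff k (flat q)"
  proof (induction k arbitrary: q)
    case 0
    then show ?case
      using DERIV_isCont[OF flat_has_derivative] by (simp add: continuous_on_eq_continuous_at)
  next
    case (Suc k)
    have "(flat q has_derivative (\<lambda>h. flat ([:0,0,1:] * (q - pderiv q)) x * h)) (at x)" for x
      using flat_has_derivative[of q x] by (simp add: has_field_derivative_def)
    then show ?case
      by (rule continuously_diff_SucI) (use Suc.IH in simp)
  qed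
qed

lemma smooth_antiderivative:
  fixes g :: "real \<Rightarrow> real"
  assumes "smooth g"
  obtains F where "smooth F" "\<And>x. (F has_real_derivative g x) (at x)" "F a = 0"
proof -
  have "\<exists>F. \<forall>x. -\<infinity> < ereal x \<longrightarrow> ereal x < \<infinity> \<longrightarrow> (F has_vector_derivative g x) (at x)"
    by (rule einterval_antiderivative)
       (use smooth_continuous[OF assms, of UNIV] in \<open>auto simp: continuous_on_eq_continuous_at\<close>)
  then obtain F where F: "\<And>x. (F has_real_derivative g x) (at x)"
    by (auto simp: has_real_derivative_iff_has_vector_derivative)
  have d: "((\<lambda>x. F x - F a) has_real_derivative g x) (at x)" for x
    by (auto intro!: derivative_eq_intros F)
  show thesis
    by (rule that[of "\<lambda>x. F x - F a"]) (use d smooth_realI[OF d assms] in auto)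
qed

lemma flat_1: "flat 1 x > 0 \<longleftrightarrow> x > 0" "flat 1 x \<ge> 0" "x \<le> 0 \<Longrightarrow> flat 1 x = 0"
  by (auto simp: flat_def)

lemma smooth_affine: "smooth (\<lambda>x::real. a * x + b)"
  by (rule smooth_realI[where g'="\<lambda>x. a"]) (auto intro!: derivative_eq_intros)

text \<open>The strict inequalities inside the interval make cutoffs positive exactly on an open
  ball, so that positivity sets of competitors can be computed exactly. The bound on the derivative
  becomes \<open>cutoff_slope\<close>.\<close>

definition is_step :: "(real \<Rightarrow> real) \<Rightarrow> bool" where
  "is_step g \<longleftrightarrow> smooth g \<and> (\<forall>x\<le>0. g x = 0) \<and> (\<forall>x\<ge>1. g x = 1) \<and>
     (\<forall>x. 0 < x \<longrightarrow> x < 1 \<longrightarrow> 0 < g x \<and> g x < 1) \<and> (\<exists>M. \<forall>x. \<bar>dir_deriv 1 g x\<bar> \<le> M)"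

lemma is_step_exists: "\<exists>g. is_step g"
proof -
  \<comment> \<open>A bump positive exactly on the open unit interval; its antiderivative, divided
    by its value at 1, is the step.\<close>
  define b where "b = (\<lambda>x. flat 1 x * flat 1 ((-1) * x + 1))"
  have b: "smooth b" unfolding b_def
    by (rule smooth_mult[OF smooth_flat smooth_compose[OF smooth_flat smooth_affine]])
  have b0: "b x \<ge> 0" for x
    unfolding b_def by (rule mult_nonneg_nonneg[OF flat_1(2) flat_1(2)])
  have b_pos: "b x > 0 \<longleftrightarrow> 0 < x \<and> x < 1" for x
    unfolding b_def zero_less_mult_iff flat_1(1)
    using flat_1(2)[of x] flat_1(2)[of "(-1)*x+1"] by (auto simp: not_less[symmetric])
  have b1: "b x = 0" if "x \<le> 0 \<or> x \<ge> 1" for x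
    using b0[of x] b_pos[of x] that by linarith
  obtain F where F: "smooth F" "\<And>x. (F has_real_derivative b x) (at x)" "F 0 = 0"
    using smooth_antiderivative[OF b] by blast
  have strict: "F x < F y" if "x < y" "0 \<le> x" "y \<le> 1" for x y
    using DERIV_pos_imp_increasing_open[OF that(1), of F] F(2) b_pos that
      smooth_continuous[OF F(1)] by force
  have const: "F x = F y" if "x \<le> y" "y \<le> 0 \<or> 1 \<le> x" for x y
  proof (cases "x = y")
    case False
    have "(F has_real_derivative 0) (at z)" if "x < z" "z < y" for z
      using F(2)[of z] b1[of z] that \<open>y \<le> 0 \<or> 1 \<le> x\<close> by auto
    then show ?thesis
      using DERIV_isconst_end[of x y F] that False smooth_continuous[OF F(1)] by auto
  qed simp
  have low: "F x = 0" if "x \<le> 0" for x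
    using const[of x 0] that F(3) by simp
  have high: "F x = F 1" if "1 \<le> x" for x
    using const[of 1 x] that by simp
  have F1: "F 1 > 0" using strict[of 0 1] F(3) by simp
  define g where "g = (\<lambda>x. F x * (1 / F 1))"
  have dg: "(g has_real_derivative b x / F 1) (at x)" for x
    unfolding g_def using F1 by (auto intro!: derivative_eq_intros F(2))
  have "\<exists>M. \<forall>x. \<bar>b x\<bar> \<le> M"
  proof -
    have "bounded (b ` {0..1})"
      using compact_continuous_image[of "{0..1}" b] smooth_continuous[OF b] compact_imp_bounded by blast
    then obtain M where M: "M > 0" "\<And>x. x \<in> {0..1} \<Longrightarrow> \<bar>b x\<bar> \<le> M"
      by (auto simp: bounded_pos)
    have "\<bar>b x\<bar> \<le> M" for x
      using M b1[of x] by (cases "x \<in> {0..1}") auto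
    then show ?thesis by blast
  qed
  then obtain M where "\<And>x. \<bar>b x\<bar> \<le> M" by blast
  then have "\<bar>dir_deriv 1 g x\<bar> \<le> M / F 1" for x
    using F1 by (simp add: dir_deriv_real[OF dg] divide_right_mono)
  moreover have "smooth g" unfolding g_def by (rule smooth_mult[OF F(1) smooth_const])
  moreover have "g x = 0" if "x \<le> 0" for x
    using low[OF that] by (simp add: g_def)
  moreover have "g x = 1" if "x \<ge> 1" for x
    using high[OF that] F1 by (simp add: g_def)
  moreover have "0 < g x \<and> g x < 1" if "0 < x" "x < 1" for x
    using strict[of 0 x] strict[of x 1] F1 F(3) that by (simp add: g_def)
  ultimately show ?thesis unfolding is_step_def by blast
qed

definition step :: "real \<Rightarrow> real" where
  "step = (SOME g. is_step g)"

lemma is_step_step: "is_step step"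
  unfolding step_def by (rule someI_ex[OF is_step_exists])

lemma step:
  "smooth step" "x \<le> 0 \<Longrightarrow> step x = 0" "x \<ge> 1 \<Longrightarrow> step x = 1" "0 < x \<Longrightarrow> x < 1 \<Longrightarrow> 0 < step x"
  and step_less_1: "x < 1 \<Longrightarrow> step x < 1"
  and step_deriv_bounded: "\<exists>M. \<forall>x. \<bar>dir_deriv 1 step x\<bar> \<le> M"
proof -
  show "smooth step" "x \<le> 0 \<Longrightarrow> step x = 0" "x \<ge> 1 \<Longrightarrow> step x = 1" "0 < x \<Longrightarrow> x < 1 \<Longrightarrow> 0 < step x"
    "\<exists>M. \<forall>x. \<bar>dir_deriv 1 step x\<bar> \<le> M"
    using is_step_step by (simp_all only: is_step_def)
  show "step x < 1" if "x < 1"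
  proof (cases "x \<le> 0")
    case True
    then have "step x = 0" using is_step_step by (simp only: is_step_def)
    then show ?thesis by simp
  next
    case False
    then show ?thesis using is_step_step that by (simp only: is_step_def not_le)
  qed
qed

lemma step_bounds: "0 \<le> step x" "step x \<le> 1" "0 < step x \<longleftrightarrow> 0 < x"
proof -
  consider "x \<le> 0" | "0 < x" "x < 1" | "1 \<le> x" by linarith
  then have "0 \<le> step x \<and> step x \<le> 1 \<and> (0 < step x \<longleftrightarrow> 0 < x)"
    by cases (use step(2-4)[of x] step_less_1[of x] in linarith)+
  then show "0 \<le> step x" "step x \<le> 1" "0 < step x \<longleftrightarrow> 0 < x" by auto
qed

text \<open>The factor 2 is that of the gradient \<open>2 * (x - c)\<close> of the squared distance
  on which cutoffs are built.\<close>

definition cutoff_slope :: real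
  where "cutoff_slope = 2 * (SOME M. M > 0 \<and> (\<forall>x. \<bar>dir_deriv 1 step x\<bar> \<le> M))"

lemma cutoff_slope: "0 < cutoff_slope" "2 * \<bar>dir_deriv 1 step x\<bar> \<le> cutoff_slope"
proof -
  obtain M where M: "\<And>x. \<bar>dir_deriv 1 step x\<bar> \<le> M"
    using step_deriv_bounded by blast
  have "\<exists>M. M > 0 \<and> (\<forall>x. \<bar>dir_deriv 1 step x\<bar> \<le> M)"
    using M by (intro exI[of _ "max M 1"]) (simp add: le_max_iff_disj)
  from someI_ex[OF this] show "0 < cutoff_slope" "2 * \<bar>dir_deriv 1 step x\<bar> \<le> cutoff_slope"
    unfolding cutoff_slope_def by simp_all
qed

section \<open>Gradients of real functions\<close>

lemma dir_deriv_sum_Basis: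
  fixes f :: "'a::euclidean_space \<Rightarrow> 'b::real_normed_vector"
  assumes "f differentiable (at x)"
  shows "dir_deriv h f x = (\<Sum>i\<in>Basis. (h \<bullet> i) *\<^sub>R dir_deriv i f x)"
proof -
  have l: "linear (\<lambda>h. dir_deriv h f x)"
    by (rule has_derivative_linear[OF dir_deriv_has_derivative[OF assms]])
  have "dir_deriv (\<Sum>i\<in>Basis. (h \<bullet> i) *\<^sub>R i) f x = (\<Sum>i\<in>Basis. (h \<bullet> i) *\<^sub>R dir_deriv i f x)"
    by (simp add: linear_sum[OF l] linear_scale[OF l])
  then show ?thesis by (simp add: euclidean_representation)
qed

definition gradient :: "('a::euclidean_space \<Rightarrow> real) \<Rightarrow> 'a \<Rightarrow> 'a"
  where "gradient f x = (\<Sum>i\<in>Basis. dir_deriv i f x *\<^sub>R i)"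

lemma gradient_inner_Basis: "i \<in> Basis \<Longrightarrow> gradient f x \<bullet> i = dir_deriv i f x"
  by (simp add: gradient_def inner_sum_left inner_Basis if_distrib cong: if_cong)

lemma gradient_inner:
  assumes "f differentiable (at x)"
  shows "gradient f x \<bullet> h = dir_deriv h f x"
  unfolding gradient_def dir_deriv_sum_Basis[OF assms, of h] inner_sum_left
  by (rule sum.cong) (simp_all add: inner_commute)

lemma gradient_eqI:
  assumes "(f has_derivative (\<lambda>h. g \<bullet> h)) (at x)"
  shows "gradient f x = g"
  by (rule euclidean_eqI) (simp add: gradient_inner_Basis dir_deriv_eq[OF assms])

lemma has_derivative_gradient:
  assumes "f differentiable (at x)"
  shows "(f has_derivative (\<lambda>h. gradient f x \<bullet> h)) (at x)"
  using dir_deriv_has_derivative[OF assms] by (simp add: gradient_inner[OF assms])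

lemma continuous_gradient:
  assumes "continuously_diff 1 f"
  shows "continuous_on S (gradient f)"
proof -
  have "continuous_on S (dir_deriv i f)" if "i \<in> Basis" for i
    using assms that continuous_on_subset by fastforce
  then have "continuous_on S (\<lambda>x. \<Sum>i\<in>Basis. dir_deriv i f x *\<^sub>R i)"
    by (intro continuous_intros)
  then show ?thesis by (simp add: gradient_def[abs_def])
qed

lemma smooth_cd1: "smooth f \<Longrightarrow> continuously_diff 1 f"
  by (auto simp: smooth_def)

lemma cd1_differentiable: "continuously_diff 1 f \<Longrightarrow> f differentiable (at x)"
  using continuously_diff_differentiable[of 0] by simp

lemma cd1_continuous: "continuously_diff 1 f \<Longrightarrow> continuous_on S f"
  using continuously_diff_Suc_imp[of 0 f] continuous_on_subset by auto

lemma cd1_dir_deriv_continuous: "continuously_diff 1 f \<Longrightarrow> i \<in> Basis \<Longrightarrow> continuous_on S (dir_deriv i f)"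
  using continuous_on_subset by fastforce

lemma dir_deriv_zero_outside:
  assumes "x \<notin> closure {x. f x \<noteq> 0}"
  shows "dir_deriv i f x = 0"
proof -
  have "(f has_derivative (\<lambda>h. 0)) (at x)"
    by (rule has_derivative_transform_within_open[of "\<lambda>x. 0" _ _ _ "- closure {x. f x \<noteq> 0}"])
      (use assms closure_subset[of "{x. f x \<noteq> 0}"] in \<open>auto intro: open_Compl\<close>)
  then show ?thesis by (simp add: dir_deriv_eq)
qed

lemma gradient_zero_outside: "x \<notin> closure {x. f x \<noteq> 0} \<Longrightarrow> gradient f x = 0"
  by (simp add: gradient_def dir_deriv_zero_outside)

subsection \<open>Cutoff functions\<close>

text \<open>Equal to 1 up to radius \<open>a\<close> and to 0 from radius \<open>b\<close> on. The
  squared norm keeps it smooth at the center. The power \<open>N\<close> makes the gradient carry a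
  factor \<open>step ^ (N - 1)\<close>, which \<open>truncation_energy_bound\<close> exploits when
  \<open>N\<close> is at least \<open>p\<close>.\<close>

definition cutoff :: "nat \<Rightarrow> real \<Rightarrow> real \<Rightarrow> 'a::euclidean_space \<Rightarrow> 'a \<Rightarrow> real"
  where "cutoff N a b c x = 1 - step (((norm (x - c))\<^sup>2 - a\<^sup>2) / (b\<^sup>2 - a\<^sup>2)) ^ N"

text \<open>At the endpoints too, since there \<open>step\<close> attains its extreme values 0 and
  1. Hence the gradient of a cutoff also vanishes on the two bounding spheres.\<close>

lemma step_deriv_0: "x \<le> 0 \<or> x \<ge> 1 \<Longrightarrow> dir_deriv 1 step x = 0"
proof -
  assume x: "x \<le> 0 \<or> x \<ge> 1"
  have d: "(step has_real_derivative dir_deriv 1 step x) (at x)"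
    using has_derivative_compose_real[of step "\<lambda>x. x" x] smooth_differentiable[OF step(1)]
    by (simp add: has_field_derivative_def dir_deriv_eq[OF has_derivative_ident])
  from x show ?thesis
  proof
    assume "x \<le> 0"
    then show ?thesis
      by (intro DERIV_local_min[OF d, of 1]) (use step_bounds step(2) in auto)
  next
    assume "x \<ge> 1"
    then show ?thesis
      by (intro DERIV_local_max[OF d, of 1]) (use step_bounds step(3) in auto)
  qed
qed

context
  fixes N :: nat and a b :: real and c :: "'a::euclidean_space"
  assumes N: "N \<ge> 1" and ab: "0 \<le> a" "a < b"
begin

lemma cutoff_arg_le0: "((norm (x - c))\<^sup>2 - a\<^sup>2) / (b\<^sup>2 - a\<^sup>2) \<le> 0 \<longleftrightarrow> norm (x - c) \<le> a"
proof -
  have "b\<^sup>2 - a\<^sup>2 > 0" using ab by (simp add: power_strict_mono)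
  then show ?thesis using ab by (auto simp: divide_le_0_iff abs_le_square_iff[symmetric])
qed

lemma cutoff_arg_ge1: "((norm (x - c))\<^sup>2 - a\<^sup>2) / (b\<^sup>2 - a\<^sup>2) \<ge> 1 \<longleftrightarrow> norm (x - c) \<ge> b"
proof -
  have "b\<^sup>2 - a\<^sup>2 > 0" using ab by (simp add: power_strict_mono)
  then show ?thesis using ab by (auto simp: le_divide_eq abs_le_square_iff[symmetric])
qed

lemma cutoff_bounds: "0 \<le> cutoff N a b c x" "cutoff N a b c x \<le> 1"
  using step_bounds by (auto simp: cutoff_def power_le_one)

lemma cutoff_eq_1: "norm (x - c) \<le> a \<Longrightarrow> cutoff N a b c x = 1"
  using step(2)[of "((norm (x - c))\<^sup>2 - a\<^sup>2) / (b\<^sup>2 - a\<^sup>2)"] N cutoff_arg_le0[of x]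
  by (simp add: cutoff_def)

lemma cutoff_pos_iff: "0 < cutoff N a b c x \<longleftrightarrow> norm (x - c) < b"
proof -
  let ?y = "((norm (x - c))\<^sup>2 - a\<^sup>2) / (b\<^sup>2 - a\<^sup>2)"
  have "step ?y ^ N < 1 \<longleftrightarrow> step ?y < 1"
    using N power_strict_mono[of "step ?y" 1 N] step_bounds(1,2)[of ?y]
    by (cases "step ?y = 1") auto
  also have "\<dots> \<longleftrightarrow> ?y < 1"
    using step(3)[of ?y] step_less_1[of ?y] by linarith
  also have "\<dots> \<longleftrightarrow> norm (x - c) < b"
    using cutoff_arg_ge1[of x] by linarith
  finally show ?thesis by (simp add: cutoff_def)
qed

lemma cutoff_eq_0: "norm (x - c) \<ge> b \<Longrightarrow> cutoff N a b c x = 0"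
  using cutoff_pos_iff[of x] cutoff_bounds[of x] by linarith

lemma smooth_cutoff: "smooth (cutoff N a b c)"
proof -
  have "smooth (\<lambda>x. (1 / (b\<^sup>2 - a\<^sup>2)) * (norm (x - c))\<^sup>2 + (- a\<^sup>2 / (b\<^sup>2 - a\<^sup>2)))"
    by (rule smooth_compose[OF smooth_affine smooth_norm_sq])
  then have "smooth (\<lambda>x. ((norm (x - c))\<^sup>2 - a\<^sup>2) / (b\<^sup>2 - a\<^sup>2))"
    by (simp add: diff_divide_distrib)
  from smooth_diff[OF smooth_const[of 1] smooth_power[OF smooth_compose[OF step(1) this]]]
  show ?thesis by (simp add: cutoff_def[abs_def])
qed

lemma cutoff_gradient:
  assumes "y = ((norm (x - c))\<^sup>2 - a\<^sup>2) / (b\<^sup>2 - a\<^sup>2)"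
  shows "gradient (cutoff N a b c) x =
    - (real N * step y ^ (N - 1) * dir_deriv 1 step y * (2 / (b\<^sup>2 - a\<^sup>2))) *\<^sub>R (x - c)"
proof (rule gradient_eqI)
  let ?f = "\<lambda>x. ((norm (x - c))\<^sup>2 - a\<^sup>2) / (b\<^sup>2 - a\<^sup>2)"
  have f: "(?f has_derivative (\<lambda>h. 2 * (h \<bullet> (x - c)) / (b\<^sup>2 - a\<^sup>2))) (at x)"
    using has_derivative_mult_right[OF has_derivative_diff[OF has_derivative_norm_sq has_derivative_const[of "a\<^sup>2"]],
        of "1 / (b\<^sup>2 - a\<^sup>2)" c x] by simp
  have s: "((\<lambda>x. step (?f x)) has_derivative
       (\<lambda>h. dir_deriv 1 step y * (2 * (h \<bullet> (x - c)) / (b\<^sup>2 - a\<^sup>2)))) (at x)"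
  proof -
    have "?f differentiable (at x)" using f by (auto simp: differentiable_def)
    from has_derivative_compose_real[of step ?f x, OF smooth_differentiable[OF step(1)] this]
    show ?thesis unfolding dir_deriv_eq[OF f] assms[symmetric] .
  qed
  have "((\<lambda>x. 1 - step (?f x) ^ N) has_derivative
      (\<lambda>h. - (of_nat N * (dir_deriv 1 step y * (2 * (h \<bullet> (x - c)) / (b\<^sup>2 - a\<^sup>2))) * step (?f x) ^ (N - 1)))) (at x)"
    using has_derivative_diff[OF has_derivative_const[of 1] has_derivative_power[OF s, of N]] by simp
  then show "(cutoff N a b c has_derivative
      (\<bullet>) (- (real N * step y ^ (N - 1) * dir_deriv 1 step y * (2 / (b\<^sup>2 - a\<^sup>2))) *\<^sub>R (x - c))) (at x)"
    unfolding cutoff_def[abs_def]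
    by (rule has_derivative_eq_rhs) (simp add: assms[symmetric] inner_commute[of "x - c"] fun_eq_iff mult_ac)
qed

lemma cutoff_gradient_eq_0: "norm (x - c) \<le> a \<or> norm (x - c) \<ge> b \<Longrightarrow> gradient (cutoff N a b c) x = 0"
  unfolding cutoff_gradient[OF refl] using cutoff_arg_le0[of x] cutoff_arg_ge1[of x] by (simp add: step_deriv_0)

lemma cutoff_gradient_le:
  "norm (gradient (cutoff N a b c) x)
    \<le> real N * step (((norm (x - c))\<^sup>2 - a\<^sup>2) / (b\<^sup>2 - a\<^sup>2)) ^ (N - 1) * (cutoff_slope / (b - a))"
proof (cases "norm (x - c) \<ge> b")
  case True
  then show ?thesis using cutoff_gradient_eq_0[of x] ab cutoff_slope(1) step_bounds(1) by simp
next
  case False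
  define y where "y = ((norm (x - c))\<^sup>2 - a\<^sup>2) / (b\<^sup>2 - a\<^sup>2)"
  have pos: "b\<^sup>2 - a\<^sup>2 > 0" using ab by (simp add: power_strict_mono)
  have "norm (gradient (cutoff N a b c) x)
      = real N * step y ^ (N - 1) * (\<bar>dir_deriv 1 step y\<bar> * (2 * norm (x - c) / (b\<^sup>2 - a\<^sup>2)))"
    unfolding cutoff_gradient[OF y_def] using pos step_bounds(1)[of y] by (simp add: abs_mult)
  also have "\<dots> \<le> real N * step y ^ (N - 1) * (cutoff_slope / 2 * (2 / (b - a)))"
  proof (intro mult_left_mono mult_mono)
    have "2 * norm (x - c) / (b\<^sup>2 - a\<^sup>2) \<le> 2 * (b + a) / ((b - a) * (b + a))"
      using False ab by (intro frac_le) (auto simp: power2_eq_square algebra_simps mult_strict_mono)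
    also have "\<dots> = 2 / (b - a)" using ab by (intro mult_divide_mult_cancel_right) simp
    finally show "2 * norm (x - c) / (b\<^sup>2 - a\<^sup>2) \<le> 2 / (b - a)" .
    show "\<bar>dir_deriv 1 step y\<bar> \<le> cutoff_slope / 2" using cutoff_slope(2)[of y] by simp
  qed (use pos cutoff_slope(1) step_bounds(1)[of y] in auto)
  finally show ?thesis by (simp add: y_def)
qed

end

text \<open>Smooth substitutes for the truncation \<open>min 1 (max 0 s)\<close>.\<close>

lemma smooth_truncation_exists:
  fixes c :: real
  assumes "c > 1"
  obtains \<Phi> :: "real \<Rightarrow> real" where
    "smooth \<Phi>" "\<And>s. s \<le> 0 \<Longrightarrow> \<Phi> s = 0" "\<And>s. s > 0 \<Longrightarrow> \<Phi> s > 0" "\<Phi> 1 = 1"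
    "\<And>s. 0 \<le> dir_deriv 1 \<Phi> s" "\<And>s. dir_deriv 1 \<Phi> s \<le> c" "\<And>s. \<Phi> s \<le> 2 * c"
proof -
  \<comment> \<open>The density \<open>b\<close> below is 1 on \<open>[e, 1]\<close>, so its
    antiderivative reaches at least \<open>1 - e = 1 / c\<close> at 1; dividing by that value turns
    slope 1 into slope at most \<open>c\<close>.\<close>
  define e where "e = 1 - 1 / c"
  have e: "0 < e" "e < 1" using assms by (auto simp: e_def)
  \<comment> \<open>It rises on \<open>[0, e]\<close>, stays at 1 up to 1 and falls to 0 at 2. The
    support ends at 2, so that the antiderivative is bounded by 2 and the truncation by
    \<open>2 * c\<close>.\<close>
  define b where "b = (\<lambda>s. step (1/e * s + 0) * step ((-1) * s + 2))"
  have b: "smooth b" unfolding b_def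
    by (rule smooth_mult[OF smooth_compose[OF step(1) smooth_affine] smooth_compose[OF step(1) smooth_affine]])
  have b0: "0 \<le> b s" "b s \<le> 1" for s
    unfolding b_def by (auto intro!: mult_nonneg_nonneg mult_le_one step_bounds)
  have b_pos: "b s > 0" if "0 < s" "s < 2" for s
    unfolding b_def using that e by (auto intro!: mult_pos_pos simp: step_bounds)
  have b_zero: "b s = 0" if "s \<le> 0 \<or> s \<ge> 2" for s
    unfolding b_def using that e step(2)[of "1/e * s + 0"] step(2)[of "(-1) * s + 2"] by (auto simp: divide_le_0_iff)
  have b_one: "b s = 1" if "e \<le> s" "s \<le> 1" for s
    unfolding b_def using that e step(3)[of "1/e * s + 0"] step(3)[of "(-1) * s + 2"] by auto
  obtain F where F: "smooth F" "\<And>x. (F has_real_derivative b x) (at x)" "F 0 = 0"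
    using smooth_antiderivative[OF b] by blast
  have mono: "F x \<le> F y" if "x \<le> y" for x y
    using DERIV_nonneg_imp_nondecreasing[OF that, of F] F(2) b0 by blast
  have const: "F x = F y" if "x \<le> y" "y \<le> 0 \<or> 2 \<le> x" for x y
  proof (cases "x = y")
    case False
    have "(F has_real_derivative 0) (at z)" if "x < z" "z < y" for z
      using F(2)[of z] b_zero[of z] that \<open>y \<le> 0 \<or> 2 \<le> x\<close> by auto
    then show ?thesis
      using DERIV_isconst_end[of x y F] that False smooth_continuous[OF F(1)] by auto
  qed simp
  have "\<exists>z. e < z \<and> z < 1 \<and> F 1 - F e = (1 - e) * b z"
    by (rule MVT2) (use e F in auto)
  then have F1: "F 1 \<ge> 1 / c"
    using b_one mono[of 0 e] F(3) e by (auto simp: e_def)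
  then have F1pos: "F 1 > 0" using assms by (smt (verit) zero_less_divide_1_iff)
  have "\<exists>z. 0 < z \<and> z < 2 \<and> F 2 - F 0 = (2 - 0) * b z"
    by (rule MVT2) (use F in auto)
  then have F2: "F 2 \<le> 2" using b0 F(3) by auto
  define \<Phi> where "\<Phi> = (\<lambda>x. F x * (1 / F 1))"
  have inv: "1 / F 1 \<le> c" using F1 F1pos assms by (simp add: field_simps)
  have d\<Phi>: "dir_deriv 1 \<Phi> x = b x / F 1" for x
    unfolding \<Phi>_def using F1pos by (intro dir_deriv_real) (auto intro!: derivative_eq_intros F(2))
  show thesis
  proof (rule that)
    show "smooth \<Phi>" unfolding \<Phi>_def by (rule smooth_mult[OF F(1) smooth_const])
    show "\<Phi> s = 0" if "s \<le> 0" for s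
      using const[of s 0] that F(3) by (simp add: \<Phi>_def)
    show "\<Phi> s > 0" if "s > 0" for s
    proof -
      define m where "m = min s 1"
      have m: "0 < m" "m \<le> 1" "m \<le> s" using that by (auto simp: m_def)
      have "\<exists>z. 0 < z \<and> z < m \<and> F m - F 0 = (m - 0) * b z"
        by (rule MVT2) (use m F in auto)
      then have "F m > 0" using b_pos m F(3) by auto
      then show ?thesis using mono[OF m(3)] F1pos by (simp add: \<Phi>_def)
    qed
    show "\<Phi> 1 = 1" using F1pos by (simp add: \<Phi>_def)
    show "0 \<le> dir_deriv 1 \<Phi> s" for s using b0 F1pos by (simp add: d\<Phi>)
    show "dir_deriv 1 \<Phi> s \<le> c" for s
      using mult_mono[OF b0(2) inv] b0 F1pos assms by (simp add: d\<Phi>)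
    show "\<Phi> s \<le> 2 * c" for s
    proof -
      have "F s \<le> F 2" using mono[of s 2] const[of 2 s] by (cases "s \<le> 2") auto
      then have "F s \<le> 2" using F2 by simp
      then show ?thesis
        using mult_mono[OF _ inv, of "F s" 2] F1pos by (simp add: \<Phi>_def)
    qed
  qed
qed

subsection \<open>Integration by parts\<close>

lemma bounded_subset_cball_0:
  fixes S :: "'a::real_normed_vector set"
  assumes "bounded S"
  obtains r where "0 < r" "S \<subseteq> cball 0 r"
  using bounded_subset_ballD[OF assms, of 0] ball_subset_cball by (metis order_trans)

lemma integrable_continuous_bounded_support:
  fixes f :: "'a::euclidean_space \<Rightarrow> 'b::euclidean_space"
  assumes "continuous_on UNIV f" "bounded {x. f x \<noteq> 0}"
  shows "integrable lborel f"
proof -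
  obtain r where r: "{x. f x \<noteq> 0} \<subseteq> cball 0 r"
    using bounded_subset_cball_0[OF assms(2)] by blast
  have "integrable lborel (\<lambda>x. indicator (cball 0 r) x *\<^sub>R f x)"
    by (rule borel_integrable_compact[OF compact_cball continuous_on_subset[OF assms(1)]]) simp
  moreover have "(\<lambda>x. indicator (cball 0 r) x *\<^sub>R f x) = f"
  proof
    fix x show "indicator (cball 0 r) x *\<^sub>R f x = f x"
      using r by (cases "f x = 0") auto
  qed
  ultimately show ?thesis by simp
qed

lemma bounded_range_continuous_bounded_support:
  fixes f :: "'a::euclidean_space \<Rightarrow> 'b::real_normed_vector"
  assumes "continuous_on UNIV f" "bounded {x. f x \<noteq> 0}"
  obtains B where "B > 0" "\<And>x. norm (f x) \<le> B"
proof -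
  obtain r where r: "{x. f x \<noteq> 0} \<subseteq> cball 0 r"
    using bounded_subset_cball_0[OF assms(2)] by blast
  have "compact (f ` cball 0 r)"
    by (rule compact_continuous_image[OF continuous_on_subset[OF assms(1)]]) simp_all
  then obtain B where B: "B > 0" "\<And>x. x \<in> cball 0 r \<Longrightarrow> norm (f x) \<le> B"
    using compact_imp_bounded[of "f ` cball 0 r"] unfolding bounded_pos by blast
  show thesis
  proof (rule that[OF B(1)])
    show "norm (f x) \<le> B" for x
    proof (cases "f x = 0")
      case False
      then have "x \<in> cball 0 r" using r by blast
      then show ?thesis by (rule B(2))
    qed (use B in simp)
  qed
qed

lemma dir_deriv_support:
  "{x. dir_deriv i f x \<noteq> 0} \<subseteq> closure {x. f x \<noteq> 0}"
  "{x. gradient f x \<noteq> 0} \<subseteq> closure {x. f x \<noteq> 0}"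
  using gradient_zero_outside dir_deriv_zero_outside by blast+

lemma lborel_integral_translation:
  fixes f :: "'a::euclidean_space \<Rightarrow> 'b::euclidean_space"
  assumes "f \<in> borel_measurable borel"
  shows "(LINT x|lborel. f (z + x)) = (LINT x|lborel. f x)"
proof -
  have "(LINT x|lborel. f x) = (LINT x|distr lborel borel ((+) z). f x)"
    by (simp add: lborel_distr_plus)
  also have "\<dots> = (LINT x|lborel. f (z + x))"
    by (rule integral_distr) (use assms in auto)
  finally show ?thesis by simp
qed

lemma has_real_derivative_along_line:
  fixes f :: "'a::euclidean_space \<Rightarrow> real"
  assumes "f differentiable (at (x + t *\<^sub>R z))"
  shows "((\<lambda>t. f (x + t *\<^sub>R z)) has_real_derivative dir_deriv z f (x + t *\<^sub>R z)) (at t)"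
proof -
  have "((\<lambda>t. x + t *\<^sub>R z) has_derivative (\<lambda>h. h *\<^sub>R z)) (at t)"
    by (auto intro!: derivative_eq_intros)
  from has_derivative_compose[OF this dir_deriv_has_derivative[OF assms]]
  have "((\<lambda>t. f (x + t *\<^sub>R z)) has_derivative (\<lambda>h. dir_deriv (h *\<^sub>R z) f (x + t *\<^sub>R z))) (at t)" .
  moreover have "dir_deriv (h *\<^sub>R z) f (x + t *\<^sub>R z) = dir_deriv z f (x + t *\<^sub>R z) * h" for h
    using linear_scale[OF has_derivative_linear[OF dir_deriv_has_derivative[OF assms]], of h z] by simp
  ultimately show ?thesis by (simp add: has_field_derivative_def)
qed

lemma mvt_along_line:
  fixes f :: "'a::euclidean_space \<Rightarrow> real"
  assumes "\<And>y. f differentiable (at y)" "h > 0"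
  obtains t where "0 < t" "t < h" "f (x + h *\<^sub>R z) - f x = h * dir_deriv z f (x + t *\<^sub>R z)"
proof -
  have "\<exists>t>0. t < h \<and> f (x + h *\<^sub>R z) - f (x + 0 *\<^sub>R z) = (h - 0) * dir_deriv z f (x + t *\<^sub>R z)"
    by (rule MVT2[OF assms(2) has_real_derivative_along_line[OF assms(1)]])
  then show thesis using that by auto
qed

text \<open>Translation invariance makes the integrals of the difference quotients vanish.\<close>

lemma integral_dir_deriv_eq_0:
  fixes f :: "'a::euclidean_space \<Rightarrow> real"
  assumes f: "continuously_diff 1 f" and supp: "bounded {x. f x \<noteq> 0}" and i: "i \<in> Basis"
  shows "(LINT x|lborel. dir_deriv i f x) = 0"
proof -
  have cont: "continuous_on UNIV f" "continuous_on UNIV (dir_deriv i f)"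
    using cd1_continuous cd1_dir_deriv_continuous f i by blast+
  have bs: "bounded {x. dir_deriv i f x \<noteq> 0}"
    using bounded_subset[OF bounded_closure[OF supp] dir_deriv_support(1)] .
  obtain B where B: "B > 0" "\<And>x. norm (dir_deriv i f x) \<le> B"
    using bounded_range_continuous_bounded_support[OF cont(2) bs] by blast
  obtain r where r: "{x. f x \<noteq> 0} \<subseteq> cball 0 r"
    using bounded_subset_cball_0[OF supp] by blast
  \<comment> \<open>Difference quotients with increment \<open>1 / (k + 1)\<close>. The increments
    are at most 1, so that all quotients vanish outside \<open>cball 0 (r + 1)\<close>, and the mean
    value theorem bounds them by \<open>B\<close> there: a common integrable majorant.\<close>
  define q where "q k x = real (Suc k) * (f ((1 / real (Suc k)) *\<^sub>R i + x) - f x)" for k x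
  have fm[measurable]: "f \<in> borel_measurable borel"
    by (rule borel_measurable_continuous_onI[OF cont(1)])
  have fi: "integrable lborel f"
    by (rule integrable_continuous_bounded_support[OF cont(1) supp])
  have fz: "integrable lborel (\<lambda>x. f (z + x))" for z
  proof (rule integrable_continuous_bounded_support)
    show "continuous_on UNIV (\<lambda>x. f (z + x))"
      by (rule continuous_on_compose2[OF cont(1)]) (auto intro: continuous_intros)
    have "{x. f (z + x) \<noteq> 0} = (\<lambda>y. - z + y) ` {x. f x \<noteq> 0}"
      by (auto simp: image_iff intro!: exI[of _ "z + _"])
    then show "bounded {x. f (z + x) \<noteq> 0}"
      using bounded_translation[OF supp, of "- z"] by (simp only:)
  qed
  have "(\<lambda>k. LINT x|lborel. q k x) \<longlonglongrightarrow> (LINT x|lborel. dir_deriv i f x)"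
  proof (rule integral_dominated_convergence[where w="\<lambda>x. indicator (cball 0 (r + 1)) x *\<^sub>R B"])
    show "dir_deriv i f \<in> borel_measurable lborel"
      using borel_measurable_continuous_onI[OF cont(2)] by simp
    show "q k \<in> borel_measurable lborel" for k unfolding q_def by measurable
    show "integrable lborel (\<lambda>x. indicator (cball (0::'a) (r + 1)) x *\<^sub>R B)"
      by (rule borel_integrable_compact) auto
    show "AE x in lborel. (\<lambda>k. q k x) \<longlonglongrightarrow> dir_deriv i f x"
    proof (rule AE_I2)
      fix x
      have "((\<lambda>h. (f (x + h *\<^sub>R i) - f x) / h) \<longlongrightarrow> dir_deriv i f x) (at 0)"
        using has_real_derivative_along_line[of f x 0 i] cd1_differentiable[OF f] by (simp add: DERIV_def)
      moreover have "filterlim (\<lambda>k. 1 / real (Suc k)) (at 0) sequentially"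
        using LIMSEQ_inverse_real_of_nat by (simp add: filterlim_at inverse_eq_divide)
      ultimately have "(\<lambda>k. (f (x + (1 / real (Suc k)) *\<^sub>R i) - f x) / (1 / real (Suc k))) \<longlonglongrightarrow> dir_deriv i f x"
        by (rule filterlim_compose)
      then show "(\<lambda>k. q k x) \<longlonglongrightarrow> dir_deriv i f x"
        by (simp add: q_def add.commute mult.commute)
    qed
    show "AE x in lborel. norm (q k x) \<le> indicator (cball 0 (r + 1)) x *\<^sub>R B" for k
    proof (rule AE_I2)
      fix x
      let ?h = "1 / real (Suc k)"
      show "norm (q k x) \<le> indicator (cball 0 (r + 1)) x *\<^sub>R B"
      proof (cases "x \<in> cball 0 (r + 1)")
        case True
        obtain t where t: "f (x + ?h *\<^sub>R i) - f x = ?h * dir_deriv i f (x + t *\<^sub>R i)"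
          using mvt_along_line[of f ?h x i] cd1_differentiable[OF f] by auto
        have "q k x = dir_deriv i f (x + t *\<^sub>R i)"
          unfolding q_def by (subst add.commute[of "?h *\<^sub>R i"], subst t) simp
        then show ?thesis using B True by simp
      next
        case False
        have "norm x \<le> norm (?h *\<^sub>R i + x) + norm (?h *\<^sub>R i)"
          by (metis add.commute add_diff_cancel_right' norm_triangle_ineq4)
        moreover have "norm (?h *\<^sub>R i) \<le> 1" using i by simp
        ultimately have "?h *\<^sub>R i + x \<notin> cball 0 r" "x \<notin> cball 0 r"
          using False unfolding mem_cball_0 by linarith+
        then have "f (?h *\<^sub>R i + x) = 0" "f x = 0" using r by auto
        then show ?thesis using False by (simp add: q_def)
      qed
    qed
  qed
  moreover have "(LINT x|lborel. q k x) = 0" for k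
    unfolding q_def using fz fi lborel_integral_translation[OF fm] by (simp add: Bochner_Integration.integral_diff)
  ultimately show ?thesis
    using LIMSEQ_unique[of "\<lambda>k. 0::real"] by simp
qed

lemma dir_deriv_mult:
  fixes f g :: "'a::euclidean_space \<Rightarrow> real"
  assumes "f differentiable (at x)" "g differentiable (at x)"
  shows "dir_deriv i (\<lambda>x. f x * g x) x = f x * dir_deriv i g x + dir_deriv i f x * g x"
  by (rule dir_deriv_eq[OF has_derivative_mult[OF dir_deriv_has_derivative[OF assms(1)] dir_deriv_has_derivative[OF assms(2)]]])

text \<open>The product rule reduces this to the vanishing integral of a derivative; bounded support
  of one factor already gives it to the product.\<close>

lemma integration_by_parts:
  fixes f g :: "'a::euclidean_space \<Rightarrow> real"
  assumes f: "continuously_diff 1 f" and g: "continuously_diff 1 g"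
    and supp: "bounded {x. g x \<noteq> 0}" and i: "i \<in> Basis"
  shows "(LINT x|lborel. f x * dir_deriv i g x) = - (LINT x|lborel. dir_deriv i f x * g x)"
proof -
  note cont = cd1_continuous[OF f, of UNIV] cd1_continuous[OF g, of UNIV]
    cd1_dir_deriv_continuous[OF f i, of UNIV] cd1_dir_deriv_continuous[OF g i, of UNIV]
  have bs: "bounded {x. dir_deriv i g x \<noteq> 0}"
    using bounded_subset[OF bounded_closure[OF supp] dir_deriv_support(1)] .
  have int: "integrable lborel (\<lambda>x. f x * dir_deriv i g x)" "integrable lborel (\<lambda>x. dir_deriv i f x * g x)"
    by (rule integrable_continuous_bounded_support, rule continuous_on_mult[OF cont(1,4)],
        rule bounded_subset[OF bs], force)
      (rule integrable_continuous_bounded_support, rule continuous_on_mult[OF cont(3,2)],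
        rule bounded_subset[OF supp], force)
  have "0 = (LINT x|lborel. dir_deriv i (\<lambda>x. f x * g x) x)"
    using integral_dir_deriv_eq_0[OF continuously_diff_mult[OF f g] bounded_subset[OF supp] i] by force
  also have "\<dots> = (LINT x|lborel. f x * dir_deriv i g x + dir_deriv i f x * g x)"
    using dir_deriv_mult[OF cd1_differentiable[OF f] cd1_differentiable[OF g]] by simp
  also have "\<dots> = (LINT x|lborel. f x * dir_deriv i g x) + (LINT x|lborel. dir_deriv i f x * g x)"
    by (rule Bochner_Integration.integral_add[OF int])
  finally show ?thesis by simp
qed

section \<open>Test functions and smooth bumps around compact sets\<close>

lemma compactly_containedI:
  fixes U :: "'a::euclidean_space set"
  assumes "A \<subseteq> C" "compact C" "C \<subseteq> U"
  shows "compactly_contained A U"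
proof -
  have "closure A \<subseteq> C" using assms compact_imp_closed closure_minimal by blast
  moreover have "bounded A" using assms compact_imp_bounded bounded_subset by blast
  ultimately show ?thesis using assms by (auto simp: compactly_contained_def)
qed

lemma compactly_contained_bounded: "compactly_contained A U \<Longrightarrow> bounded A"
  unfolding compactly_contained_def by (metis bounded_subset closure_subset compact_imp_bounded)

lemma test_functions_iff:
  "\<phi> \<in> test_functions U \<longleftrightarrow> smooth \<phi> \<and> compactly_contained {x. \<phi> x \<noteq> 0} U"
  by (auto simp: test_functions_def smooth_def)

lemma compact_bump:
  fixes C :: "'a::euclidean_space set"
  assumes "compact C" "e > 0"
  obtains \<phi> :: "'a \<Rightarrow> real" where "smooth \<phi>" "\<And>x. 0 \<le> \<phi> x" "\<And>x. \<phi> x \<le> 1" "\<And>x. x \<in> C \<Longrightarrow> \<phi> x = 1"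
    "\<And>x. \<phi> x \<noteq> 0 \<Longrightarrow> \<exists>y\<in>C. dist x y < e"
proof -
  obtain D where D: "finite D" "D \<subseteq> C" "C \<subseteq> (\<Union>c\<in>D. ball c (e/2))"
    using compactE_image[of C C "\<lambda>c. ball c (e/2)"] assms by force
  \<comment> \<open>A smooth union of finitely many cutoffs of small balls covering
    \<open>C\<close>: the value is 1 as soon as one cutoff is 1, and 0 where all of them
    vanish.\<close>
  define \<phi> where "\<phi> = (\<lambda>x. 1 - (\<Prod>c\<in>D. 1 - cutoff 1 (e/2) e c x))"
  have e: "0 \<le> e/2" "e/2 < e" using assms by auto
  note cb = cutoff_bounds[OF _ e, of 1, simplified]
  show thesis
  proof (rule that)
    show "smooth \<phi>" unfolding \<phi>_def
      by (intro smooth_diff smooth_prod smooth_const smooth_cutoff[OF _ e]) simp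
    show "0 \<le> \<phi> x" "\<phi> x \<le> 1" for x
      unfolding \<phi>_def using cb by (auto intro!: prod_le_1 prod_nonneg)
    show "\<phi> x = 1" if x: "x \<in> C" for x
    proof -
      obtain c where c: "c \<in> D" "x \<in> ball c (e/2)" using D x by blast
      then have "cutoff 1 (e/2) e c x = 1"
        using e by (intro cutoff_eq_1) (auto simp: dist_norm norm_minus_commute)
      then show ?thesis unfolding \<phi>_def using c D by (simp add: prod_zero_iff) blast
    qed
    show "\<exists>y\<in>C. dist x y < e" if "\<phi> x \<noteq> 0" for x
    proof (rule ccontr)
      assume n: "\<not> (\<exists>y\<in>C. dist x y < e)"
      have "cutoff 1 (e/2) e c x = 0" if "c \<in> D" for c
        using n that D e by (intro cutoff_eq_0) (force simp: dist_norm)+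
      then show False using \<open>\<phi> x \<noteq> 0\<close> by (simp add: \<phi>_def)
    qed
  qed
qed

text \<open>Bumps around shrinking neighbourhoods of \<open>C\<close>. The single compact set
  \<open>D\<close> that contains all supports provides the majorant when dominated convergence
  replaces the bumps by the indicator.\<close>

lemma compact_bump_sequence:
  fixes C :: "'a::euclidean_space set"
  assumes "compact C" "open U" "C \<subseteq> U"
  obtains \<phi> :: "nat \<Rightarrow> 'a \<Rightarrow> real" and D where "compact D" "D \<subseteq> U"
    "\<And>k. \<phi> k \<in> test_functions U" "\<And>k x. 0 \<le> \<phi> k x" "\<And>k x. \<phi> k x \<le> 1"
    "\<And>k x. x \<in> C \<Longrightarrow> \<phi> k x = 1" "\<And>k x. x \<notin> D \<Longrightarrow> \<phi> k x = 0"
    "\<And>x. (\<lambda>k. \<phi> k x) \<longlonglongrightarrow> indicator C x"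
proof (cases "C = {}")
  \<comment> \<open>Separate because \<open>infdist\<close> from the empty set is 0 by convention,
    so that the neighbourhoods used below would be the whole space.\<close>
  case True
  show thesis
    by (rule that[of "{}" "\<lambda>k x. 0"])
       (use True in \<open>auto simp: test_functions_iff compactly_contained_def\<close>)
next
  case False
  obtain d where d: "d > 0" "{x. infdist x C \<le> d} \<subseteq> U"
    using compact_in_open_separated[OF False assms] by blast
  define D where "D = {x. infdist x C \<le> d}"
  have "compact D" unfolding D_def by (rule compact_infdist_le) (use False assms d in auto)
  define e where "e k = d / real (Suc k)" for k
  have e: "e k > 0" "e k \<le> d" for k
    using d by (auto simp: e_def field_simps)
  have "\<exists>\<phi>::'a \<Rightarrow> real. smooth \<phi> \<and> (\<forall>x. 0 \<le> \<phi> x \<and> \<phi> x \<le> 1) \<and> (\<forall>x\<in>C. \<phi> x = 1) \<and>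
      (\<forall>x. \<phi> x \<noteq> 0 \<longrightarrow> (\<exists>y\<in>C. dist x y < e k))" for k
    using compact_bump[OF assms(1) e(1)[of k]] by metis
  then obtain \<phi> :: "nat \<Rightarrow> 'a \<Rightarrow> real" where \<phi>: "\<And>k. smooth (\<phi> k)" "\<And>k x. 0 \<le> \<phi> k x" "\<And>k x. \<phi> k x \<le> 1"
    "\<And>k x. x \<in> C \<Longrightarrow> \<phi> k x = 1" "\<And>k x. \<phi> k x \<noteq> 0 \<Longrightarrow> \<exists>y\<in>C. dist x y < e k"
    by metis
  have inf: "infdist x C < e k" if "\<phi> k x \<noteq> 0" for k x
    using \<phi>(5)[OF that] infdist_le[of _ C x] by force
  have supp: "\<phi> k x = 0" if "x \<notin> D" for k x
    using inf[of k x] e(2)[of k] that by (force simp: D_def)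
  have "\<phi> k \<in> test_functions U" for k
    unfolding test_functions_iff
    by (intro conjI \<phi> compactly_containedI[of _ D]) (use supp \<open>compact D\<close> d in \<open>auto simp: D_def[symmetric]\<close>)
  moreover have "(\<lambda>k. \<phi> k x) \<longlonglongrightarrow> indicator C x" for x
  proof (cases "x \<in> C")
    case True
    then show ?thesis using \<phi>(4) by simp
  next
    case out: False
    then have "infdist x C > 0"
      using False assms(1) compact_imp_closed in_closed_iff_infdist_zero infdist_nonneg[of x C]
      by (metis less_eq_real_def)
    moreover have "e \<longlonglongrightarrow> 0" unfolding e_def
      using LIMSEQ_Suc[OF lim_const_over_n[of d]] by simp
    ultimately have "\<forall>\<^sub>F k in sequentially. e k < infdist x C"
      by (rule order_tendstoD(2)[rotated])
    then have "\<forall>\<^sub>F k in sequentially. \<phi> k x = 0"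
      by (rule eventually_mono) (use inf in force)
    then show ?thesis using out by (simp add: tendsto_eventually)
  qed
  ultimately show thesis
    using that[of D \<phi>] \<open>compact D\<close> d \<phi> supp by (auto simp: D_def)
qed

section \<open>Set integrals as integrals for the restricted measure
  \<open>lebesgue_on\<close>\<close>

lemma set_integrable_lebesgue_on:
  fixes f :: "'a::euclidean_space \<Rightarrow> 'b::euclidean_space"
  shows "U \<in> sets lebesgue \<Longrightarrow> set_integrable lebesgue U f \<longleftrightarrow> integrable (lebesgue_on U) f"
  by (simp add: set_integrable_def integrable_restrict_space)

lemma set_lebesgue_integral_lebesgue_on:
  fixes f :: "'a::euclidean_space \<Rightarrow> 'b::euclidean_space"
  shows "U \<in> sets lebesgue \<Longrightarrow> (LINT x:U|lebesgue. f x) = (LINT x|lebesgue_on U. f x)"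
  by (simp add: set_lebesgue_integral_def integral_restrict_space)

lemma set_borel_measurable_lebesgue_on:
  fixes f :: "'a::euclidean_space \<Rightarrow> 'b::euclidean_space"
  shows "U \<in> sets lebesgue \<Longrightarrow> set_borel_measurable lebesgue U f \<longleftrightarrow> f \<in> borel_measurable (lebesgue_on U)"
  by (simp add: set_borel_measurable_def borel_measurable_restrict_space_iff)

lemma continuous_borel_measurable_lebesgue_on:
  fixes f :: "'a::euclidean_space \<Rightarrow> 'b::euclidean_space"
  assumes "continuous_on UNIV f"
  shows "f \<in> borel_measurable (lebesgue_on U)"
proof -
  have "f \<in> borel_measurable lborel"
    using borel_measurable_continuous_onI[OF assms] by simp
  then have "f \<in> borel_measurable lebesgue" by (rule measurable_completion)
  then show ?thesis by (rule measurable_restrict_space1)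
qed

lemma continuous_borel_measurable_lebesgue:
  fixes f :: "'a::euclidean_space \<Rightarrow> 'b::euclidean_space"
  assumes "continuous_on UNIV f"
  shows "f \<in> borel_measurable lebesgue"
  using borel_measurable_continuous_onI[OF assms] by (auto intro: measurable_completion)

lemma open_Union_compact:
  fixes U :: "'a::euclidean_space set"
  assumes "open U"
  obtains F :: "nat \<Rightarrow> 'a set" where "\<And>n. compact (F n)" "U = (\<Union>n. F n)"
proof (rule open_Union_compact_subsets[OF assms])
  fix C :: "nat \<Rightarrow> 'a set"
  assume "\<And>n. compact (C n)" "(\<Union> (range C)) = U"
  then show thesis using that[of C] by auto
qed

text \<open>Local integrability suffices since \<open>\<phi>\<close> is bounded and lives on the
  compact set \<open>D\<close>. The second part moves the integral to the whole space with
  \<open>f\<close> cut down to \<open>D\<close>, where one majorant serves a whole sequence of test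
  functions.\<close>

lemma integrable_times_test_function:
  fixes f \<phi> :: "'a::euclidean_space \<Rightarrow> real"
  assumes f: "locally_integrable U f" and D: "compact D" "D \<subseteq> U" and U: "U \<in> sets lebesgue"
    and \<phi>: "continuous_on UNIV \<phi>" "\<And>x. x \<notin> D \<Longrightarrow> \<phi> x = 0"
  shows "integrable (lebesgue_on U) (\<lambda>x. f x * \<phi> x)"
    and "(LINT x|lebesgue_on U. f x * \<phi> x) = (LINT x|lebesgue. (indicator D x *\<^sub>R f x) * \<phi> x)"
proof -
  have "bounded {x. \<phi> x \<noteq> 0}"
    by (rule bounded_subset[OF compact_imp_bounded[OF D(1)]]) (use \<phi>(2) in blast)
  then obtain B where B: "\<And>x. norm (\<phi> x) \<le> B"
    using bounded_range_continuous_bounded_support[OF \<phi>(1)] by blast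
  have i: "integrable lebesgue (\<lambda>x. indicator D x *\<^sub>R f x)"
    using f D unfolding locally_integrable_def set_integrable_def by blast
  have m: "\<phi> \<in> borel_measurable lebesgue" by (rule continuous_borel_measurable_lebesgue[OF \<phi>(1)])
  have "integrable lebesgue (\<lambda>x. (indicator D x *\<^sub>R f x) * \<phi> x)"
  proof (rule Bochner_Integration.integrable_bound)
    show "integrable lebesgue (\<lambda>x. (indicator D x *\<^sub>R f x) * B)"
      using i by (rule integrable_mult_left)
    show "(\<lambda>x. (indicator D x *\<^sub>R f x) * \<phi> x) \<in> borel_measurable lebesgue"
      using borel_measurable_integrable[OF i] m by (rule borel_measurable_times)
    show "AE x in lebesgue. norm ((indicator D x *\<^sub>R f x) * \<phi> x) \<le> norm ((indicator D x *\<^sub>R f x) * B)"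
    proof (rule AE_I2)
      fix x
      have "\<bar>\<phi> x\<bar> \<le> \<bar>B\<bar>" using B[of x] by simp
      then show "norm ((indicator D x *\<^sub>R f x) * \<phi> x) \<le> norm ((indicator D x *\<^sub>R f x) * B)"
        by (simp add: abs_mult mult_left_mono)
    qed
  qed
  moreover have eq: "(\<lambda>x. (indicator D x *\<^sub>R f x) * \<phi> x) = (\<lambda>x. indicator U x *\<^sub>R (f x * \<phi> x))"
  proof
    fix x show "(indicator D x *\<^sub>R f x) * \<phi> x = indicator U x *\<^sub>R (f x * \<phi> x)"
      using D(2) \<phi>(2)[of x] by (cases "x \<in> D") auto
  qed
  ultimately show "integrable (lebesgue_on U) (\<lambda>x. f x * \<phi> x)"
    using U by (simp add: integrable_restrict_space)
  show "(LINT x|lebesgue_on U. f x * \<phi> x) = (LINT x|lebesgue. (indicator D x *\<^sub>R f x) * \<phi> x)"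
    unfolding eq using U by (simp add: integral_restrict_space)
qed

lemma test_function_compact_support:
  assumes "\<phi> \<in> test_functions U"
  obtains D where "compact D" "D \<subseteq> U" "\<And>x. x \<notin> D \<Longrightarrow> \<phi> x = 0"
    "\<And>x i. x \<notin> D \<Longrightarrow> dir_deriv i \<phi> x = 0" "\<And>x. x \<notin> D \<Longrightarrow> gradient \<phi> x = 0"
proof (rule that[of "closure {x. \<phi> x \<noteq> 0}"])
  show "compact (closure {x. \<phi> x \<noteq> 0})" "closure {x. \<phi> x \<noteq> 0} \<subseteq> U"
    using assms by (auto simp: test_functions_iff compactly_contained_def)
  show "\<phi> x = 0" if "x \<notin> closure {x. \<phi> x \<noteq> 0}" for x
    using that closure_subset[of "{x. \<phi> x \<noteq> 0}"] by blast
qed (use gradient_zero_outside dir_deriv_zero_outside in blast)+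

lemma test_functionD: "\<phi> \<in> test_functions U \<Longrightarrow> smooth \<phi>"
  by (simp add: test_functions_iff)

subsection \<open>Uniqueness of the weak gradient\<close>

text \<open>The indicator of \<open>C\<close> is a bounded limit of test functions with common
  compact support.\<close>

lemma integral_compact_eq_0:
  fixes g :: "'a::euclidean_space \<Rightarrow> real"
  assumes U: "open U" and g: "locally_integrable U g"
    and z: "\<And>\<phi>. \<phi> \<in> test_functions U \<Longrightarrow> (LINT x|lebesgue_on U. g x * \<phi> x) = 0"
    and C: "compact C" "C \<subseteq> U"
  shows "(LINT x|lebesgue. indicator C x *\<^sub>R g x) = 0"
proof -
  obtain \<phi> :: "nat \<Rightarrow> 'a \<Rightarrow> real" and D where D: "compact D" "D \<subseteq> U"
    and \<phi>: "\<And>k. \<phi> k \<in> test_functions U" "\<And>k x. 0 \<le> \<phi> k x" "\<And>k x. \<phi> k x \<le> 1"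
    "\<And>k x. x \<in> C \<Longrightarrow> \<phi> k x = 1" "\<And>k x. x \<notin> D \<Longrightarrow> \<phi> k x = 0"
    "\<And>x. (\<lambda>k. \<phi> k x) \<longlonglongrightarrow> indicator C x"
    by (rule compact_bump_sequence[OF C(1) U C(2)]) (rule that, assumption+)
  have UL: "U \<in> sets lebesgue" using U by auto
  have i: "integrable lebesgue (\<lambda>x. indicator D x *\<^sub>R g x)"
    using g D unfolding locally_integrable_def set_integrable_def by blast
  note m = borel_measurable_integrable[OF i]
  have cont: "continuous_on UNIV (\<phi> k)" for k
    by (rule smooth_continuous[OF test_functionD[OF \<phi>(1)]])
  have CD: "C \<subseteq> D" using \<phi>(4,5) by force
  have "(\<lambda>k. LINT x|lebesgue. (indicator D x *\<^sub>R g x) * \<phi> k x) \<longlonglongrightarrow> (LINT x|lebesgue. indicator C x *\<^sub>R g x)"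
  proof (rule integral_dominated_convergence[where w="\<lambda>x. norm (indicator D x *\<^sub>R g x)"])
    show "(\<lambda>x. indicator C x *\<^sub>R g x) \<in> borel_measurable lebesgue"
      using g C unfolding locally_integrable_def set_integrable_def by auto
    show "(\<lambda>x. (indicator D x *\<^sub>R g x) * \<phi> k x) \<in> borel_measurable lebesgue" for k
      using m continuous_borel_measurable_lebesgue[OF cont] by (rule borel_measurable_times)
    show "integrable lebesgue (\<lambda>x. norm (indicator D x *\<^sub>R g x))" using i by (rule integrable_norm)
    show "AE x in lebesgue. (\<lambda>k. (indicator D x *\<^sub>R g x) * \<phi> k x) \<longlonglongrightarrow> indicator C x *\<^sub>R g x"
    proof (rule AE_I2)
      fix x
      have "(\<lambda>k. (indicator D x *\<^sub>R g x) * \<phi> k x) \<longlonglongrightarrow> (indicator D x *\<^sub>R g x) * indicator C x"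
        by (intro tendsto_intros \<phi>(6))
      moreover have "(indicator D x *\<^sub>R g x) * indicator C x = indicator C x *\<^sub>R g x"
        using CD by (auto simp: indicator_def)
      ultimately show "(\<lambda>k. (indicator D x *\<^sub>R g x) * \<phi> k x) \<longlonglongrightarrow> indicator C x *\<^sub>R g x" by (simp only:)
    qed
    show "AE x in lebesgue. norm ((indicator D x *\<^sub>R g x) * \<phi> k x) \<le> norm (indicator D x *\<^sub>R g x)" for k
      using \<phi>(2,3)[where k=k] by (intro AE_I2) (simp add: abs_mult mult_left_le)
  qed
  moreover have "(LINT x|lebesgue. (indicator D x *\<^sub>R g x) * \<phi> k x) = 0" for k
    using integrable_times_test_function(2)[OF g D UL cont \<phi>(5)] z[OF \<phi>(1)] by metis
  ultimately show ?thesis using LIMSEQ_unique[of "\<lambda>k. 0::real"] by simp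
qed

text \<open>One half of the fundamental lemma of the calculus of variations, without mollifiers.
  Inside a compact set, \<open>g > 0\<close> holds up to a null set on a countable union of compact
  sets; on each of them \<open>g\<close> is positive with integral zero, so each is null.\<close>

lemma AE_nonpos_if_integrates_to_0:
  fixes g :: "'a::euclidean_space \<Rightarrow> real"
  assumes U: "open U" and g: "locally_integrable U g"
    and z: "\<And>\<phi>. \<phi> \<in> test_functions U \<Longrightarrow> (LINT x|lebesgue_on U. g x * \<phi> x) = 0"
  shows "AE x in lebesgue. x \<in> U \<longrightarrow> g x \<le> 0"
proof -
  have local: "AE x in lebesgue. x \<in> D \<longrightarrow> g x \<le> 0" if D: "compact D" "D \<subseteq> U" for D
  proof -
    define S where "S = {x \<in> space lebesgue. 0 < indicator D x *\<^sub>R g x}"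
    have "(\<lambda>x. indicator D x *\<^sub>R g x) \<in> borel_measurable lebesgue"
      using g D unfolding locally_integrable_def set_integrable_def by auto
    then have "S \<in> sets lebesgue" unfolding S_def by measurable
    then obtain F T where F: "fsigma F" "T \<in> null_sets lebesgue" "F \<union> T = S"
      by (rule lebesgue_set_almost_fsigma) (rule that)
    obtain C :: "nat \<Rightarrow> 'a set" where C0: "range C \<subseteq> Collect compact" "F = \<Union> (range C)"
      using F(1) unfolding fsigma_Union_compact by (elim exE conjE)
    then have C: "\<And>n. compact (C n)" "F = (\<Union>n. C n)" by blast+
    have "C n \<in> null_sets lebesgue" for n
    proof (rule null_if_pos_func_has_zero_int)
      have sub: "C n \<subseteq> S" using C F by auto
      have "S \<subseteq> D" by (auto simp: S_def indicator_def split: if_splits)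
      with sub have CD: "C n \<subseteq> D" by blast
      then have CU: "C n \<subseteq> U" using D by blast
      show "integrable lebesgue (\<lambda>x. indicator (C n) x *\<^sub>R g x)"
        using g C(1) CU unfolding locally_integrable_def set_integrable_def by blast
      show "C n \<in> sets lebesgue" using lmeasurable_compact[OF C(1)] by (rule fmeasurableD)
      show "AE x\<in>C n in lebesgue. 0 < indicator (C n) x *\<^sub>R g x"
      proof (rule AE_I2, rule impI)
        fix x assume x: "x \<in> C n"
        with sub have "x \<in> S" by blast
        with x CD show "0 < indicator (C n) x *\<^sub>R g x" by (auto simp: S_def)
      qed
      show "set_lebesgue_integral lebesgue (C n) (\<lambda>x. indicator (C n) x *\<^sub>R g x) = 0"
        using integral_compact_eq_0[OF U g z C(1) CU]
        by (simp add: set_lebesgue_integral_def indicator_inter_arith[symmetric] mult.assoc[symmetric])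
    qed
    then have "F \<in> null_sets lebesgue" unfolding C(2) by auto
    then have "S \<in> null_sets lebesgue" using F by auto
    then have "AE x in lebesgue. x \<notin> S" by (rule AE_not_in)
    then show ?thesis by eventually_elim (auto simp: S_def indicator_def split: if_splits)
  qed
  obtain F :: "nat \<Rightarrow> 'a set" where F: "\<And>n. compact (F n)" "U = (\<Union>n. F n)"
    using open_Union_compact[OF U] by blast
  have "AE x in lebesgue. \<forall>n. x \<in> F n \<longrightarrow> g x \<le> 0"
    unfolding AE_all_countable using local F by blast
  then show ?thesis by eventually_elim (use F in auto)
qed

lemma AE_eq_0_if_integrates_to_0:
  fixes g :: "'a::euclidean_space \<Rightarrow> real"
  assumes U: "open U" and g: "locally_integrable U g"
    and z: "\<And>\<phi>. \<phi> \<in> test_functions U \<Longrightarrow> (LINT x|lebesgue_on U. g x * \<phi> x) = 0"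
  shows "AE x in lebesgue. x \<in> U \<longrightarrow> g x = 0"
proof -
  have "locally_integrable U (\<lambda>x. - g x)"
    using g by (auto simp: locally_integrable_def set_integrable_def)
  then have "AE x in lebesgue. x \<in> U \<longrightarrow> - g x \<le> 0"
    by (rule AE_nonpos_if_integrates_to_0[OF U]) (use z in auto)
  moreover have "AE x in lebesgue. x \<in> U \<longrightarrow> g x \<le> 0"
    by (rule AE_nonpos_if_integrates_to_0[OF U g z])
  ultimately show ?thesis by eventually_elim auto
qed

lemma locally_integrable_component:
  assumes "locally_integrable U G"
  shows "locally_integrable U (\<lambda>x. G x \<bullet> i)"
  unfolding locally_integrable_def set_integrable_def
proof (intro allI impI)
  fix C assume "compact C \<and> C \<subseteq> U"
  then have "integrable lebesgue (\<lambda>x. indicator C x *\<^sub>R G x)"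
    using assms unfolding locally_integrable_def set_integrable_def by blast
  then have "integrable lebesgue (\<lambda>x. (indicator C x *\<^sub>R G x) \<bullet> i)" by (rule integrable_inner_left)
  then show "integrable lebesgue (\<lambda>x. indicator C x *\<^sub>R (G x \<bullet> i))" by simp
qed

lemma locally_integrable_diff:
  assumes "locally_integrable U f" "locally_integrable U g"
  shows "locally_integrable U (\<lambda>x. f x - g x)"
  using assms unfolding locally_integrable_def by (blast intro: set_integral_diff(1))

lemma test_function_integrable:
  fixes f :: "'a::euclidean_space \<Rightarrow> real"
  assumes "open U" "locally_integrable U f" "\<phi> \<in> test_functions U" "i \<in> Basis"
  shows "integrable (lebesgue_on U) (\<lambda>x. f x * \<phi> x)" "integrable (lebesgue_on U) (\<lambda>x. f x * dir_deriv i \<phi> x)"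
proof -
  obtain D where D: "compact D" "D \<subseteq> U" "\<And>x. x \<notin> D \<Longrightarrow> \<phi> x = 0" "\<And>x i. x \<notin> D \<Longrightarrow> dir_deriv i \<phi> x = 0"
    using test_function_compact_support[OF assms(3)] by metis
  have U: "U \<in> sets lebesgue" using assms(1) by auto
  note s = test_functionD[OF assms(3)]
  show "integrable (lebesgue_on U) (\<lambda>x. f x * \<phi> x)"
    by (rule integrable_times_test_function(1)[OF assms(2) D(1,2) U smooth_continuous[OF s] D(3)])
  show "integrable (lebesgue_on U) (\<lambda>x. f x * dir_deriv i \<phi> x)"
    by (rule integrable_times_test_function(1)[OF assms(2) D(1,2) U
          smooth_continuous[OF smooth_dir_deriv[OF s assms(4)]] D(4)])
qed

lemma has_weak_gradient_iff:
  assumes "open U"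
  shows "has_weak_gradient U v G \<longleftrightarrow> locally_integrable U v \<and> locally_integrable U G \<and>
    (\<forall>\<phi>\<in>test_functions U. \<forall>i\<in>Basis.
       (LINT x|lebesgue_on U. v x * dir_deriv i \<phi> x) = - (LINT x|lebesgue_on U. (G x \<bullet> i) * \<phi> x))"
proof -
  have "U \<in> sets lebesgue" using assms by auto
  then show ?thesis unfolding has_weak_gradient_def by (simp add: set_lebesgue_integral_lebesgue_on)
qed

lemma has_weak_gradient_diff:
  fixes U :: "'a::euclidean_space set"
  assumes U: "open U" and "has_weak_gradient U v G" "has_weak_gradient U w H"
  shows "has_weak_gradient U (\<lambda>x. v x - w x) (\<lambda>x. G x - H x)"
proof -
  have li: "locally_integrable U v" "locally_integrable U w" "locally_integrable U G" "locally_integrable U H"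
    using assms unfolding has_weak_gradient_iff[OF U] by auto
  show ?thesis unfolding has_weak_gradient_iff[OF U]
  proof (intro conjI ballI locally_integrable_diff li)
    fix \<phi> :: "'a \<Rightarrow> real" and i :: 'a
    assume \<phi>: "\<phi> \<in> test_functions U" and i: "i \<in> Basis"
    note int = test_function_integrable[OF U _ \<phi> i]
    show "(LINT x|lebesgue_on U. (v x - w x) * dir_deriv i \<phi> x) = - (LINT x|lebesgue_on U. ((G x - H x) \<bullet> i) * \<phi> x)"
      using assms(2,3) \<phi> i unfolding has_weak_gradient_iff[OF U]
      by (simp add: inner_diff_left left_diff_distrib int li locally_integrable_component
          Bochner_Integration.integral_diff)
  qed
qed

text \<open>\<open>G - H\<close> is a weak gradient of the zero function, so each of its components
  integrates to zero against every test function.\<close>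

lemma weak_gradient_AE_unique:
  assumes U: "open U" and "has_weak_gradient U v G" "has_weak_gradient U v H"
  shows "AE x in lebesgue. x \<in> U \<longrightarrow> G x = H x"
proof -
  have d: "has_weak_gradient U (\<lambda>x. v x - v x) (\<lambda>x. G x - H x)"
    by (rule has_weak_gradient_diff[OF assms])
  have "AE x in lebesgue. x \<in> U \<longrightarrow> (G x - H x) \<bullet> i = 0" if i: "i \<in> Basis" for i
  proof (rule AE_eq_0_if_integrates_to_0[OF U])
    show "locally_integrable U (\<lambda>x. (G x - H x) \<bullet> i)"
      by (rule locally_integrable_component) (use d in \<open>simp add: has_weak_gradient_iff[OF U]\<close>)
    show "(LINT x|lebesgue_on U. ((G x - H x) \<bullet> i) * \<phi> x) = 0" if "\<phi> \<in> test_functions U" for \<phi>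
      using d that i unfolding has_weak_gradient_iff[OF U] by simp
  qed
  then have "AE x in lebesgue. \<forall>i\<in>Basis. x \<in> U \<longrightarrow> (G x - H x) \<bullet> i = 0"
    by (intro AE_finite_allI) auto
  then show ?thesis
    by eventually_elim (auto intro: euclidean_eqI simp: inner_diff_left)
qed

lemma weak_gradient_AE_eq:
  assumes U: "open U" and "has_weak_gradient U v G"
  shows "AE x in lebesgue_on U. weak_gradient U v x = G x"
proof -
  have "has_weak_gradient U v (weak_gradient U v)"
    unfolding weak_gradient_def by (rule someI[of _ G]) (rule assms)
  from weak_gradient_AE_unique[OF U this assms(2)] U show ?thesis
    by (simp add: AE_restrict_space_iff)
qed

subsection \<open>Square integrable weak gradients\<close>

lemma norm_sum_sq_le:
  fixes a b :: "'a::real_inner"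
  shows "(norm (a + b))\<^sup>2 \<le> 2 * (norm a)\<^sup>2 + 2 * (norm b)\<^sup>2"
    and "(norm (a - b))\<^sup>2 \<le> 2 * (norm a)\<^sup>2 + 2 * (norm b)\<^sup>2"
proof -
  have p: "2 * (norm a)\<^sup>2 + 2 * (norm b)\<^sup>2 - (norm (a + b))\<^sup>2 = (norm (a - b))\<^sup>2"
    by (simp add: power2_norm_eq_inner algebra_simps)
  have m: "2 * (norm a)\<^sup>2 + 2 * (norm b)\<^sup>2 - (norm (a - b))\<^sup>2 = (norm (a + b))\<^sup>2"
    by (simp add: power2_norm_eq_inner algebra_simps)
  show "(norm (a + b))\<^sup>2 \<le> 2 * (norm a)\<^sup>2 + 2 * (norm b)\<^sup>2" using p zero_le_power2[of "norm (a - b)"] by linarith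
  show "(norm (a - b))\<^sup>2 \<le> 2 * (norm a)\<^sup>2 + 2 * (norm b)\<^sup>2" using m zero_le_power2[of "norm (a + b)"] by linarith
qed

section \<open>Convergence in L2 and in L1 on a finite measure space\<close>

context finite_measure
begin

lemma integrable_if_square_integrable:
  fixes f :: "'a \<Rightarrow> 'b::euclidean_space"
  assumes "f \<in> borel_measurable M" "integrable M (\<lambda>x. (norm (f x))\<^sup>2)"
  shows "integrable M f"
proof (rule Bochner_Integration.integrable_bound)
  show "integrable M (\<lambda>x. 1 + (norm (f x))\<^sup>2)" using assms(2) by simp
  show "AE x in M. norm (f x) \<le> norm (1 + (norm (f x))\<^sup>2)"
  proof (rule AE_I2)
    fix x
    have "0 \<le> (norm (f x) - 1)\<^sup>2" by simp
    then have "2 * norm (f x) \<le> 1 + (norm (f x))\<^sup>2" by (simp add: power2_diff)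
    then show "norm (f x) \<le> norm (1 + (norm (f x))\<^sup>2)"
      using norm_ge_zero[of "f x"] unfolding real_norm_def by linarith
  qed
qed (rule assms)

text \<open>Young's inequality bounds \<open>norm f\<close> by \<open>e + (norm f)^2 / e\<close>.
  With \<open>e\<close> about the L2 norm, both resulting integrals are of the order of that
  norm.\<close>

lemma L2_tendsto_imp_L1_tendsto:
  fixes f :: "nat \<Rightarrow> 'a \<Rightarrow> 'b::euclidean_space"
  assumes m: "\<And>k. f k \<in> borel_measurable M" and i: "\<And>k. integrable M (\<lambda>x. (norm (f k x))\<^sup>2)"
    and lim: "(\<lambda>k. LINT x|M. (norm (f k x))\<^sup>2) \<longlonglongrightarrow> 0"
  shows "(\<lambda>k. LINT x|M. norm (f k x)) \<longlonglongrightarrow> 0"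
proof -
  define a where "a k = (LINT x|M. (norm (f k x))\<^sup>2)" for k
  \<comment> \<open>The summand \<open>1 / (k + 1)\<close> keeps \<open>e k\<close> positive when
    \<open>a k\<close> is 0, so that dividing by it is legitimate.\<close>
  define e where "e k = sqrt (a k) + 1 / real (Suc k)" for k
  have a0: "a k \<ge> 0" for k unfolding a_def by (rule Bochner_Integration.integral_nonneg) simp
  have e0: "e k > 0" for k unfolding e_def using a0 by (simp add: add_nonneg_pos)
  have ai: "integrable M (\<lambda>x. norm (f k x))" for k
    by (rule integrable_norm[OF integrable_if_square_integrable[OF m i]])
  have bound: "(LINT x|M. norm (f k x)) \<le> e k * measure M (space M) + sqrt (a k)" for k
  proof -
    have "(LINT x|M. norm (f k x)) \<le> (LINT x|M. e k + (norm (f k x))\<^sup>2 / e k)"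
    proof (rule integral_mono)
      fix x
      have "0 \<le> (norm (f k x) - e k)\<^sup>2" by simp
      then have "2 * e k * norm (f k x) \<le> (e k)\<^sup>2 + (norm (f k x))\<^sup>2"
        by (simp add: power2_diff algebra_simps)
      then have "e k * norm (f k x) \<le> (e k)\<^sup>2 + (norm (f k x))\<^sup>2"
        using mult_nonneg_nonneg[OF less_imp_le[OF e0[of k]] norm_ge_zero[of "f k x"]]
        unfolding mult.assoc by linarith
      then show "norm (f k x) \<le> e k + (norm (f k x))\<^sup>2 / e k"
        using e0[of k] by (simp add: field_simps power2_eq_square)
    qed (use ai i in auto)
    also have "\<dots> = e k * measure M (space M) + a k / e k"
      using i unfolding a_def by (simp add: Bochner_Integration.integral_add)
    also have "a k / e k \<le> sqrt (a k)"
    proof -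
      have "a k \<le> sqrt (a k) * e k"
        using a0[of k] unfolding e_def distrib_left by simp
      then show ?thesis using e0[of k] by (simp add: divide_le_eq)
    qed
    finally show ?thesis by simp
  qed
  have "a \<longlonglongrightarrow> 0" using lim unfolding a_def .
  then have s: "(\<lambda>k. sqrt (a k)) \<longlonglongrightarrow> 0" using tendsto_real_sqrt[of a 0] by simp
  have "(\<lambda>k. 1 / real (Suc k)) \<longlonglongrightarrow> 0" using LIMSEQ_inverse_real_of_nat by (simp add: inverse_eq_divide)
  then have "(\<lambda>k. e k * measure M (space M) + sqrt (a k)) \<longlonglongrightarrow> (0 + 0) * measure M (space M) + 0"
    unfolding e_def by (intro tendsto_intros s)
  then have "(\<lambda>k. e k * measure M (space M) + sqrt (a k)) \<longlonglongrightarrow> 0" by simp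
  then show ?thesis
  proof (rule Lim_null_comparison[OF always_eventually, rotated], intro allI)
    fix k
    show "norm (LINT x|M. norm (f k x)) \<le> e k * measure M (space M) + sqrt (a k)"
      using bound[of k] by (simp add: abs_of_nonneg Bochner_Integration.integral_nonneg)
  qed
qed

text \<open>Passes to the limit in the defining identity of the weak gradient, where
  \<open>w\<close> is a test function or one of its derivatives.\<close>

lemma L2_tendsto_integral_times:
  fixes f :: "nat \<Rightarrow> 'a \<Rightarrow> real"
  assumes m: "\<And>k. f k \<in> borel_measurable M" "g \<in> borel_measurable M" "w \<in> borel_measurable M"
    and i: "\<And>k. integrable M (\<lambda>x. (norm (f k x - g x))\<^sup>2)" "integrable M g"
    and lim: "(\<lambda>k. LINT x|M. (norm (f k x - g x))\<^sup>2) \<longlonglongrightarrow> 0"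
    and w: "\<And>x. \<bar>w x\<bar> \<le> B"
  shows "(\<lambda>k. LINT x|M. f k x * w x) \<longlonglongrightarrow> (LINT x|M. g x * w x)"
proof -
  have dm: "(\<lambda>x. f k x - g x) \<in> borel_measurable M" for k using m by simp
  have di: "integrable M (\<lambda>x. f k x - g x)" for k
    by (rule integrable_if_square_integrable[OF dm i(1)])
  have wi: "integrable M (\<lambda>x. h x * w x)" if "integrable M h" for h :: "'a \<Rightarrow> real"
  proof (rule Bochner_Integration.integrable_bound)
    show "integrable M (\<lambda>x. h x * B)" using that by simp
    show "AE x in M. norm (h x * w x) \<le> norm (h x * B)"
      using w by (intro AE_I2) (simp add: abs_mult mult_left_mono order_trans[OF _ abs_ge_self])
  qed (use that m in auto)
  have diff: "\<bar>(LINT x|M. f k x * w x) - (LINT x|M. g x * w x)\<bar> \<le> B * (LINT x|M. norm (f k x - g x))" for k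
  proof -
    have "integrable M (f k)" using Bochner_Integration.integrable_add[OF di[of k] i(2)] by simp
    then have "(LINT x|M. f k x * w x) - (LINT x|M. g x * w x) = (LINT x|M. (f k x - g x) * w x)"
      using wi[OF _] i(2) by (simp add: left_diff_distrib Bochner_Integration.integral_diff)
    also have "\<bar>\<dots>\<bar> \<le> (LINT x|M. \<bar>(f k x - g x) * w x\<bar>)"
      by (rule integral_abs_bound)
    also have "\<dots> \<le> (LINT x|M. B * norm (f k x - g x))"
    proof (rule integral_mono)
      show "\<bar>(f k x - g x) * w x\<bar> \<le> B * norm (f k x - g x)" for x
        using mult_right_mono[OF w[of x], of "\<bar>f k x - g x\<bar>"] by (simp add: abs_mult mult.commute)
    qed (use wi[OF di] di in auto)
    finally show ?thesis by simp
  qed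
  have "(\<lambda>k. B * (LINT x|M. norm (f k x - g x))) \<longlonglongrightarrow> 0"
    using tendsto_mult_right_zero[OF L2_tendsto_imp_L1_tendsto[OF dm i(1) lim]] by simp
  then have "(\<lambda>k. (LINT x|M. f k x * w x) - (LINT x|M. g x * w x)) \<longlonglongrightarrow> 0"
    by (rule Lim_null_comparison[OF always_eventually, rotated]) (use diff in simp)
  then show ?thesis by (rule LIM_zero_cancel)
qed

end

lemma finite_measure_lebesgue_on_bounded:
  fixes U :: "'a::euclidean_space set"
  assumes "open U" "bounded U"
  shows "finite_measure (lebesgue_on U)"
  using assms by (simp add: finite_measure_lebesgue_on lmeasurable_open)

lemma square_integrable_iff:
  fixes f :: "'a::euclidean_space \<Rightarrow> 'b::euclidean_space"
  assumes "open U"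
  shows "square_integrable U f \<longleftrightarrow>
    f \<in> borel_measurable (lebesgue_on U) \<and> integrable (lebesgue_on U) (\<lambda>x. (norm (f x))\<^sup>2)"
proof -
  have "U \<in> sets lebesgue" using assms by auto
  then show ?thesis
    unfolding square_integrable_def by (simp add: set_integrable_lebesgue_on set_borel_measurable_lebesgue_on)
qed

lemma square_integrable_add:
  fixes f g :: "'a::euclidean_space \<Rightarrow> 'b::euclidean_space"
  assumes U: "open U" and "square_integrable U f" "square_integrable U g"
  shows "square_integrable U (\<lambda>x. f x + g x)"
  unfolding square_integrable_iff[OF U]
proof
  have fg: "f \<in> borel_measurable (lebesgue_on U)" "g \<in> borel_measurable (lebesgue_on U)"
     "integrable (lebesgue_on U) (\<lambda>x. (norm (f x))\<^sup>2)" "integrable (lebesgue_on U) (\<lambda>x. (norm (g x))\<^sup>2)"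
    using assms unfolding square_integrable_iff[OF U] by auto
  then show m: "(\<lambda>x. f x + g x) \<in> borel_measurable (lebesgue_on U)" by simp
  show "integrable (lebesgue_on U) (\<lambda>x. (norm (f x + g x))\<^sup>2)"
  proof (rule Bochner_Integration.integrable_bound)
    show "integrable (lebesgue_on U) (\<lambda>x. 2 * (norm (f x))\<^sup>2 + 2 * (norm (g x))\<^sup>2)"
      using fg by simp
    show "AE x in lebesgue_on U. norm ((norm (f x + g x))\<^sup>2) \<le> norm (2 * (norm (f x))\<^sup>2 + 2 * (norm (g x))\<^sup>2)"
      using norm_sum_sq_le(1) by (intro AE_I2) simp
  qed (use m in simp)
qed

lemma square_integrable_scaleR:
  fixes f :: "'a::euclidean_space \<Rightarrow> 'b::euclidean_space"
  assumes U: "open U" and "square_integrable U f"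
    and h: "h \<in> borel_measurable (lebesgue_on U)" "\<And>x. \<bar>h x\<bar> \<le> B"
  shows "square_integrable U (\<lambda>x. h x *\<^sub>R f x)"
  unfolding square_integrable_iff[OF U]
proof
  have f: "f \<in> borel_measurable (lebesgue_on U)" "integrable (lebesgue_on U) (\<lambda>x. (norm (f x))\<^sup>2)"
    using assms unfolding square_integrable_iff[OF U] by auto
  then show m: "(\<lambda>x. h x *\<^sub>R f x) \<in> borel_measurable (lebesgue_on U)" using h by simp
  show "integrable (lebesgue_on U) (\<lambda>x. (norm (h x *\<^sub>R f x))\<^sup>2)"
  proof (rule Bochner_Integration.integrable_bound)
    show "integrable (lebesgue_on U) (\<lambda>x. B\<^sup>2 * (norm (f x))\<^sup>2)" using f by simp
    show "AE x in lebesgue_on U. norm ((norm (h x *\<^sub>R f x))\<^sup>2) \<le> norm (B\<^sup>2 * (norm (f x))\<^sup>2)"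
    proof (rule AE_I2)
      fix x
      have "\<bar>h x\<bar>\<^sup>2 \<le> B\<^sup>2" using h(2)[of x] by (intro power_mono) auto
      then show "norm ((norm (h x *\<^sub>R f x))\<^sup>2) \<le> norm (B\<^sup>2 * (norm (f x))\<^sup>2)"
        by (simp add: power_mult_distrib mult_right_mono)
    qed
    show "(\<lambda>x. (norm (h x *\<^sub>R f x))\<^sup>2) \<in> borel_measurable (lebesgue_on U)"
      using m by measurable
  qed
qed

lemma square_integrable_diff:
  fixes f g :: "'a::euclidean_space \<Rightarrow> 'b::euclidean_space"
  assumes U: "open U" and "square_integrable U f" "square_integrable U g"
  shows "square_integrable U (\<lambda>x. f x - g x)"
  using square_integrable_add[OF U assms(2) square_integrable_scaleR[OF U assms(3), of "\<lambda>x. -1" 1]] by simp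

lemma square_integrable_bounded:
  fixes f :: "'a::euclidean_space \<Rightarrow> 'b::euclidean_space"
  assumes U: "open U" "bounded U" and f: "f \<in> borel_measurable (lebesgue_on U)" "\<And>x. norm (f x) \<le> B"
  shows "square_integrable U f"
  unfolding square_integrable_iff[OF U(1)]
proof
  interpret finite_measure "lebesgue_on U" by (rule finite_measure_lebesgue_on_bounded[OF U])
  show "integrable (lebesgue_on U) (\<lambda>x. (norm (f x))\<^sup>2)"
    by (rule integrable_const_bound[of _ "B\<^sup>2"]) (use f in \<open>auto intro!: power_mono\<close>)
qed (rule f)

lemma locally_integrable_if_integrable:
  fixes f :: "'a::euclidean_space \<Rightarrow> 'b::euclidean_space"
  assumes "open U" "integrable (lebesgue_on U) f"
  shows "locally_integrable U f"
  unfolding locally_integrable_def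
proof (intro allI impI)
  fix C assume C: "compact C \<and> C \<subseteq> U"
  have "U \<in> sets lebesgue" using assms(1) by auto
  then have "set_integrable lebesgue U f" using assms(2) by (simp add: set_integrable_lebesgue_on)
  then show "set_integrable lebesgue C f"
    by (rule set_integrable_subset) (use C fmeasurableD[OF lmeasurable_compact] in blast)+
qed

lemma locally_integrable_if_square_integrable:
  fixes f :: "'a::euclidean_space \<Rightarrow> 'b::euclidean_space"
  assumes U: "open U" "bounded U" and "square_integrable U f"
  shows "integrable (lebesgue_on U) f" "locally_integrable U f"
proof -
  interpret finite_measure "lebesgue_on U" by (rule finite_measure_lebesgue_on_bounded[OF U])
  show "integrable (lebesgue_on U) f"
    using assms(3) unfolding square_integrable_iff[OF U(1)] by (auto intro: integrable_if_square_integrable)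
  then show "locally_integrable U f" by (rule locally_integrable_if_integrable[OF U(1)])
qed

lemma integral_lebesgue_on_eq_lborel:
  fixes f :: "'a::euclidean_space \<Rightarrow> real"
  assumes "continuous_on UNIV f" "\<And>x. x \<notin> U \<Longrightarrow> f x = 0" "U \<in> sets lebesgue"
  shows "(LINT x|lebesgue_on U. f x) = (LINT x|lborel. f x)"
proof -
  have eq: "(\<lambda>x. indicator U x *\<^sub>R f x) = f"
  proof
    fix x show "indicator U x *\<^sub>R f x = f x"
      using assms(2)[of x] by (cases "x \<in> U") auto
  qed
  have "(LINT x|lebesgue_on U. f x) = (LINT x|lebesgue. f x)"
    using assms(3) eq by (simp add: integral_restrict_space)
  also have "\<dots> = (LINT x|lborel. f x)"
    by (rule integral_completion) (use borel_measurable_continuous_onI[OF assms(1)] in simp)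
  finally show ?thesis .
qed

section \<open>Sobolev functions as limits of test functions\<close>

lemma test_function_facts:
  fixes \<phi> :: "'a::euclidean_space \<Rightarrow> real"
  assumes U: "open U" "bounded U" and \<phi>: "\<phi> \<in> test_functions U"
  shows "square_integrable U \<phi>" "square_integrable U (gradient \<phi>)" "has_weak_gradient U \<phi> (gradient \<phi>)"
proof -
  note s = test_functionD[OF \<phi>]
  have bs: "bounded {x. \<phi> x \<noteq> 0}"
    using \<phi> compactly_contained_bounded unfolding test_functions_iff by blast
  have bg: "bounded {x. gradient \<phi> x \<noteq> 0}"
    by (rule bounded_subset[OF bounded_closure[OF bs] dir_deriv_support(2)])
  have c: "continuous_on UNIV \<phi>" "continuous_on UNIV (gradient \<phi>)"
    using smooth_continuous[OF s] continuous_gradient[OF smooth_cd1[OF s]] by auto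
  show sq: "square_integrable U \<phi>" "square_integrable U (gradient \<phi>)"
  proof -
    obtain B where "\<And>x. norm (\<phi> x) \<le> B"
      using bounded_range_continuous_bounded_support[OF c(1) bs] by blast
    then show "square_integrable U \<phi>"
      by (rule square_integrable_bounded[OF U continuous_borel_measurable_lebesgue_on[OF c(1)]])
    obtain B' where "\<And>x. norm (gradient \<phi> x) \<le> B'"
      using bounded_range_continuous_bounded_support[OF c(2) bg] by blast
    then show "square_integrable U (gradient \<phi>)"
      by (rule square_integrable_bounded[OF U continuous_borel_measurable_lebesgue_on[OF c(2)]])
  qed
  show "has_weak_gradient U \<phi> (gradient \<phi>)"
    unfolding has_weak_gradient_iff[OF U(1)]
  proof (intro conjI ballI locally_integrable_if_square_integrable[OF U] sq)
    fix \<psi> :: "'a \<Rightarrow> real" and i :: 'a assume \<psi>: "\<psi> \<in> test_functions U" and i: "i \<in> Basis"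
    note s' = test_functionD[OF \<psi>]
    have UL: "U \<in> sets lebesgue" using U by auto
    obtain D where D: "D \<subseteq> U" "\<And>x. x \<notin> D \<Longrightarrow> \<psi> x = 0" "\<And>x. x \<notin> D \<Longrightarrow> dir_deriv i \<psi> x = 0"
      using test_function_compact_support[OF \<psi>] by metis
    have out: "x \<notin> U \<Longrightarrow> \<psi> x = 0" "x \<notin> U \<Longrightarrow> dir_deriv i \<psi> x = 0" for x using D by blast+
    have "(LINT x|lebesgue_on U. \<phi> x * dir_deriv i \<psi> x) = (LINT x|lborel. \<phi> x * dir_deriv i \<psi> x)"
      by (rule integral_lebesgue_on_eq_lborel)
        (use out UL in \<open>auto intro: continuous_on_mult c smooth_continuous[OF smooth_dir_deriv[OF s' i]]\<close>)
    also have "\<dots> = - (LINT x|lborel. dir_deriv i \<phi> x * \<psi> x)"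
      using \<psi> compactly_contained_bounded unfolding test_functions_iff
      by (intro integration_by_parts smooth_cd1 s s' i) blast
    also have "(LINT x|lborel. dir_deriv i \<phi> x * \<psi> x) = (LINT x|lebesgue_on U. dir_deriv i \<phi> x * \<psi> x)"
      by (rule integral_lebesgue_on_eq_lborel[symmetric])
        (use out UL in \<open>auto intro: continuous_on_mult smooth_continuous s' smooth_dir_deriv[OF s i]\<close>)
    finally show "(LINT x|lebesgue_on U. \<phi> x * dir_deriv i \<psi> x) = - (LINT x|lebesgue_on U. (gradient \<phi> x \<bullet> i) * \<psi> x)"
      by (simp add: gradient_inner_Basis[OF i])
  qed
qed

text \<open>Integrability on compact sets gives measurability there, and an open set is exhausted by
  countably many compact sets.\<close>

lemma locally_integrable_measurable:
  fixes f :: "'a::euclidean_space \<Rightarrow> 'b::euclidean_space"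
  assumes U: "open U" and f: "locally_integrable U f"
  shows "f \<in> borel_measurable (lebesgue_on U)"
proof -
  obtain F :: "nat \<Rightarrow> 'a set" where F: "\<And>n. compact (F n)" "U = (\<Union>n. F n)"
    using open_Union_compact[OF U] by blast
  define E where "E n = (\<Union>i\<le>n. F i)" for n
  have E: "compact (E n)" "E n \<subseteq> U" for n
    unfolding E_def F(2) using F(1) by auto
  have "(\<lambda>x. indicator U x *\<^sub>R f x) \<in> borel_measurable lebesgue"
  proof (rule borel_measurable_LIMSEQ_metric)
    show "(\<lambda>x. indicator (E n) x *\<^sub>R f x) \<in> borel_measurable lebesgue" for n
      using f E[of n] unfolding locally_integrable_def set_integrable_def by auto
    show "(\<lambda>n. indicator (E n) x *\<^sub>R f x) \<longlonglongrightarrow> indicator U x *\<^sub>R f x" for x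
    proof (cases "x \<in> U")
      case True
      then obtain m where "x \<in> F m" using F(2) by blast
      then have "x \<in> E n" if "m \<le> n" for n using that unfolding E_def by blast
      then have "\<forall>\<^sub>F n in sequentially. indicator (E n) x *\<^sub>R f x = indicator U x *\<^sub>R f x"
        using True by (intro eventually_sequentiallyI[of m]) simp
      then show ?thesis by (rule tendsto_eventually)
    next
      case False
      then have "x \<notin> E n" for n using E(2)[of n] by blast
      then show ?thesis using False by simp
    qed
  qed
  then show ?thesis using U by (simp add: borel_measurable_restrict_space_iff)
qed

lemma weak_gradient_properties:
  assumes "has_weak_gradient U w W"
  shows "has_weak_gradient U w (weak_gradient U w)"
  unfolding weak_gradient_def by (rule someI[of _ W]) (rule assms)

lemma has_weak_gradient_measurable:
  assumes "open U" "has_weak_gradient U w W"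
  shows "w \<in> borel_measurable (lebesgue_on U)" "W \<in> borel_measurable (lebesgue_on U)"
  using assms locally_integrable_measurable unfolding has_weak_gradient_def by blast+

text \<open>\<open>weak_gradient\<close> is an arbitrary choice, but almost everywhere unique, so
  any weak gradient \<open>W\<close> at hand computes the norm.\<close>

lemma H1_norm_eq:
  fixes w :: "'a::euclidean_space \<Rightarrow> real"
  assumes U: "open U" and W: "has_weak_gradient U w W"
  shows "H1_norm U w = sqrt ((LINT x|lebesgue_on U. (w x)\<^sup>2) + (LINT x|lebesgue_on U. (norm (W x))\<^sup>2))"
proof -
  have UL: "U \<in> sets lebesgue" using U by auto
  have m: "weak_gradient U w \<in> borel_measurable (lebesgue_on U)" "W \<in> borel_measurable (lebesgue_on U)"
    using has_weak_gradient_measurable(2)[OF U] weak_gradient_properties[OF W] W by blast+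
  have "(LINT x|lebesgue_on U. (norm (weak_gradient U w x))\<^sup>2) = (LINT x|lebesgue_on U. (norm (W x))\<^sup>2)"
  proof (rule integral_cong_AE)
    show "AE x in lebesgue_on U. (norm (weak_gradient U w x))\<^sup>2 = (norm (W x))\<^sup>2"
      using weak_gradient_AE_eq[OF U W] by eventually_elim simp
  qed (use m in auto)
  then show ?thesis
    unfolding H1_norm_def by (simp add: set_lebesgue_integral_lebesgue_on[OF UL])
qed

lemma H1_norm_tendsto_imp:
  fixes U :: "'a::euclidean_space set"
  assumes U: "open U" "bounded U" and \<phi>: "\<And>k. \<phi> k \<in> test_functions U"
    and u: "square_integrable U u" "square_integrable U G" "has_weak_gradient U u G"
    and lim: "(\<lambda>k. H1_norm U (\<lambda>x. \<phi> k x - u x)) \<longlonglongrightarrow> 0"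
  shows "(\<lambda>k. LINT x|lebesgue_on U. (norm (\<phi> k x - u x))\<^sup>2) \<longlonglongrightarrow> 0"
    and "(\<lambda>k. LINT x|lebesgue_on U. (norm (gradient (\<phi> k) x - G x))\<^sup>2) \<longlonglongrightarrow> 0"
proof -
  define a where "a k = (LINT x|lebesgue_on U. (norm (\<phi> k x - u x))\<^sup>2)" for k
  define b where "b k = (LINT x|lebesgue_on U. (norm (gradient (\<phi> k) x - G x))\<^sup>2)" for k
  have nn: "a k \<ge> 0" "b k \<ge> 0" for k
    unfolding a_def b_def by (rule Bochner_Integration.integral_nonneg, simp)+
  have h: "H1_norm U (\<lambda>x. \<phi> k x - u x) = sqrt (a k + b k)" for k
    using H1_norm_eq[OF U(1) has_weak_gradient_diff[OF U(1) test_function_facts(3)[OF U \<phi>[of k]] u(3)]]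
    by (simp add: a_def b_def)
  have "(\<lambda>k. (H1_norm U (\<lambda>x. \<phi> k x - u x))\<^sup>2) \<longlonglongrightarrow> 0\<^sup>2"
    by (rule tendsto_power[OF lim])
  then have ab: "(\<lambda>k. a k + b k) \<longlonglongrightarrow> 0"
    unfolding h using nn by simp
  have "(\<lambda>k. a k) \<longlonglongrightarrow> 0"
    by (rule Lim_null_comparison[OF always_eventually ab]) (use nn in simp)
  moreover have "(\<lambda>k. b k) \<longlonglongrightarrow> 0"
    by (rule Lim_null_comparison[OF always_eventually ab]) (use nn in simp)
  ultimately show "(\<lambda>k. LINT x|lebesgue_on U. (norm (\<phi> k x - u x))\<^sup>2) \<longlonglongrightarrow> 0"
    and "(\<lambda>k. LINT x|lebesgue_on U. (norm (gradient (\<phi> k) x - G x))\<^sup>2) \<longlonglongrightarrow> 0"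
    unfolding a_def b_def by auto
qed

text \<open>Closedness of the weak gradient: \<open>G\<close> need not be known as a weak gradient
  beforehand, because the defining identity of the \<open>\<phi> k\<close> survives L2 convergence
  against a fixed test function.\<close>

lemma has_weak_gradient_limit:
  fixes U :: "'a::euclidean_space set"
  assumes U: "open U" "bounded U" and \<phi>: "\<And>k. \<phi> k \<in> test_functions U"
    and u: "square_integrable U u" "square_integrable U G"
    and lim: "(\<lambda>k. LINT x|lebesgue_on U. (norm (\<phi> k x - u x))\<^sup>2) \<longlonglongrightarrow> 0"
      "(\<lambda>k. LINT x|lebesgue_on U. (norm (gradient (\<phi> k) x - G x))\<^sup>2) \<longlonglongrightarrow> 0"
  shows "has_weak_gradient U u G" and "(\<lambda>k. H1_norm U (\<lambda>x. \<phi> k x - u x)) \<longlonglongrightarrow> 0"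
proof -
  interpret finite_measure "lebesgue_on U" by (rule finite_measure_lebesgue_on_bounded[OF U])
  note tf = test_function_facts[OF U \<phi>]
  have meas: "u \<in> borel_measurable (lebesgue_on U)" "G \<in> borel_measurable (lebesgue_on U)"
    "\<phi> k \<in> borel_measurable (lebesgue_on U)" "gradient (\<phi> k) \<in> borel_measurable (lebesgue_on U)" for k
    using u tf unfolding square_integrable_iff[OF U(1)] by blast+
  have sqd: "square_integrable U (\<lambda>x. \<phi> k x - u x)" "square_integrable U (\<lambda>x. gradient (\<phi> k) x - G x)" for k
    by (intro square_integrable_diff U tf u)+
  have sqi: "integrable (lebesgue_on U) (\<lambda>x. (norm (\<phi> k x - u x))\<^sup>2)"
    "integrable (lebesgue_on U) (\<lambda>x. (norm (gradient (\<phi> k) x - G x))\<^sup>2)" for k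
    using sqd[of k] unfolding square_integrable_iff[OF U(1)] by blast+
  note li = locally_integrable_if_square_integrable[OF U]
  show w: "has_weak_gradient U u G"
    unfolding has_weak_gradient_iff[OF U(1)]
  proof (intro conjI ballI li(2) u)
    fix \<psi> :: "'a \<Rightarrow> real" and i :: 'a assume \<psi>: "\<psi> \<in> test_functions U" and i: "i \<in> Basis"
    note s = test_functionD[OF \<psi>]
    have bs: "bounded {x. \<psi> x \<noteq> 0}"
      using \<psi> compactly_contained_bounded unfolding test_functions_iff by blast
    have bd: "bounded {x. dir_deriv i \<psi> x \<noteq> 0}"
      by (rule bounded_subset[OF bounded_closure[OF bs] dir_deriv_support(1)])
    have c: "continuous_on UNIV \<psi>" "continuous_on UNIV (dir_deriv i \<psi>)"
      using smooth_continuous s smooth_dir_deriv[OF s i] by blast+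
    obtain B where B: "\<And>x. norm (\<psi> x) \<le> B"
      using bounded_range_continuous_bounded_support[OF c(1) bs] by blast
    obtain B' where B': "\<And>x. norm (dir_deriv i \<psi> x) \<le> B'"
      using bounded_range_continuous_bounded_support[OF c(2) bd] by blast
    have lim_v: "(\<lambda>k. LINT x|lebesgue_on U. \<phi> k x * dir_deriv i \<psi> x) \<longlonglongrightarrow> (LINT x|lebesgue_on U. u x * dir_deriv i \<psi> x)"
      by (rule L2_tendsto_integral_times[OF meas(3,1) continuous_borel_measurable_lebesgue_on[OF c(2)]
            sqi(1) li(1)[OF u(1)] lim(1)]) (use B' in simp)
    have lim_G: "(\<lambda>k. LINT x|lebesgue_on U. (gradient (\<phi> k) x \<bullet> i) * \<psi> x) \<longlonglongrightarrow> (LINT x|lebesgue_on U. (G x \<bullet> i) * \<psi> x)"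
    proof (rule L2_tendsto_integral_times)
      have le: "(norm (gradient (\<phi> k) x \<bullet> i - G x \<bullet> i))\<^sup>2 \<le> (norm (gradient (\<phi> k) x - G x))\<^sup>2" for k x
        using Basis_le_norm[OF i, of "gradient (\<phi> k) x - G x"]
        by (intro power_mono) (auto simp: inner_diff_left)
      show int: "integrable (lebesgue_on U) (\<lambda>x. (norm (gradient (\<phi> k) x \<bullet> i - G x \<bullet> i))\<^sup>2)" for k
        by (rule Bochner_Integration.integrable_bound[OF sqi(2)[of k]])
           (use meas le in auto)
      show "(\<lambda>k. LINT x|lebesgue_on U. (norm (gradient (\<phi> k) x \<bullet> i - G x \<bullet> i))\<^sup>2) \<longlonglongrightarrow> 0"
      proof (rule Lim_null_comparison[OF always_eventually lim(2)], rule allI)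
        fix k
        have "(LINT x|lebesgue_on U. (norm (gradient (\<phi> k) x \<bullet> i - G x \<bullet> i))\<^sup>2)
            \<le> (LINT x|lebesgue_on U. (norm (gradient (\<phi> k) x - G x))\<^sup>2)"
          by (rule integral_mono[OF int sqi(2) le])
        then show "norm (LINT x|lebesgue_on U. (norm (gradient (\<phi> k) x \<bullet> i - G x \<bullet> i))\<^sup>2)
            \<le> (LINT x|lebesgue_on U. (norm (gradient (\<phi> k) x - G x))\<^sup>2)"
          by (simp add: abs_of_nonneg Bochner_Integration.integral_nonneg)
      qed
      show "\<bar>\<psi> x\<bar> \<le> B" for x using B[of x] by simp
      show "integrable (lebesgue_on U) (\<lambda>x. G x \<bullet> i)"
        using li(1)[OF u(2)] by (rule integrable_inner_left)
      show "\<psi> \<in> borel_measurable (lebesgue_on U)" by (rule continuous_borel_measurable_lebesgue_on[OF c(1)])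
    qed (use meas in auto)
    have eq: "(LINT x|lebesgue_on U. \<phi> k x * dir_deriv i \<psi> x)
        = - (LINT x|lebesgue_on U. (gradient (\<phi> k) x \<bullet> i) * \<psi> x)" for k
      using tf(3)[of k] \<psi> i unfolding has_weak_gradient_iff[OF U(1)] by blast
    show "(LINT x|lebesgue_on U. u x * dir_deriv i \<psi> x) = - (LINT x|lebesgue_on U. (G x \<bullet> i) * \<psi> x)"
      by (rule LIMSEQ_unique[OF lim_v]) (unfold eq, rule tendsto_minus[OF lim_G])
  qed
  have "H1_norm U (\<lambda>x. \<phi> k x - u x) = sqrt ((LINT x|lebesgue_on U. (norm (\<phi> k x - u x))\<^sup>2)
      + (LINT x|lebesgue_on U. (norm (gradient (\<phi> k) x - G x))\<^sup>2))" for k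
    using H1_norm_eq[OF U(1) has_weak_gradient_diff[OF U(1) tf(3)[of k] w]] by simp
  moreover have "(\<lambda>k. sqrt ((LINT x|lebesgue_on U. (norm (\<phi> k x - u x))\<^sup>2)
      + (LINT x|lebesgue_on U. (norm (gradient (\<phi> k) x - G x))\<^sup>2))) \<longlonglongrightarrow> sqrt (0 + 0)"
    by (intro tendsto_real_sqrt tendsto_add lim)
  ultimately show "(\<lambda>k. H1_norm U (\<lambda>x. \<phi> k x - u x)) \<longlonglongrightarrow> 0" by simp
qed

section \<open>The chain rule for truncated Sobolev functions\<close>

lemma lipschitz_dir_deriv:
  fixes \<Phi> :: "real \<Rightarrow> real"
  assumes "smooth \<Phi>" and c: "\<And>s. \<bar>dir_deriv 1 \<Phi> s\<bar> \<le> c"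
  shows "\<bar>\<Phi> a - \<Phi> b\<bar> \<le> c * \<bar>a - b\<bar>"
proof -
  have "\<bar>\<Phi> a - \<Phi> b\<bar> \<le> c * \<bar>a - b\<bar>" if ba: "b < a" for a b
  proof -
    obtain t where "\<Phi> (b + (a - b) *\<^sub>R 1) - \<Phi> b = (a - b) * dir_deriv 1 \<Phi> (b + t *\<^sub>R 1)"
      by (rule mvt_along_line[OF smooth_differentiable[OF assms(1)], of "a - b" b 1]) (use ba in auto)
    then have "\<bar>\<Phi> a - \<Phi> b\<bar> = (a - b) * \<bar>dir_deriv 1 \<Phi> (b + t *\<^sub>R 1)\<bar>"
      using ba by (simp add: abs_mult)
    also have "\<dots> \<le> (a - b) * c" using c ba by (intro mult_left_mono) auto
    finally show ?thesis using ba by (simp add: mult.commute)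
  qed
  from this[of a b] this[of b a] show ?thesis
    by (cases a b rule: linorder_cases) (auto simp: abs_minus_commute)
qed

lemma smooth_truncate_gradient:
  fixes \<phi> \<eta> :: "'a::euclidean_space \<Rightarrow> real"
  assumes "smooth \<Phi>" "smooth \<phi>" "smooth \<eta>"
  shows "smooth (\<lambda>x. \<Phi> (\<phi> x) * \<eta> x)"
    and "gradient (\<lambda>x. \<Phi> (\<phi> x) * \<eta> x) x
      = (\<eta> x * dir_deriv 1 \<Phi> (\<phi> x)) *\<^sub>R gradient \<phi> x + \<Phi> (\<phi> x) *\<^sub>R gradient \<eta> x"
proof -
  note s = smooth_compose[OF assms(1,2)]
  show "smooth (\<lambda>x. \<Phi> (\<phi> x) * \<eta> x)" by (rule smooth_mult[OF s assms(3)])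
  show "gradient (\<lambda>x. \<Phi> (\<phi> x) * \<eta> x) x
      = (\<eta> x * dir_deriv 1 \<Phi> (\<phi> x)) *\<^sub>R gradient \<phi> x + \<Phi> (\<phi> x) *\<^sub>R gradient \<eta> x"
  proof (rule gradient_eqI)
    note d = smooth_differentiable[OF assms(2)] smooth_differentiable[OF assms(3)]
    have "((\<lambda>x. \<Phi> (\<phi> x)) has_derivative (\<lambda>h. dir_deriv 1 \<Phi> (\<phi> x) * dir_deriv h \<phi> x)) (at x)"
      by (rule has_derivative_compose_real[OF smooth_differentiable[OF assms(1)] d(1)])
    from has_derivative_mult[OF this has_derivative_gradient[OF d(2)]]
    show "((\<lambda>x. \<Phi> (\<phi> x) * \<eta> x) has_derivative
        (\<bullet>) ((\<eta> x * dir_deriv 1 \<Phi> (\<phi> x)) *\<^sub>R gradient \<phi> x + \<Phi> (\<phi> x) *\<^sub>R gradient \<eta> x)) (at x)"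
      by (rule has_derivative_eq_rhs)
         (simp add: fun_eq_iff inner_add_left gradient_inner[OF d(1)] mult_ac)
  qed
qed

text \<open>The chain and product rules are proved on approximating test functions and carried to
  the limit by \<open>has_weak_gradient_limit\<close>. The approximants are returned explicitly, not
  just membership in a closure, so that a caller can check that they are still one near
  \<open>K\<close>. \<open>\<Phi> 0 = 0\<close> keeps their supports inside those of the
  \<open>\<phi> k\<close>.\<close>

lemma H1_truncate:
  fixes U :: "'a::euclidean_space set" and \<phi> :: "nat \<Rightarrow> 'a \<Rightarrow> real"
  assumes U: "open U" "bounded U" and \<phi>: "\<And>k. \<phi> k \<in> test_functions U"
    and u: "square_integrable U u" "square_integrable U G" "has_weak_gradient U u G"
    and lim: "(\<lambda>k. H1_norm U (\<lambda>x. \<phi> k x - u x)) \<longlonglongrightarrow> 0"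
    and \<Phi>: "smooth \<Phi>" "\<Phi> 0 = 0" "\<And>s. \<bar>dir_deriv 1 \<Phi> s\<bar> \<le> c" "\<And>s. \<bar>\<Phi> s\<bar> \<le> b"
    and \<eta>: "smooth \<eta>" "\<And>x. \<bar>\<eta> x\<bar> \<le> 1" "\<And>x. norm (gradient \<eta> x) \<le> B"
  obtains r :: "nat \<Rightarrow> nat" where
    "\<And>k. (\<lambda>x. \<Phi> (\<phi> k x) * \<eta> x) \<in> test_functions U"
    "(\<lambda>k. H1_norm U (\<lambda>x. \<Phi> (\<phi> (r k) x) * \<eta> x - \<Phi> (u x) * \<eta> x)) \<longlonglongrightarrow> 0"
    "has_weak_gradient U (\<lambda>x. \<Phi> (u x) * \<eta> x) (\<lambda>x. (\<eta> x * dir_deriv 1 \<Phi> (u x)) *\<^sub>R G x + \<Phi> (u x) *\<^sub>R gradient \<eta> x)"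
    "(\<lambda>x. \<Phi> (u x) * \<eta> x) \<in> H1 U"
proof -
  interpret finite_measure "lebesgue_on U" by (rule finite_measure_lebesgue_on_bounded[OF U])
  let ?L = "lebesgue_on U"
  define \<psi> where "\<psi> k = (\<lambda>x. \<Phi> (\<phi> k x) * \<eta> x)" for k
  define v where "v = (\<lambda>x. \<Phi> (u x) * \<eta> x)"
  define H where "H = (\<lambda>x. (\<eta> x * dir_deriv 1 \<Phi> (u x)) *\<^sub>R G x + \<Phi> (u x) *\<^sub>R gradient \<eta> x)"
  note tf = test_function_facts[OF U \<phi>]
  have s\<phi>: "smooth (\<phi> k)" for k by (rule test_functionD[OF \<phi>])
  have \<psi>: "\<psi> k \<in> test_functions U" for k
    unfolding test_functions_iff
  proof
    show "smooth (\<psi> k)" unfolding \<psi>_def by (rule smooth_truncate_gradient(1)[OF \<Phi>(1) s\<phi> \<eta>(1)])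
    have "{x. \<psi> k x \<noteq> 0} \<subseteq> {x. \<phi> k x \<noteq> 0}" unfolding \<psi>_def using \<Phi>(2) by auto
    then have "{x. \<psi> k x \<noteq> 0} \<subseteq> closure {x. \<phi> k x \<noteq> 0}" using closure_subset by blast
    then show "compactly_contained {x. \<psi> k x \<noteq> 0} U"
      using \<phi>[of k] unfolding test_functions_iff
      by (intro compactly_containedI[of _ "closure {x. \<phi> k x \<noteq> 0}"]) (auto simp: compactly_contained_def)
  qed
  have um: "u \<in> borel_measurable ?L" and Gm: "G \<in> borel_measurable ?L"
    using u unfolding square_integrable_iff[OF U(1)] by blast+
  have c\<Phi>: "continuous_on UNIV \<Phi>" "continuous_on UNIV (dir_deriv 1 \<Phi>)"
    using smooth_continuous[OF \<Phi>(1)] smooth_continuous[OF smooth_dir_deriv[OF \<Phi>(1)]] by auto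
  have \<Phi>m: "(\<lambda>x. \<Phi> (u x)) \<in> borel_measurable ?L" "(\<lambda>x. dir_deriv 1 \<Phi> (u x)) \<in> borel_measurable ?L"
    by (rule measurable_compose[OF um borel_measurable_continuous_onI[OF c\<Phi>(1)]])
       (rule measurable_compose[OF um borel_measurable_continuous_onI[OF c\<Phi>(2)]])
  have \<eta>m: "\<eta> \<in> borel_measurable ?L" "gradient \<eta> \<in> borel_measurable ?L"
    using continuous_borel_measurable_lebesgue_on smooth_continuous[OF \<eta>(1)]
      continuous_gradient[OF smooth_cd1[OF \<eta>(1)]] by blast+
  have c0: "c \<ge> 0" using \<Phi>(3)[of 0] by linarith
  have b0: "b \<ge> 0" using \<Phi>(4)[of 0] by linarith
  have B0: "B \<ge> 0" using \<eta>(3)[of 0] norm_ge_zero order_trans by blast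
  have sqv: "square_integrable U v"
    unfolding v_def
  proof (rule square_integrable_bounded[OF U])
    show "(\<lambda>x. \<Phi> (u x) * \<eta> x) \<in> borel_measurable ?L" using \<Phi>m \<eta>m by simp
    show "norm (\<Phi> (u x) * \<eta> x) \<le> b * 1" for x
      unfolding real_norm_def abs_mult by (intro mult_mono \<Phi> \<eta> b0) auto
  qed
  have sqH: "square_integrable U H"
    unfolding H_def
  proof (intro square_integrable_add[OF U(1)])
    show "square_integrable U (\<lambda>x. (\<eta> x * dir_deriv 1 \<Phi> (u x)) *\<^sub>R G x)"
    proof (rule square_integrable_scaleR[OF U(1) u(2)])
      show "\<bar>\<eta> x * dir_deriv 1 \<Phi> (u x)\<bar> \<le> 1 * c" for x
        unfolding abs_mult by (intro mult_mono \<Phi> \<eta>) auto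
    qed (use \<Phi>m \<eta>m in simp)
    show "square_integrable U (\<lambda>x. \<Phi> (u x) *\<^sub>R gradient \<eta> x)"
      by (rule square_integrable_scaleR[OF U(1) square_integrable_bounded[OF U \<eta>m(2) \<eta>(3)] \<Phi>m(1) \<Phi>(4)])
  qed
  note lims = H1_norm_tendsto_imp[OF U \<phi> u lim]
  have sqd: "square_integrable U (\<lambda>x. \<phi> k x - u x)" "square_integrable U (\<lambda>x. gradient (\<phi> k) x - G x)"
    "square_integrable U (\<lambda>x. \<psi> k x - v x)" "square_integrable U (\<lambda>x. gradient (\<psi> k) x - H x)" for k
    by (intro square_integrable_diff U tf u sqv sqH test_function_facts[OF U \<psi>])+
  have sqi: "integrable ?L (\<lambda>x. (norm (\<phi> k x - u x))\<^sup>2)" "integrable ?L (\<lambda>x. (norm (gradient (\<phi> k) x - G x))\<^sup>2)"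
    "integrable ?L (\<lambda>x. (norm (\<psi> k x - v x))\<^sup>2)" "integrable ?L (\<lambda>x. (norm (gradient (\<psi> k) x - H x))\<^sup>2)"
    and sqm: "(\<lambda>x. \<phi> k x - u x) \<in> borel_measurable ?L" for k
    using sqd[of k] unfolding square_integrable_iff[OF U(1)] by blast+
  have Gi: "integrable ?L (\<lambda>x. (norm (G x))\<^sup>2)"
    using u(2) unfolding square_integrable_iff[OF U(1)] by blast
  have \<phi>m: "\<phi> k \<in> borel_measurable ?L" for k
    using tf(1) unfolding square_integrable_iff[OF U(1)] by blast
  \<comment> \<open>Convergence in L2 alone does not control
    \<open>dir_deriv 1 \<Phi> (\<phi> k x)\<close> pointwise; along a subsequence that converges
    almost everywhere, continuity of the derivative does.\<close>
  have "\<exists>r::nat \<Rightarrow> nat. strict_mono r \<and> (AE x in ?L. (\<lambda>n. \<phi> (r n) x - u x) \<longlonglongrightarrow> 0)"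
    by (rule tendsto_L1_AE_subseq[OF integrable_if_square_integrable[OF sqm sqi(1)]
          L2_tendsto_imp_L1_tendsto[OF sqm sqi(1) lims(1)]])
  then obtain r :: "nat \<Rightarrow> nat" where r: "strict_mono r" "AE x in ?L. (\<lambda>n. \<phi> (r n) x - u x) \<longlonglongrightarrow> 0"
    by blast
  have lim1: "(\<lambda>k. LINT x|?L. (norm (\<phi> (r k) x - u x))\<^sup>2) \<longlonglongrightarrow> 0"
    using LIMSEQ_subseq_LIMSEQ[OF lims(1) r(1)] by (simp add: o_def)
  have lim2: "(\<lambda>k. LINT x|?L. (norm (gradient (\<phi> (r k)) x - G x))\<^sup>2) \<longlonglongrightarrow> 0"
    using LIMSEQ_subseq_LIMSEQ[OF lims(2) r(1)] by (simp add: o_def)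
  have lip: "\<bar>\<Phi> a - \<Phi> a'\<bar> \<le> c * \<bar>a - a'\<bar>" for a a' by (rule lipschitz_dir_deriv[OF \<Phi>(1,3)])
  have \<psi>v: "(\<lambda>k. LINT x|?L. (norm (\<psi> (r k) x - v x))\<^sup>2) \<longlonglongrightarrow> 0"
  proof (rule Lim_null_comparison[OF always_eventually tendsto_mult_right_zero[OF lim1, of "c\<^sup>2"]], rule allI)
    fix k
    have "(LINT x|?L. (norm (\<psi> (r k) x - v x))\<^sup>2) \<le> (LINT x|?L. c\<^sup>2 * (norm (\<phi> (r k) x - u x))\<^sup>2)"
    proof (rule integral_mono)
      fix x
      have "\<bar>\<psi> (r k) x - v x\<bar> = \<bar>\<Phi> (\<phi> (r k) x) - \<Phi> (u x)\<bar> * \<bar>\<eta> x\<bar>"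
        unfolding \<psi>_def v_def by (simp add: abs_mult[symmetric] left_diff_distrib)
      also have "\<dots> \<le> (c * \<bar>\<phi> (r k) x - u x\<bar>) * 1"
        by (intro mult_mono lip \<eta>) (use c0 in auto)
      finally show "(norm (\<psi> (r k) x - v x))\<^sup>2 \<le> c\<^sup>2 * (norm (\<phi> (r k) x - u x))\<^sup>2"
        unfolding power_mult_distrib[symmetric] by (intro power_mono) auto
    qed (use sqi in auto)
    then show "norm (LINT x|?L. (norm (\<psi> (r k) x - v x))\<^sup>2) \<le> c\<^sup>2 * (LINT x|?L. (norm (\<phi> (r k) x - u x))\<^sup>2)"
      by (simp add: abs_of_nonneg Bochner_Integration.integral_nonneg)
  qed
  \<comment> \<open>The only error term that does not follow from L2 convergence: the fixed function
    \<open>G\<close> times a difference of slopes. It tends to zero by dominated convergence with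
    majorant \<open>(2 * c)^2\<close> times the squared norm of \<open>G\<close>.\<close>
  define D where "D k x = (dir_deriv 1 \<Phi> (\<phi> (r k) x) - dir_deriv 1 \<Phi> (u x))\<^sup>2 * (norm (G x))\<^sup>2" for k x
  have Dm: "D k \<in> borel_measurable ?L" for k
    unfolding D_def using \<Phi>m Gm measurable_compose[OF \<phi>m borel_measurable_continuous_onI[OF c\<Phi>(2)]] by simp
  have Dle: "norm (D k x) \<le> (2 * c)\<^sup>2 * (norm (G x))\<^sup>2" for k x
  proof -
    have "\<bar>dir_deriv 1 \<Phi> (\<phi> (r k) x) - dir_deriv 1 \<Phi> (u x)\<bar> \<le> 2 * c"
      using \<Phi>(3)[of "\<phi> (r k) x"] \<Phi>(3)[of "u x"] by linarith
    then have "\<bar>dir_deriv 1 \<Phi> (\<phi> (r k) x) - dir_deriv 1 \<Phi> (u x)\<bar>\<^sup>2 \<le> (2 * c)\<^sup>2"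
      by (intro power_mono) auto
    then show ?thesis unfolding D_def by (simp add: abs_mult mult_right_mono)
  qed
  have wi: "integrable ?L (\<lambda>x. (2 * c)\<^sup>2 * (norm (G x))\<^sup>2)" using Gi by simp
  have Di: "integrable ?L (D k)" for k
    by (rule Bochner_Integration.integrable_bound[OF wi Dm]) (use Dle in simp)
  have Dlim: "(\<lambda>k. LINT x|?L. D k x) \<longlonglongrightarrow> 0"
  proof -
    have "(\<lambda>k. LINT x|?L. D k x) \<longlonglongrightarrow> (LINT x|?L. 0)"
    proof (rule integral_dominated_convergence[OF _ Dm wi])
      show "AE x in ?L. (\<lambda>k. D k x) \<longlonglongrightarrow> 0"
        using r(2)
      proof eventually_elim
        fix x assume "(\<lambda>n. \<phi> (r n) x - u x) \<longlonglongrightarrow> 0"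
        then have *: "(\<lambda>n. \<phi> (r n) x) \<longlonglongrightarrow> u x" by (rule LIM_zero_cancel)
        have "isCont (dir_deriv 1 \<Phi>) (u x)"
          using c\<Phi>(2) by (simp add: continuous_on_eq_continuous_at)
        then have "(\<lambda>n. dir_deriv 1 \<Phi> (\<phi> (r n) x)) \<longlonglongrightarrow> dir_deriv 1 \<Phi> (u x)"
          using * by (rule isCont_tendsto_compose)
        then have "(\<lambda>k. D k x) \<longlonglongrightarrow> (dir_deriv 1 \<Phi> (u x) - dir_deriv 1 \<Phi> (u x))\<^sup>2 * (norm (G x))\<^sup>2"
          unfolding D_def by (intro tendsto_intros)
        then show "(\<lambda>k. D k x) \<longlonglongrightarrow> 0" by simp
      qed
    qed (use Dle in auto)
    then show ?thesis by simp
  qed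
  have grad\<psi>: "gradient (\<psi> k) x = (\<eta> x * dir_deriv 1 \<Phi> (\<phi> k x)) *\<^sub>R gradient (\<phi> k) x + \<Phi> (\<phi> k x) *\<^sub>R gradient \<eta> x" for k x
    unfolding \<psi>_def by (rule smooth_truncate_gradient(2)[OF \<Phi>(1) s\<phi> \<eta>(1)])
  \<comment> \<open>Majorant of the squared gradient error. The error is split into \<open>X\<close>
    (gradients differ), \<open>Y\<close> (slopes differ) and \<open>Z\<close> (values differ, by the
    Lipschitz bound); the factors 2, 4, 4 come from applying \<open>norm_sum_sq_le\<close>
    twice.\<close>
  define R where "R k x = 2 * c\<^sup>2 * (norm (gradient (\<phi> (r k)) x - G x))\<^sup>2 + (4 * D k x + 4 * (B * c)\<^sup>2 * (norm (\<phi> (r k) x - u x))\<^sup>2)" for k x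
  have Rle: "(norm (gradient (\<psi> (r k)) x - H x))\<^sup>2 \<le> R k x" for k x
  proof -
    define X where "X = (\<eta> x * dir_deriv 1 \<Phi> (\<phi> (r k) x)) *\<^sub>R (gradient (\<phi> (r k)) x - G x)"
    define Y where "Y = (\<eta> x * (dir_deriv 1 \<Phi> (\<phi> (r k) x) - dir_deriv 1 \<Phi> (u x))) *\<^sub>R G x"
    define Z where "Z = (\<Phi> (\<phi> (r k) x) - \<Phi> (u x)) *\<^sub>R gradient \<eta> x"
    have "gradient (\<psi> (r k)) x - H x = X + (Y + Z)"
      unfolding grad\<psi> H_def X_def Y_def Z_def by (simp add: algebra_simps)
    then have "(norm (gradient (\<psi> (r k)) x - H x))\<^sup>2 \<le> 2 * (norm X)\<^sup>2 + 2 * (norm (Y + Z))\<^sup>2"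
      using norm_sum_sq_le(1)[of X "Y + Z"] by simp
    also have "(norm (Y + Z))\<^sup>2 \<le> 2 * (norm Y)\<^sup>2 + 2 * (norm Z)\<^sup>2" by (rule norm_sum_sq_le(1))
    finally have le: "(norm (gradient (\<psi> (r k)) x - H x))\<^sup>2 \<le> 2 * (norm X)\<^sup>2 + (4 * (norm Y)\<^sup>2 + 4 * (norm Z)\<^sup>2)" by simp
    have "norm X \<le> 1 * c * norm (gradient (\<phi> (r k)) x - G x)"
      unfolding X_def norm_scaleR abs_mult by (intro mult_mono \<eta> \<Phi>) (use c0 in auto)
    then have X: "(norm X)\<^sup>2 \<le> c\<^sup>2 * (norm (gradient (\<phi> (r k)) x - G x))\<^sup>2"
      unfolding power_mult_distrib[symmetric] by (intro power_mono) auto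
    have "norm Y \<le> 1 * \<bar>dir_deriv 1 \<Phi> (\<phi> (r k) x) - dir_deriv 1 \<Phi> (u x)\<bar> * norm (G x)"
      unfolding Y_def norm_scaleR abs_mult by (intro mult_mono \<eta>) auto
    then have "(norm Y)\<^sup>2 \<le> (\<bar>dir_deriv 1 \<Phi> (\<phi> (r k) x) - dir_deriv 1 \<Phi> (u x)\<bar> * norm (G x))\<^sup>2"
      by (intro power_mono) auto
    then have Y: "(norm Y)\<^sup>2 \<le> D k x" unfolding D_def by (simp add: power_mult_distrib)
    have "norm Z \<le> (c * \<bar>\<phi> (r k) x - u x\<bar>) * B"
      unfolding Z_def norm_scaleR by (intro mult_mono lip \<eta>) (use c0 in auto)
    then have Z: "(norm Z)\<^sup>2 \<le> (B * c)\<^sup>2 * (norm (\<phi> (r k) x - u x))\<^sup>2"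
      unfolding power_mult_distrib[symmetric] by (intro power_mono) (auto simp: mult_ac)
    show ?thesis unfolding R_def using le X Y Z by linarith
  qed
  have Ri: "integrable ?L (R k)" for k
    unfolding R_def by (intro Bochner_Integration.integrable_add integrable_mult_right sqi Di)
  have Rint: "(LINT x|?L. R k x) = 2 * c\<^sup>2 * (LINT x|?L. (norm (gradient (\<phi> (r k)) x - G x))\<^sup>2) +
      (4 * (LINT x|?L. D k x) + 4 * (B * c)\<^sup>2 * (LINT x|?L. (norm (\<phi> (r k) x - u x))\<^sup>2))" for k
    unfolding R_def using sqi Di by (simp add: Bochner_Integration.integral_add)
  have "(\<lambda>k. 2 * c\<^sup>2 * (LINT x|?L. (norm (gradient (\<phi> (r k)) x - G x))\<^sup>2) +
      (4 * (LINT x|?L. D k x) + 4 * (B * c)\<^sup>2 * (LINT x|?L. (norm (\<phi> (r k) x - u x))\<^sup>2))) \<longlonglongrightarrow>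
      2 * c\<^sup>2 * 0 + (4 * 0 + 4 * (B * c)\<^sup>2 * 0)"
    by (intro tendsto_intros lim1 lim2 Dlim)
  then have Rlim: "(\<lambda>k. LINT x|?L. R k x) \<longlonglongrightarrow> 0" unfolding Rint by simp
  have \<psi>H: "(\<lambda>k. LINT x|?L. (norm (gradient (\<psi> (r k)) x - H x))\<^sup>2) \<longlonglongrightarrow> 0"
  proof (rule Lim_null_comparison[OF always_eventually Rlim], rule allI)
    fix k
    have "(LINT x|?L. (norm (gradient (\<psi> (r k)) x - H x))\<^sup>2) \<le> (LINT x|?L. R k x)"
      by (rule integral_mono[OF sqi(4) Ri Rle])
    then show "norm (LINT x|?L. (norm (gradient (\<psi> (r k)) x - H x))\<^sup>2) \<le> (LINT x|?L. R k x)"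
      by (simp add: abs_of_nonneg Bochner_Integration.integral_nonneg)
  qed
  note res = has_weak_gradient_limit[OF U \<psi> sqv sqH \<psi>v \<psi>H]
  show thesis
  proof (rule that)
    show "(\<lambda>x. \<Phi> (\<phi> k x) * \<eta> x) \<in> test_functions U" for k using \<psi>[of k] by (simp add: \<psi>_def)
    show "(\<lambda>k. H1_norm U (\<lambda>x. \<Phi> (\<phi> (r k) x) * \<eta> x - \<Phi> (u x) * \<eta> x)) \<longlonglongrightarrow> 0"
      using res(2) by (simp add: \<psi>_def v_def)
    show "has_weak_gradient U (\<lambda>x. \<Phi> (u x) * \<eta> x)
        (\<lambda>x. (\<eta> x * dir_deriv 1 \<Phi> (u x)) *\<^sub>R G x + \<Phi> (u x) *\<^sub>R gradient \<eta> x)"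
      using res(1) by (simp add: v_def H_def)
    show "(\<lambda>x. \<Phi> (u x) * \<eta> x) \<in> H1 U"
      using res(1) sqv sqH unfolding H1_def v_def by blast
  qed
qed

subsection \<open>Fields and perimeter\<close>

lemma cd1I:
  fixes f :: "'a::euclidean_space \<Rightarrow> 'b::real_normed_vector"
  assumes "\<And>x. (f has_derivative f' x) (at x)"
    and "\<And>i. i \<in> Basis \<Longrightarrow> continuous_on UNIV (\<lambda>x. f' x i)"
  shows "continuously_diff 1 f"
  using continuously_diff_SucI[of f f' 0] assms by simp

lemma cd1_scaleR:
  fixes f :: "'a::euclidean_space \<Rightarrow> real" and T :: "'a \<Rightarrow> 'b::real_normed_vector"
  assumes "continuously_diff 1 f" "continuously_diff 1 T"
  shows "continuously_diff 1 (\<lambda>x. f x *\<^sub>R T x)"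
proof (rule cd1I)
  show "((\<lambda>x. f x *\<^sub>R T x) has_derivative (\<lambda>h. f x *\<^sub>R dir_deriv h T x + dir_deriv h f x *\<^sub>R T x)) (at x)" for x
    by (rule has_derivative_scaleR; rule dir_deriv_has_derivative; rule cd1_differentiable; rule assms)
  show "continuous_on UNIV (\<lambda>x. f x *\<^sub>R dir_deriv i T x + dir_deriv i f x *\<^sub>R T x)" if "i \<in> Basis" for i
    by (intro continuous_on_add continuous_on_scaleR cd1_continuous cd1_dir_deriv_continuous assms that)
qed

lemma cd1_translate:
  fixes f :: "'a::euclidean_space \<Rightarrow> 'b::real_normed_vector"
  assumes "continuously_diff 1 f"
  shows "continuously_diff 1 (\<lambda>x. f (x + z))" and "dir_deriv i (\<lambda>x. f (x + z)) x = dir_deriv i f (x + z)"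
proof -
  have d: "((\<lambda>x. f (x + z)) has_derivative (\<lambda>h. dir_deriv h f (x + z))) (at x)" for x
  proof -
    have "((\<lambda>x. x + z) has_derivative (\<lambda>h. h)) (at x)" by (auto intro!: derivative_eq_intros)
    from has_derivative_compose[OF this dir_deriv_has_derivative[OF cd1_differentiable[OF assms]]]
    show ?thesis .
  qed
  show "dir_deriv i (\<lambda>x. f (x + z)) x = dir_deriv i f (x + z)" by (rule dir_deriv_eq[OF d])
  show "continuously_diff 1 (\<lambda>x. f (x + z))"
  proof (rule cd1I[OF d])
    fix i :: 'a assume "i \<in> Basis"
    then have "continuous_on UNIV (dir_deriv i f)" by (rule cd1_dir_deriv_continuous[OF assms])
    then show "continuous_on UNIV (\<lambda>x. dir_deriv i f (x + z))"
      by (rule continuous_on_compose2) (auto intro: continuous_intros)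
  qed
qed

lemma divergence_scaleR:
  fixes f :: "'a::euclidean_space \<Rightarrow> real" and T :: "'a \<Rightarrow> 'a"
  assumes "f differentiable (at x)" "T differentiable (at x)"
  shows "divergence (\<lambda>x. f x *\<^sub>R T x) x = f x * divergence T x + gradient f x \<bullet> T x"
proof -
  have "dir_deriv i (\<lambda>x. f x *\<^sub>R T x) x = f x *\<^sub>R dir_deriv i T x + dir_deriv i f x *\<^sub>R T x" for i
    by (rule dir_deriv_eq[OF has_derivative_scaleR[OF dir_deriv_has_derivative[OF assms(1)]
            dir_deriv_has_derivative[OF assms(2)]]])
  then show ?thesis
    unfolding divergence_def gradient_def
    by (simp add: inner_add_left sum.distrib sum_distrib_left inner_sum_left inner_commute[of "T x"])
qed

lemma divergence_add:
  assumes "S differentiable (at x)" "T differentiable (at x)"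
  shows "divergence (\<lambda>x. S x + T x) x = divergence S x + divergence T x"
proof -
  have "dir_deriv i (\<lambda>x. S x + T x) x = dir_deriv i S x + dir_deriv i T x" for i
    by (rule dir_deriv_eq[OF has_derivative_add[OF dir_deriv_has_derivative[OF assms(1)]
            dir_deriv_has_derivative[OF assms(2)]]])
  then show ?thesis unfolding divergence_def by (simp add: inner_add_left sum.distrib)
qed

lemma divergence_continuous:
  assumes "continuously_diff 1 T"
  shows "continuous_on UNIV (divergence T)"
  unfolding divergence_def[abs_def]
  by (intro continuous_on_sum continuous_on_inner cd1_dir_deriv_continuous[OF assms] continuous_on_const)

lemma divergence_support: "{x. divergence T x \<noteq> 0} \<subseteq> closure {x. T x \<noteq> 0}"
proof -
  have "dir_deriv i T x = 0" if "x \<notin> closure {x. T x \<noteq> 0}" for x i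
    using dir_deriv_zero_outside[OF that] .
  then have "divergence T x = 0" if "x \<notin> closure {x. T x \<noteq> 0}" for x
    using that by (simp add: divergence_def)
  then show ?thesis by blast
qed

lemma perimeter_fieldsI:
  assumes "continuously_diff 1 T" "bounded {x. T x \<noteq> 0}" "\<And>x. norm (T x) \<le> 1"
  shows "T \<in> perimeter_fields"
proof -
  have "compactly_contained {x. T x \<noteq> 0} UNIV"
    using assms(2) by (simp add: compactly_contained_def compact_closure)
  then show ?thesis unfolding perimeter_fields_def using assms by blast
qed

lemma perimeter_fieldsD:
  assumes "T \<in> perimeter_fields"
  shows "continuously_diff 1 T" "bounded {x. T x \<noteq> 0}" "norm (T x) \<le> 1" "T differentiable (at x)"
    "continuous_on UNIV (divergence T)" "integrable lborel (divergence T)" "\<exists>B. \<forall>x. \<bar>divergence T x\<bar> \<le> B"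
proof -
  show *: "continuously_diff 1 T" "bounded {x. T x \<noteq> 0}" "norm (T x) \<le> 1"
    using assms compactly_contained_bounded unfolding perimeter_fields_def by blast+
  show "T differentiable (at x)" by (rule cd1_differentiable[OF *(1)])
  show c: "continuous_on UNIV (divergence T)" by (rule divergence_continuous[OF *(1)])
  have b: "bounded {x. divergence T x \<noteq> 0}"
    by (rule bounded_subset[OF bounded_closure[OF *(2)] divergence_support])
  show "integrable lborel (divergence T)" by (rule integrable_continuous_bounded_support[OF c b])
  show "\<exists>B. \<forall>x. \<bar>divergence T x\<bar> \<le> B"
    using bounded_range_continuous_bounded_support[OF c b] by (metis real_norm_def)
qed

text \<open>A perimeter bound as a family of real inequalities, so that contributions of fields can
  be added and subtracted. It also makes sense for sets of infinite volume: the whole space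
  satisfies it with bound 0 although \<open>perimeter UNIV\<close> is infinite, its indicator not
  being integrable.\<close>

definition perimeter_le :: "'a::euclidean_space set \<Rightarrow> real \<Rightarrow> bool"
  where "perimeter_le E P \<longleftrightarrow> (\<forall>T\<in>perimeter_fields. (LINT x|lborel. indicator E x * divergence T x) \<le> P)"

lemma zero_field: "(\<lambda>x. 0) \<in> perimeter_fields"
  by (rule perimeter_fieldsI) auto

lemma perimeter_le_nonneg:
  assumes "perimeter_le E P" shows "P \<ge> 0"
proof -
  have "divergence (\<lambda>x. 0::'a) = (\<lambda>x. 0)"
    by (simp add: divergence_def[abs_def] dir_deriv_eq[OF has_derivative_const])
  then show ?thesis using assms zero_field unfolding perimeter_le_def by fastforce
qed

lemma total_variation_le_iff:
  fixes E :: "'a::euclidean_space set"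
  assumes E: "E \<in> sets borel" and P: "P \<ge> 0"
  shows "total_variation (indicator E) \<le> ennreal P \<longleftrightarrow> perimeter_le E P"
proof -
  have "(LINT x|lebesgue. indicator E x * divergence T x) = (LINT x|lborel. indicator E x * divergence T x)"
    if "T \<in> perimeter_fields" for T
    using borel_measurable_continuous_onI[OF perimeter_fieldsD(5)[OF that]] E
    by (intro integral_completion) simp
  then show ?thesis
    unfolding total_variation_def SUP_le_iff perimeter_le_def using P by (simp add: ennreal_le_iff)
qed

text \<open>A bounded Borel set has finite volume, so membership of its indicator in
  \<open>BV\<close> depends on the total variation only and the case distinction in
  \<open>perimeter\<close> collapses.\<close>

lemma perimeter_le_ennreal_iff:
  fixes E :: "'a::euclidean_space set"
  assumes E: "E \<in> sets borel" "bounded E" and P: "P \<ge> 0"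
  shows "perimeter E \<le> ennreal P \<longleftrightarrow> perimeter_le E P"
proof -
  have "emeasure lborel E < \<infinity>" using emeasure_bounded_finite[OF E(2)] .
  then have i: "integrable lborel (indicator E :: 'a \<Rightarrow> real)"
    using E by (intro integrable_real_indicator) auto
  then have "integrable lebesgue (indicator E :: 'a \<Rightarrow> real)"
    using integrable_completion[of "indicator E :: 'a \<Rightarrow> real" lborel] E by simp
  then have p: "perimeter E = (if total_variation (indicator E) < \<infinity> then total_variation (indicator E) else \<infinity>)"
    by (simp add: perimeter_def BV_def)
  have "perimeter E = total_variation (indicator E)"
    unfolding p by (cases "total_variation (indicator E :: 'a \<Rightarrow> real)") auto
  then show ?thesis using total_variation_le_iff[OF E(1) P] by simp
qed

lemma integral_divergence_eq_0:
  fixes T :: "'a::euclidean_space \<Rightarrow> 'a"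
  assumes "T \<in> perimeter_fields"
  shows "(LINT x|lborel. divergence T x) = 0"
proof -
  note T = perimeter_fieldsD[OF assms]
  have c: "continuously_diff 1 (\<lambda>x. T x \<bullet> i)" and d: "dir_deriv j (\<lambda>x. T x \<bullet> i) x = dir_deriv j T x \<bullet> i" for i j x
  proof -
    have h: "((\<lambda>x. T x \<bullet> i) has_derivative (\<lambda>h. dir_deriv h T x \<bullet> i)) (at x)" for x
      by (rule has_derivative_inner_left[OF dir_deriv_has_derivative[OF T(4)]])
    show "continuously_diff 1 (\<lambda>x. T x \<bullet> i)"
      by (rule cd1I[OF h]) (intro continuous_on_inner cd1_dir_deriv_continuous[OF T(1)] continuous_on_const)
    show "dir_deriv j (\<lambda>x. T x \<bullet> i) x = dir_deriv j T x \<bullet> i" by (rule dir_deriv_eq[OF h])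
  qed
  have bs: "bounded {x. T x \<bullet> i \<noteq> 0}" for i
    by (rule bounded_subset[OF T(2)]) auto
  have z: "(LINT x|lborel. dir_deriv i T x \<bullet> i) = 0" if "i \<in> Basis" for i
    using integral_dir_deriv_eq_0[OF c bs that, of i] unfolding d .
  have int: "integrable lborel (\<lambda>x. dir_deriv i T x \<bullet> i)" if i: "i \<in> Basis" for i
    unfolding d[symmetric]
    by (rule integrable_continuous_bounded_support[OF cd1_dir_deriv_continuous[OF c i]
          bounded_subset[OF bounded_closure[OF bs] dir_deriv_support(1)]])
  show ?thesis
    unfolding divergence_def by (subst Bochner_Integration.integral_sum) (use int z in auto)
qed

lemma perimeter_le_UNIV: "perimeter_le UNIV 0"
  unfolding perimeter_le_def by (simp add: integral_divergence_eq_0)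

subsection \<open>Cutting a set of finite perimeter by a ball\<close>

text \<open>The radius is a minimum point of \<open>f t - k t\<close>, where \<open>k\<close> is the slope of the chord.\<close>

lemma exists_radius_small_slope:
  fixes f :: "real \<Rightarrow> real"
  assumes "a < b" and f: "continuous_on {a..b} f"
  obtains s where "a < s" "s \<le> b" "\<And>t. a \<le> t \<Longrightarrow> t < s \<Longrightarrow> f s - f t \<le> (f b - f a) / (b - a) * (s - t)"
proof -
  define k where "k = (f b - f a) / (b - a)"
  define g where "g t = f t - k * t" for t
  have "continuous_on {a..b} g" unfolding g_def by (intro continuous_intros f)
  then obtain m where m: "m \<in> {a..b}" "\<And>t. t \<in> {a..b} \<Longrightarrow> g m \<le> g t"
    using continuous_attains_inf[of "{a..b}" g] assms(1) by auto
  have "k * (b - a) = f b - f a" using assms(1) by (simp add: k_def)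
  then have gab: "g a = g b" by (simp add: g_def algebra_simps)
  \<comment> \<open>\<open>g\<close> has equal values at \<open>a\<close> and \<open>b\<close>, so a
    minimum at the excluded endpoint \<open>a\<close> can be moved to \<open>b\<close>.\<close>
  define s where "s = (if m = a then b else m)"
  have s: "a < s" "s \<le> b" "\<And>t. t \<in> {a..b} \<Longrightarrow> g s \<le> g t"
    using m gab assms(1) unfolding s_def by (auto split: if_splits)
  show thesis
  proof (rule that[OF s(1,2)])
    fix t assume "a \<le> t" "t < s"
    then have "g s \<le> g t" using s by auto
    then show "f s - f t \<le> (f b - f a) / (b - a) * (s - t)"
      unfolding k_def[symmetric] g_def by (simp add: algebra_simps)
  qed
qed

lemma fmeasurable_borel_bounded:
  fixes F :: "'a::euclidean_space set"
  shows "F \<in> sets borel \<Longrightarrow> bounded F \<Longrightarrow> F \<in> fmeasurable lborel"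
  using emeasure_bounded_finite by (intro fmeasurableI) auto

text \<open>Increments of the volume of \<open>E\<close> in a ball are at most those of the volume
  of the ball itself, which is a power of the radius.\<close>

lemma measure_ball_continuous:
  fixes E :: "'a::euclidean_space set"
  assumes E: "E \<in> sets borel" and a: "0 \<le> a"
  shows "continuous_on {a..b} (\<lambda>s. measure lborel (E \<inter> ball 0 s))"
proof -
  have le: "\<bar>measure lborel (E \<inter> ball 0 s) - measure lborel (E \<inter> ball 0 t)\<bar>
      \<le> \<bar>measure lborel (ball (0::'a) s) - measure lborel (ball (0::'a) t)\<bar>" for s t
  proof -
    have "\<bar>measure lborel (E \<inter> ball 0 s) - measure lborel (E \<inter> ball 0 t)\<bar>
      \<le> \<bar>measure lborel (ball (0::'a) s) - measure lborel (ball (0::'a) t)\<bar>" if "t \<le> s" for s t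
    proof -
      have sub: "E \<inter> ball 0 t \<subseteq> E \<inter> ball 0 s" "ball (0::'a) t \<subseteq> ball 0 s" using that by auto
      have fmE: "E \<inter> ball 0 r \<in> fmeasurable lborel" for r
        by (rule fmeasurable_borel_bounded) (use E in \<open>auto intro: bounded_Int\<close>)
      have fmB: "ball (0::'a) r \<in> fmeasurable lborel" for r by (rule fmeasurable_borel_bounded) auto
      have "measure lborel (E \<inter> ball 0 s) - measure lborel (E \<inter> ball 0 t)
          = measure lborel (E \<inter> ball 0 s - E \<inter> ball 0 t)"
        by (rule measurable_measure_Diff[symmetric]) (use fmE sub E in auto)
      also have "\<dots> \<le> measure lborel (ball (0::'a) s - ball 0 t)"
        by (rule measure_mono_fmeasurable) (use E fmB in \<open>auto intro: fmeasurable_Diff\<close>)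
      also have "\<dots> = measure lborel (ball (0::'a) s) - measure lborel (ball (0::'a) t)"
        by (rule measurable_measure_Diff) (use fmB sub in auto)
      finally have "measure lborel (E \<inter> ball 0 s) - measure lborel (E \<inter> ball 0 t)
          \<le> measure lborel (ball (0::'a) s) - measure lborel (ball (0::'a) t)" .
      moreover have "measure lborel (E \<inter> ball 0 t) \<le> measure lborel (E \<inter> ball 0 s)"
        by (rule measure_mono_fmeasurable[OF sub(1) _ fmE]) (use E in auto)
      ultimately show ?thesis by simp
    qed
    from this[of s t] this[of t s] show ?thesis by (cases "t \<le> s") (auto simp: abs_minus_commute)
  qed
  have cb: "continuous_on {a..b} (\<lambda>s. measure lborel (ball (0::'a) s))"
  proof -
    have "continuous_on {a..b} (\<lambda>s. s ^ DIM('a) * measure lborel (ball (0::'a) 1))"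
      by (intro continuous_intros)
    then show ?thesis
    proof (rule continuous_on_eq)
      fix s assume "s \<in> {a..b}"
      then show "s ^ DIM('a) * measure lborel (ball (0::'a) 1) = measure lborel (ball (0::'a) s)"
        using a content_ball_conv_unit_ball[of s "0::'a"] by simp
    qed
  qed
  show ?thesis
    unfolding continuous_on_def
  proof
    fix t assume "t \<in> {a..b}"
    then have "((\<lambda>s. measure lborel (ball (0::'a) s)) \<longlongrightarrow> measure lborel (ball (0::'a) t)) (at t within {a..b})"
      using cb by (simp add: continuous_on_def)
    then have "((\<lambda>s. \<bar>measure lborel (ball (0::'a) s) - measure lborel (ball (0::'a) t)\<bar>) \<longlongrightarrow> 0) (at t within {a..b})"
      using tendsto_rabs_zero LIM_zero by blast
    then have "((\<lambda>s. measure lborel (E \<inter> ball 0 s) - measure lborel (E \<inter> ball 0 t)) \<longlongrightarrow> 0) (at t within {a..b})"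
      by (rule Lim_null_comparison[OF always_eventually, rotated]) (use le in simp)
    then show "((\<lambda>s. measure lborel (E \<inter> ball 0 s)) \<longlongrightarrow> measure lborel (E \<inter> ball 0 t)) (at t within {a..b})"
      by (rule LIM_zero_cancel)
  qed
qed

text \<open>Two fields are glued to \<open>z T1 + (1 - z) T2\<close> with a cutoff \<open>z\<close> of the ball; at a radius as above the
  gradient of \<open>z\<close> contributes only the volume of \<open>E\<close> in the shell divided by its width.\<close>

lemma perimeter_cut:
  fixes E :: "'a::euclidean_space set"
  assumes E: "E \<in> sets borel" and P: "perimeter_le E P" and ab: "0 \<le> a" "a < b"
  shows "\<exists>s. a < s \<and> s \<le> b \<and> (\<forall>T1\<in>perimeter_fields. \<forall>T2\<in>perimeter_fields.
    (LINT x|lborel. indicator (E \<inter> ball 0 s) x * divergence T1 x)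
    + (LINT x|lborel. indicator (E - ball 0 s) x * divergence T2 x)
    \<le> P + 2 * cutoff_slope * (measure lborel (E \<inter> ball 0 b) - measure lborel (E \<inter> ball 0 a)) / (b - a))"
proof -
  define f where "f s = measure lborel (E \<inter> ball 0 s)" for s
  define \<kappa> where "\<kappa> = (f b - f a) / (b - a)"
  obtain s where s: "a < s" "s \<le> b"
    and slope0: "\<And>t. a \<le> t \<Longrightarrow> t < s \<Longrightarrow> f s - f t \<le> (f b - f a) / (b - a) * (s - t)"
    by (rule exists_radius_small_slope[OF ab(2) measure_ball_continuous[OF E ab(1), of b, folded f_def]])
       (rule that, assumption+)
  note slope = slope0[folded \<kappa>_def]
  show ?thesis
  proof (intro exI[of _ s] conjI s ballI)
    fix T1 T2 :: "'a \<Rightarrow> 'a" assume T1: "T1 \<in> perimeter_fields" and T2: "T2 \<in> perimeter_fields"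
    note T1' = perimeter_fieldsD[OF T1] and T2' = perimeter_fieldsD[OF T2]
    \<comment> \<open>Inner radii in \<open>[a, s)\<close> that tend to \<open>s\<close>: the slope
      bound applies to each shell between \<open>t k\<close> and \<open>s\<close>, while the cutoffs
      converge to the indicator of the ball.\<close>
    define t where "t k = s - (s - a) / real (Suc (Suc k))" for k
    have t: "a \<le> t k" "0 \<le> t k" "t k < s" for k
    proof -
      have "(s - a) / real (Suc (Suc k)) \<le> (s - a) / 1" using s by (intro divide_left_mono) auto
      then show "a \<le> t k" "0 \<le> t k" using ab unfolding t_def by auto
      show "t k < s" using s unfolding t_def by simp
    qed
    define z where "z k = cutoff 1 (t k) s (0::'a)" for k
    have z01: "0 \<le> z k x" "z k x \<le> 1" for k x
      unfolding z_def using cutoff_bounds[of 1 "t k" s 0 x] t by auto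
    have zcd: "continuously_diff 1 (z k)" for k
      unfolding z_def by (rule smooth_cd1[OF smooth_cutoff[OF _ t(2,3)]]) simp
    have zm[measurable]: "z k \<in> borel_measurable borel" for k
      by (rule borel_measurable_continuous_onI[OF cd1_continuous[OF zcd]])
    have zlim: "(\<lambda>k. z k x) \<longlonglongrightarrow> indicator (ball 0 s) x" for x
    proof (cases "norm x < s")
      case True
      have "(\<lambda>k. (s - a) / real k) \<longlonglongrightarrow> 0" by (rule lim_const_over_n)
      then have "(\<lambda>k. (s - a) / real (Suc (Suc k))) \<longlonglongrightarrow> 0" by (intro LIMSEQ_Suc)
      then have "t \<longlonglongrightarrow> s - 0" unfolding t_def by (intro tendsto_diff tendsto_const)
      then have "\<forall>\<^sub>F k in sequentially. norm x < t k"
        using True by (intro order_tendstoD(1)[of t s]) auto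
      then have "\<forall>\<^sub>F k in sequentially. z k x = 1"
      proof eventually_elim
        case (elim k)
        then show ?case unfolding z_def using t by (intro cutoff_eq_1) auto
      qed
      then show ?thesis using True by (simp add: tendsto_eventually)
    next
      case False
      then have "z k x = 0" for k unfolding z_def using t by (intro cutoff_eq_0) auto
      then show ?thesis using False by simp
    qed
    have Em[measurable]: "E \<in> sets borel" by (rule E)
    have dm[measurable]: "divergence T1 \<in> borel_measurable borel" "divergence T2 \<in> borel_measurable borel"
      using borel_measurable_continuous_onI T1'(5) T2'(5) by blast+
    have [measurable]: "divergence T1 \<in> borel_measurable lborel" "divergence T2 \<in> borel_measurable lborel"
      "ball (0::'a) s \<in> sets borel"
      using dm by auto
    have int: "integrable lborel (\<lambda>x. g x * d x)"
      if "integrable lborel d" "g \<in> borel_measurable borel" "\<And>x. \<bar>g x\<bar> \<le> 1" for g d :: "'a \<Rightarrow> real"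
      by (rule Bochner_Integration.integrable_bound[OF that(1)])
        (use that borel_measurable_integrable[OF that(1)] in \<open>auto simp: abs_mult intro!: mult_left_le_one_le\<close>)
    have g1: "\<bar>indicator E x * z k x\<bar> \<le> 1" "\<bar>indicator E x * (1 - z k x)\<bar> \<le> 1" for k x
      using z01[of k x] by (auto simp: indicator_def)
    have i1: "integrable lborel (\<lambda>x. (indicator E x * z k x) * divergence T1 x)" for k
      by (rule int[OF T1'(6) _ g1(1)]) measurable
    have i2: "integrable lborel (\<lambda>x. (indicator E x * (1 - z k x)) * divergence T2 x)" for k
      by (rule int[OF T2'(6) _ g1(2)]) measurable
    have main: "(LINT x|lborel. (indicator E x * z k x) * divergence T1 x)
        + (LINT x|lborel. (indicator E x * (1 - z k x)) * divergence T2 x) \<le> P + 2 * cutoff_slope * \<kappa>" for k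
    proof -
      \<comment> \<open>Pointwise a convex combination of two vectors of norm at most one, hence
        again an admissible field, to which the perimeter bound of \<open>E\<close> applies.\<close>
      define T where "T x = z k x *\<^sub>R T1 x + (1 - z k x) *\<^sub>R T2 x" for x
      define A where "A = E \<inter> (ball 0 s - ball 0 (t k))"
      have z'cd: "continuously_diff 1 (\<lambda>x. 1 - z k x)"
        unfolding z_def by (intro smooth_cd1 smooth_diff smooth_const smooth_cutoff t) simp
      have zd: "z k differentiable (at x)" "(\<lambda>x. 1 - z k x) differentiable (at x)" for x
        using cd1_differentiable zcd z'cd by blast+
      have g': "gradient (\<lambda>x. 1 - z k x) x = - gradient (z k) x" for x
      proof (rule gradient_eqI)
        show "((\<lambda>x. 1 - z k x) has_derivative (\<bullet>) (- gradient (z k) x)) (at x)"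
          using has_derivative_diff[OF has_derivative_const has_derivative_gradient[OF zd(1)], of 1 x]
          by (rule has_derivative_eq_rhs) (simp add: fun_eq_iff)
      qed
      have T: "T \<in> perimeter_fields"
      proof (rule perimeter_fieldsI)
        show "continuously_diff 1 T"
          unfolding T_def[abs_def] by (intro continuously_diff_add cd1_scaleR zcd z'cd T1'(1) T2'(1))
        show "bounded {x. T x \<noteq> 0}"
          by (rule bounded_subset[OF bounded_Un[THEN iffD2, OF conjI[OF T1'(2) T2'(2)]]]) (auto simp: T_def)
        fix x
        have "norm (T x) \<le> z k x * norm (T1 x) + (1 - z k x) * norm (T2 x)"
          unfolding T_def using norm_triangle_ineq[of "z k x *\<^sub>R T1 x" "(1 - z k x) *\<^sub>R T2 x"] z01[of k x] by simp
        also have "\<dots> \<le> z k x * 1 + (1 - z k x) * 1"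
          using z01[of k x] T1'(3) T2'(3) by (intro add_mono mult_left_mono) auto
        finally show "norm (T x) \<le> 1" by simp
      qed
      have div: "divergence T x = z k x * divergence T1 x + (1 - z k x) * divergence T2 x + gradient (z k) x \<bullet> (T1 x - T2 x)" for x
      proof -
        have "divergence T x = divergence (\<lambda>x. z k x *\<^sub>R T1 x) x + divergence (\<lambda>x. (1 - z k x) *\<^sub>R T2 x) x"
          unfolding T_def[abs_def]
          by (rule divergence_add) (rule cd1_differentiable, rule cd1_scaleR, (rule zcd z'cd T1'(1) T2'(1))+)+
        then show ?thesis
          by (simp add: divergence_scaleR zd T1'(4) T2'(4) g' inner_diff_right)
      qed
      have Am: "A \<in> sets borel" unfolding A_def by auto
      have Afin: "emeasure lborel A < \<infinity>"
        by (rule emeasure_bounded_finite) (auto simp: A_def intro: bounded_subset[OF bounded_ball[of 0 s]])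
      have Ameas: "measure lborel A = f s - f (t k)"
      proof -
        have fm: "E \<inter> ball 0 r \<in> fmeasurable lborel" for r
          by (rule fmeasurable_borel_bounded) (auto intro: bounded_Int)
        have "A = E \<inter> ball 0 s - E \<inter> ball 0 (t k)" unfolding A_def by auto
        then show ?thesis
          unfolding f_def using t(3)[of k]
          by (simp only:) (rule measurable_measure_Diff[OF fm], auto)
      qed
      \<comment> \<open>The gradient of the cutoff is at most
        \<open>cutoff_slope / (s - t k)\<close> and \<open>T1 - T2\<close> has norm at most 2; this
        is the origin of the constant \<open>2 * cutoff_slope\<close>.\<close>
      have low: "- (2 * cutoff_slope / (s - t k)) * indicator A x \<le> indicator E x * (gradient (z k) x \<bullet> (T1 x - T2 x))" for x
      proof (cases "x \<in> A")
        case True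
        have "norm (gradient (z k) x) \<le> cutoff_slope / (s - t k)"
          using cutoff_gradient_le[where N=1 and a="t k" and b=s and c=0 and x=x] t[of k] unfolding z_def by simp
        moreover have "norm (T1 x - T2 x) \<le> 2"
          using norm_triangle_ineq4[of "T1 x" "T2 x"] T1'(3)[of x] T2'(3)[of x] by linarith
        ultimately have "norm (gradient (z k) x) * norm (T1 x - T2 x) \<le> cutoff_slope / (s - t k) * 2"
          by (intro mult_mono) (use cutoff_slope(1) t[of k] in auto)
        moreover have "\<bar>gradient (z k) x \<bullet> (T1 x - T2 x)\<bar> \<le> norm (gradient (z k) x) * norm (T1 x - T2 x)"
          by (rule Cauchy_Schwarz_ineq2)
        ultimately have "- (cutoff_slope / (s - t k) * 2) \<le> gradient (z k) x \<bullet> (T1 x - T2 x)" by linarith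
        moreover have "indicator A x = (1::real)" "indicator E x = (1::real)"
          using True by (auto simp: A_def)
        ultimately show ?thesis by (simp add: mult.commute)
      next
        case False
        have eq0: "indicator E x * (gradient (z k) x \<bullet> (T1 x - T2 x)) = 0"
        proof (cases "x \<in> E")
          case True
          then have "norm x \<le> t k \<or> norm x \<ge> s" using False by (auto simp: A_def)
          then have "gradient (z k) x = 0"
            using cutoff_gradient_eq_0[where N=1 and a="t k" and b=s and c=0 and x=x] t[of k] unfolding z_def by simp
          then show ?thesis by simp
        qed simp
        show ?thesis unfolding eq0 using False by simp
      qed
      have di: "integrable lborel (\<lambda>x. indicator E x * divergence T x)"
        by (rule int[OF perimeter_fieldsD(6)[OF T]]) (auto simp: indicator_def)
      have gi: "integrable lborel (\<lambda>x. indicator E x * (gradient (z k) x \<bullet> (T1 x - T2 x)))"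
      proof -
        have "integrable lborel (\<lambda>x. indicator E x * divergence T x - (indicator E x * z k x) * divergence T1 x
            - (indicator E x * (1 - z k x)) * divergence T2 x)"
          using di i1 i2 by (intro Bochner_Integration.integrable_diff)
        moreover have "indicator E x * divergence T x - (indicator E x * z k x) * divergence T1 x
            - (indicator E x * (1 - z k x)) * divergence T2 x = indicator E x * (gradient (z k) x \<bullet> (T1 x - T2 x))" for x
          unfolding div by (cases "x \<in> E") auto
        ultimately show ?thesis by (simp only:)
      qed
      have ii: "integrable lborel (\<lambda>x. - (2 * cutoff_slope / (s - t k)) * indicator A x)"
        using Am Afin by (intro integrable_mult_right integrable_real_indicator) auto
      have "- (2 * cutoff_slope / (s - t k)) * measure lborel A = (LINT x|lborel. - (2 * cutoff_slope / (s - t k)) * indicator A x)"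
        using Am Afin by simp
      also have "\<dots> \<le> (LINT x|lborel. indicator E x * (gradient (z k) x \<bullet> (T1 x - T2 x)))"
        by (rule integral_mono[OF ii gi low])
      finally have l: "- (2 * cutoff_slope / (s - t k)) * measure lborel A \<le> (LINT x|lborel. indicator E x * (gradient (z k) x \<bullet> (T1 x - T2 x)))" .
      \<comment> \<open>The slope condition on \<open>s\<close> bounds the shell volume by its width
        times \<open>\<kappa>\<close>, so that the width cancels and the bound is uniform in
        \<open>k\<close>.\<close>
      have "(2 * cutoff_slope / (s - t k)) * measure lborel A \<le> (2 * cutoff_slope / (s - t k)) * (\<kappa> * (s - t k))"
        unfolding Ameas using cutoff_slope(1) t[of k] slope[OF t(1,3)] by (intro mult_left_mono) auto
      also have "\<dots> = 2 * cutoff_slope * \<kappa>" using t(3)[of k] by simp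
      finally have l2: "(2 * cutoff_slope / (s - t k)) * measure lborel A \<le> 2 * cutoff_slope * \<kappa>" .
      have "(LINT x|lborel. (indicator E x * z k x) * divergence T1 x)
        + (LINT x|lborel. (indicator E x * (1 - z k x)) * divergence T2 x)
        + (LINT x|lborel. indicator E x * (gradient (z k) x \<bullet> (T1 x - T2 x)))
        = (LINT x|lborel. indicator E x * divergence T x)"
        unfolding div distrib_left mult.assoc[symmetric]
        using i1 i2 gi by (simp add: Bochner_Integration.integral_add mult.assoc)
      also have "\<dots> \<le> P" using P T unfolding perimeter_le_def by blast
      finally show ?thesis using l l2 by linarith
    qed
    \<comment> \<open>The gradient term has been estimated away, so only the cutoffs themselves
      remain and dominated convergence replaces them by sharp indicators.\<close>
    have l1: "(\<lambda>k. LINT x|lborel. (indicator E x * z k x) * divergence T1 x)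
        \<longlonglongrightarrow> (LINT x|lborel. indicator (E \<inter> ball 0 s) x * divergence T1 x)"
    proof (rule integral_dominated_convergence[where w="\<lambda>x. \<bar>divergence T1 x\<bar>"])
      show "AE x in lborel. (\<lambda>k. (indicator E x * z k x) * divergence T1 x) \<longlonglongrightarrow> indicator (E \<inter> ball 0 s) x * divergence T1 x"
        unfolding indicator_inter_arith by (intro AE_I2 tendsto_intros zlim)
      show "AE x in lborel. norm ((indicator E x * z k x) * divergence T1 x) \<le> \<bar>divergence T1 x\<bar>" for k
        using g1(1)[of _ k] by (intro AE_I2) (simp add: abs_mult mult_left_le_one_le)
      show "(\<lambda>x. indicator (E \<inter> ball 0 s) x * divergence T1 x) \<in> borel_measurable lborel"
        by measurable
      show "(\<lambda>x. (indicator E x * z k x) * divergence T1 x) \<in> borel_measurable lborel" for k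
        by measurable
      show "integrable lborel (\<lambda>x. \<bar>divergence T1 x\<bar>)" using T1'(6) by simp
    qed
    have l2: "(\<lambda>k. LINT x|lborel. (indicator E x * (1 - z k x)) * divergence T2 x)
        \<longlonglongrightarrow> (LINT x|lborel. indicator (E - ball 0 s) x * divergence T2 x)"
    proof (rule integral_dominated_convergence[where w="\<lambda>x. \<bar>divergence T2 x\<bar>"])
      show "AE x in lborel. (\<lambda>k. (indicator E x * (1 - z k x)) * divergence T2 x) \<longlonglongrightarrow> indicator (E - ball 0 s) x * divergence T2 x"
      proof (rule AE_I2)
        fix x
        have "(\<lambda>k. (indicator E x * (1 - z k x)) * divergence T2 x)
            \<longlonglongrightarrow> (indicator E x * (1 - indicator (ball 0 s) x)) * divergence T2 x"
          by (intro tendsto_intros zlim)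
        moreover have "indicator E x * (1 - indicator (ball 0 s) x) = (indicator (E - ball 0 s) x :: real)"
          by (auto simp: indicator_def)
        ultimately show "(\<lambda>k. (indicator E x * (1 - z k x)) * divergence T2 x) \<longlonglongrightarrow> indicator (E - ball 0 s) x * divergence T2 x"
          by (simp only:)
      qed
      show "AE x in lborel. norm ((indicator E x * (1 - z k x)) * divergence T2 x) \<le> \<bar>divergence T2 x\<bar>" for k
        using g1(2)[of _ k] by (intro AE_I2) (simp add: abs_mult mult_left_le_one_le)
      show "(\<lambda>x. indicator (E - ball 0 s) x * divergence T2 x) \<in> borel_measurable lborel"
        by measurable
      show "(\<lambda>x. (indicator E x * (1 - z k x)) * divergence T2 x) \<in> borel_measurable lborel" for k
        by measurable
      show "integrable lborel (\<lambda>x. \<bar>divergence T2 x\<bar>)" using T2'(6) by simp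
    qed
    have "(LINT x|lborel. indicator (E \<inter> ball 0 s) x * divergence T1 x)
      + (LINT x|lborel. indicator (E - ball 0 s) x * divergence T2 x) \<le> P + 2 * cutoff_slope * \<kappa>"
      by (rule LIMSEQ_le_const2[OF tendsto_add[OF l1 l2]]) (use main in blast)
    then show "(LINT x|lborel. indicator (E \<inter> ball 0 s) x * divergence T1 x)
      + (LINT x|lborel. indicator (E - ball 0 s) x * divergence T2 x)
      \<le> P + 2 * cutoff_slope * (measure lborel (E \<inter> ball 0 b) - measure lborel (E \<inter> ball 0 a)) / (b - a)"
      by (simp add: \<kappa>_def f_def)
  qed
qed

subsection \<open>The isoperimetric inequality\<close>

lemma bounded_borel_indicator_integrable:
  fixes E :: "'a::euclidean_space set" and g :: "'a \<Rightarrow> real"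
  assumes E: "E \<in> sets borel" "bounded E" and g: "g \<in> borel_measurable borel" "\<And>x. \<bar>g x\<bar> \<le> B"
  shows "integrable lborel (\<lambda>x. indicator E x * g x)"
proof (rule Bochner_Integration.integrable_bound)
  have "emeasure lborel E < \<infinity>" by (rule emeasure_bounded_finite[OF E(2)])
  then show "integrable lborel (\<lambda>x. B * indicator E x :: real)"
    using E by (intro integrable_mult_right integrable_real_indicator) auto
  show "(\<lambda>x. indicator E x * g x) \<in> borel_measurable lborel" using E g by simp
  show "AE x in lborel. norm (indicator E x * g x) \<le> norm (B * indicator E x)"
    using g(2) by (intro AE_I2) (auto simp: indicator_def order_trans[OF _ abs_ge_self])
qed

text \<open>The integral of \<open>\<psi>\<close> over \<open>E\<close>, translated by
  \<open>t *\<^sub>R z\<close>, is differentiable in \<open>t\<close>. At a mean value point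
  \<open>\<xi>\<close> its derivative is, up to the factor \<open>- norm z\<close>, the integral
  over \<open>E\<close> of the divergence of \<open>- \<psi>\<close> shifted by
  \<open>\<xi> *\<^sub>R z\<close> times the unit vector along \<open>z\<close>. This is one
  admissible field, so no integration over the segment is needed.\<close>

lemma translation_estimate_smooth:
  fixes E :: "'a::euclidean_space set" and \<psi> :: "'a \<Rightarrow> real"
  assumes E: "E \<in> sets borel" "bounded E" and P: "perimeter_le E P"
    and \<psi>: "smooth \<psi>" "bounded {x. \<psi> x \<noteq> 0}" "\<And>x. \<bar>\<psi> x\<bar> \<le> 1"
  shows "(LINT x|lborel. indicator E x * \<psi> x) - (LINT x|lborel. indicator E x * \<psi> (x + z)) \<le> norm z * P"
proof (cases "z = 0")
  case False
  define w where "w = z /\<^sub>R norm z"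
  have w: "norm w = 1" "z = norm z *\<^sub>R w" using False by (auto simp: w_def)
  have d\<psi>: "\<psi> differentiable (at x)" for x by (rule smooth_differentiable[OF \<psi>(1)])
  have g: "dir_deriv z \<psi> x = gradient \<psi> x \<bullet> z" for x by (simp add: gradient_inner[OF d\<psi>])
  have cg: "continuous_on UNIV (dir_deriv z \<psi>)"
    unfolding g[abs_def] by (intro continuous_on_inner continuous_gradient[OF smooth_cd1[OF \<psi>(1)]] continuous_on_const)
  have "bounded {x. dir_deriv z \<psi> x \<noteq> 0}"
    by (rule bounded_subset[OF bounded_closure[OF \<psi>(2)] dir_deriv_support(1)])
  then obtain B where B: "B > 0" "\<And>x. norm (dir_deriv z \<psi> x) \<le> B"
    using bounded_range_continuous_bounded_support[OF cg] by blast
  \<comment> \<open>Bounds the difference quotients in \<open>t\<close> uniformly, which justifies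
    differentiation under the integral.\<close>
  have lip: "\<bar>\<psi> (x + h *\<^sub>R z) - \<psi> x\<bar> \<le> B * \<bar>h\<bar>" for x h
  proof -
    have pos: "\<bar>\<psi> (x + h *\<^sub>R z) - \<psi> x\<bar> \<le> B * h" if h: "h > 0" for x h
    proof -
      obtain t where "\<psi> (x + h *\<^sub>R z) - \<psi> x = h * dir_deriv z \<psi> (x + t *\<^sub>R z)"
        by (rule mvt_along_line[OF d\<psi> h])
      then show ?thesis using B(2)[of "x + t *\<^sub>R z"] h by (simp add: abs_mult mult.commute[of h])
    qed
    consider "h > 0" | "h < 0" | "h = 0" by linarith
    then show ?thesis
    proof cases
      case 2
      then show ?thesis using pos[of "-h" "x + h *\<^sub>R z"] by (simp add: abs_minus_commute)
    qed (use pos[of h x] in auto)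
  qed
  have m: "(\<lambda>x. \<psi> (x + y)) \<in> borel_measurable borel" "(\<lambda>x. dir_deriv z \<psi> (x + y)) \<in> borel_measurable borel" for y
    by (rule borel_measurable_continuous_onI, rule continuous_on_compose2[OF smooth_continuous[OF \<psi>(1)]],
        auto intro: continuous_intros)
       (rule borel_measurable_continuous_onI, rule continuous_on_compose2[OF cg], auto intro: continuous_intros)
  define a where "a t = (LINT x|lborel. indicator E x * \<psi> (x + t *\<^sub>R z))" for t
  define a' where "a' t = (LINT x|lborel. indicator E x * dir_deriv z \<psi> (x + t *\<^sub>R z))" for t
  have ai: "integrable lborel (\<lambda>x. indicator E x * \<psi> (x + y))" for y
    by (rule bounded_borel_indicator_integrable[OF E m(1)]) (rule \<psi>(3))
  have deriv: "(a has_real_derivative a' t) (at t)" for t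
    unfolding DERIV_def tendsto_at_iff_sequentially
  proof (intro allI impI)
    fix h :: "nat \<Rightarrow> real" assume h: "\<forall>i. h i \<in> UNIV - {0}" "h \<longlonglongrightarrow> 0"
    define q where "q k x = indicator E x * ((\<psi> (x + (t + h k) *\<^sub>R z) - \<psi> (x + t *\<^sub>R z)) / h k)" for k x
    have "(\<lambda>k. LINT x|lborel. q k x) \<longlonglongrightarrow> a' t"
      unfolding a'_def
    proof (rule integral_dominated_convergence)
      show "(\<lambda>x. indicator E x * dir_deriv z \<psi> (x + t *\<^sub>R z)) \<in> borel_measurable lborel"
        using E m(2) by simp
      show "q k \<in> borel_measurable lborel" for k unfolding q_def using E m(1) by simp
      show "integrable lborel (\<lambda>x. indicator E x * B)"
        by (rule bounded_borel_indicator_integrable[OF E, of _ B]) (use B in auto)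
      show "AE x in lborel. norm (q k x) \<le> indicator E x * B" for k
      proof (rule AE_I2)
        fix x
        have hk: "h k \<noteq> 0" using h(1) by auto
        have "\<bar>\<psi> (x + (t + h k) *\<^sub>R z) - \<psi> (x + t *\<^sub>R z)\<bar> \<le> B * \<bar>h k\<bar>"
          using lip[of "x + t *\<^sub>R z" "h k"] by (simp add: scaleR_add_left add.assoc)
        then have "\<bar>(\<psi> (x + (t + h k) *\<^sub>R z) - \<psi> (x + t *\<^sub>R z)) / h k\<bar> \<le> B"
          using hk by (simp add: divide_le_eq)
        then show "norm (q k x) \<le> indicator E x * B"
          unfolding q_def by (cases "x \<in> E") auto
      qed
      show "AE x in lborel. (\<lambda>k. q k x) \<longlonglongrightarrow> indicator E x * dir_deriv z \<psi> (x + t *\<^sub>R z)"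
      proof (rule AE_I2)
        fix x
        have "((\<lambda>h. (\<psi> (x + (t + h) *\<^sub>R z) - \<psi> (x + t *\<^sub>R z)) / h) \<longlongrightarrow> dir_deriv z \<psi> (x + t *\<^sub>R z)) (at 0)"
          using has_real_derivative_along_line[OF d\<psi>, of x z t] by (simp add: DERIV_def)
        then have "(\<lambda>k. (\<psi> (x + (t + h k) *\<^sub>R z) - \<psi> (x + t *\<^sub>R z)) / h k) \<longlonglongrightarrow> dir_deriv z \<psi> (x + t *\<^sub>R z)"
          using h unfolding tendsto_at_iff_sequentially comp_def by blast
        then show "(\<lambda>k. q k x) \<longlonglongrightarrow> indicator E x * dir_deriv z \<psi> (x + t *\<^sub>R z)"
          unfolding q_def by (rule tendsto_mult_left)
      qed
    qed
    moreover have "(LINT x|lborel. q k x) = (a (t + h k) - a t) / h k" for k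
    proof -
      have "q k x = (indicator E x * \<psi> (x + (t + h k) *\<^sub>R z) - indicator E x * \<psi> (x + t *\<^sub>R z)) / h k" for x
        unfolding q_def by (simp add: right_diff_distrib)
      then show ?thesis
        unfolding a_def using ai by (simp add: Bochner_Integration.integral_diff)
    qed
    ultimately show "((\<lambda>h. (a (t + h) - a t) / h) \<circ> h) \<longlonglongrightarrow> a' t" by (simp add: comp_def)
  qed
  obtain \<xi> where \<xi>: "a 1 - a 0 = (1 - 0) * a' \<xi>"
    using MVT2[of 0 1 a a'] deriv by auto
  define T where "T x = - \<psi> (x + \<xi> *\<^sub>R z) *\<^sub>R w" for x
  have c: "continuously_diff 1 (\<lambda>x. - \<psi> (x + \<xi> *\<^sub>R z))"
  proof -
    have "smooth (\<lambda>x. - \<psi> x)" using smooth_mult[OF smooth_const[of "-1"] \<psi>(1)] by simp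
    then show ?thesis using cd1_translate(1)[OF smooth_cd1] by blast
  qed
  have "T \<in> perimeter_fields"
  proof (rule perimeter_fieldsI)
    show "continuously_diff 1 T"
      unfolding T_def[abs_def] using cd1_scaleR[OF c continuously_diff_const[of 1 w]] by simp
    have "{x. T x \<noteq> 0} \<subseteq> (\<lambda>y. - (\<xi> *\<^sub>R z) + y) ` {x. \<psi> x \<noteq> 0}"
      unfolding T_def by (auto simp: image_iff intro!: exI[of _ "_ + \<xi> *\<^sub>R z"])
    then show "bounded {x. T x \<noteq> 0}"
      by (rule bounded_subset[OF bounded_translation[OF \<psi>(2)]])
    show "norm (T x) \<le> 1" for x unfolding T_def using \<psi>(3) w by simp
  qed
  moreover have "divergence T x = - (dir_deriv z \<psi> (x + \<xi> *\<^sub>R z) / norm z)" for x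
  proof -
    have "divergence T x = gradient (\<lambda>x. - \<psi> (x + \<xi> *\<^sub>R z)) x \<bullet> w"
      unfolding T_def[abs_def]
      using divergence_scaleR[OF cd1_differentiable[OF c], of "\<lambda>x. w" x]
      by (simp add: divergence_def dir_deriv_eq[OF has_derivative_const])
    also have "gradient (\<lambda>x. - \<psi> (x + \<xi> *\<^sub>R z)) x = - gradient \<psi> (x + \<xi> *\<^sub>R z)"
    proof (rule gradient_eqI)
      have "((\<lambda>x. x + \<xi> *\<^sub>R z) has_derivative (\<lambda>h. h)) (at x)" by (auto intro!: derivative_eq_intros)
      from has_derivative_minus[OF has_derivative_compose[OF this has_derivative_gradient[OF d\<psi>]]]
      show "((\<lambda>x. - \<psi> (x + \<xi> *\<^sub>R z)) has_derivative (\<bullet>) (- gradient \<psi> (x + \<xi> *\<^sub>R z))) (at x)"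
        by (rule has_derivative_eq_rhs) (simp add: fun_eq_iff)
    qed
    also have "- gradient \<psi> (x + \<xi> *\<^sub>R z) \<bullet> w = - (dir_deriv z \<psi> (x + \<xi> *\<^sub>R z) / norm z)"
      unfolding g w_def by (simp add: divide_inverse mult.commute)
    finally show ?thesis .
  qed
  ultimately have "(LINT x|lborel. indicator E x * - (dir_deriv z \<psi> (x + \<xi> *\<^sub>R z) / norm z)) \<le> P"
    using P unfolding perimeter_le_def by (metis (no_types, lifting) Bochner_Integration.integral_cong)
  also have "(LINT x|lborel. indicator E x * - (dir_deriv z \<psi> (x + \<xi> *\<^sub>R z) / norm z)) = - (a' \<xi> / norm z)"
    unfolding a'_def by simp
  finally have "- a' \<xi> \<le> norm z * P" using False by (simp add: field_simps)
  then show ?thesis using \<xi> by (simp add: a_def)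
qed simp

text \<open>\<open>translation_estimate_smooth\<close> with \<open>\<psi>\<close> approximating the
  indicator of a compact \<open>C\<close> inside \<open>E\<close>: the shifted integral tends to the
  volume of the points of \<open>E\<close> that \<open>z\<close> moves into \<open>C\<close>, at
  most the overlap of \<open>E\<close> with its translate. Inner regularity then lets
  \<open>C\<close> fill \<open>E\<close>.\<close>

lemma translation_estimate:
  fixes E :: "'a::euclidean_space set"
  assumes E: "E \<in> sets borel" "bounded E" and P: "perimeter_le E P"
  shows "measure lborel E \<le> measure lborel (E \<inter> {x. x + z \<in> E}) + norm z * P"
proof -
  have shift[measurable]: "{x. x + z \<in> F} \<in> sets borel" if "F \<in> sets borel" for F :: "'a set"
  proof -
    have "(\<lambda>x. x + z) -` F \<inter> space borel \<in> sets borel"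
      by (rule measurable_sets[OF _ that]) simp
    then show ?thesis by (simp add: vimage_def)
  qed
  have fm: "E \<inter> F \<in> fmeasurable lborel" if "F \<in> sets borel" for F
    by (rule fmeasurable_borel_bounded) (use E that in \<open>auto intro: bounded_subset[OF E(2)]\<close>)
  have compact_case: "measure lborel C \<le> measure lborel (E \<inter> {x. x + z \<in> E}) + norm z * P"
    if C: "compact C" "C \<subseteq> E" for C
  proof -
    have Cb: "C \<in> sets borel" using C(1) by (simp add: borel_compact)
    obtain \<phi> :: "nat \<Rightarrow> 'a \<Rightarrow> real" and D where D: "compact D" "D \<subseteq> UNIV"
      and \<phi>: "\<And>k. \<phi> k \<in> test_functions UNIV" "\<And>k x. 0 \<le> \<phi> k x" "\<And>k x. \<phi> k x \<le> 1"
      "\<And>k x. x \<in> C \<Longrightarrow> \<phi> k x = 1" "\<And>k x. x \<notin> D \<Longrightarrow> \<phi> k x = 0"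
      "\<And>x. (\<lambda>k. \<phi> k x) \<longlonglongrightarrow> indicator C x"
      by (rule compact_bump_sequence[OF C(1) open_UNIV subset_UNIV]) (rule that, assumption+)
    have b: "\<bar>\<phi> k x\<bar> \<le> 1" for k x using \<phi>(2,3)[of k x] by simp
    have lim: "(\<lambda>k. LINT x|lborel. indicator E x * \<phi> k (x + y)) \<longlonglongrightarrow> (LINT x|lborel. indicator E x * indicator C (x + y))" for y
    proof (rule integral_dominated_convergence)
      show "integrable lborel (\<lambda>x. indicator E x * 1 :: real)"
        by (rule bounded_borel_indicator_integrable[OF E, of _ 1]) auto
      have "\<phi> k \<in> borel_measurable borel" for k
        by (rule borel_measurable_continuous_onI[OF smooth_continuous[OF test_functionD[OF \<phi>(1)]]])
      then have "(\<lambda>x. \<phi> k (x + y)) \<in> borel_measurable borel" for k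
        by (rule measurable_compose[rotated]) simp
      then show "(\<lambda>x. indicator E x * \<phi> k (x + y)) \<in> borel_measurable lborel" for k
        using E by simp
      have "(\<lambda>x. indicator C (x + y) :: real) \<in> borel_measurable borel"
        by (rule measurable_compose[OF _ borel_measurable_indicator[OF Cb]]) simp
      then show "(\<lambda>x. indicator E x * indicator C (x + y) :: real) \<in> borel_measurable lborel"
        using E by simp
      show "AE x in lborel. (\<lambda>k. indicator E x * \<phi> k (x + y)) \<longlonglongrightarrow> indicator E x * indicator C (x + y)"
        by (intro AE_I2 tendsto_mult_left \<phi>(6))
      show "AE x in lborel. norm (indicator E x * \<phi> k (x + y)) \<le> indicator E x * 1" for k
        using b[of k] by (intro AE_I2) (auto simp: indicator_def)
    qed
    have "(LINT x|lborel. indicator E x * indicator C (x + 0)) - (LINT x|lborel. indicator E x * indicator C (x + z)) \<le> norm z * P"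
    proof (rule LIMSEQ_le_const2[OF tendsto_diff[OF lim lim]])
      have "(LINT x|lborel. indicator E x * \<phi> k x) - (LINT x|lborel. indicator E x * \<phi> k (x + z)) \<le> norm z * P" for k
        using \<phi>(1)[of k] compactly_contained_bounded unfolding test_functions_iff
        by (intro translation_estimate_smooth[OF E P] b) blast+
      then show "\<exists>N. \<forall>k\<ge>N. (LINT x|lborel. indicator E x * \<phi> k (x + 0)) - (LINT x|lborel. indicator E x * \<phi> k (x + z)) \<le> norm z * P"
        by simp
    qed
    moreover have "(LINT x|lborel. indicator E x * indicator C (x + 0)) = measure lborel C"
    proof -
      have "(\<lambda>x. indicator E x * indicator C (x + 0)) = (indicator C :: 'a \<Rightarrow> real)"
        using C(2) by (auto simp: indicator_def fun_eq_iff)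
      then show ?thesis by (simp only:) simp
    qed
    moreover have "(LINT x|lborel. indicator E x * indicator C (x + z)) = measure lborel (E \<inter> {x. x + z \<in> C})"
    proof -
      have "(\<lambda>x. indicator E x * indicator C (x + z)) = (indicator (E \<inter> {x. x + z \<in> C}) :: 'a \<Rightarrow> real)"
        by (auto simp: indicator_def fun_eq_iff)
      then show ?thesis by (simp only:) simp
    qed
    moreover have "measure lborel (E \<inter> {x. x + z \<in> C}) \<le> measure lborel (E \<inter> {x. x + z \<in> E})"
      by (rule measure_mono_fmeasurable) (use C Cb E shift fm in auto)
    ultimately show ?thesis by linarith
  qed
  show ?thesis
  proof (rule field_le_epsilon)
    fix e :: real assume e: "e > 0"
    have "E \<in> sets lebesgue" using E(1) by simp
    then obtain C where C: "closed C" "C \<subseteq> E" "E - C \<in> lmeasurable" "emeasure lebesgue (E - C) < ennreal e"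
      by (rule sets_lebesgue_inner_closed[OF _ e]) (rule that)
    have cC: "compact C" using C E(2) bounded_subset compact_eq_bounded_closed by blast
    have Cb: "C \<in> sets borel" using cC by (simp add: borel_compact)
    have "measure lborel (E - C) < e"
    proof -
      have "emeasure lborel (E - C) < ennreal e" using C(4) E Cb by simp
      moreover have "emeasure lborel (E - C) = ennreal (measure lborel (E - C))"
        using calculation by (intro emeasure_eq_ennreal_measure) auto
      ultimately show ?thesis by (simp add: ennreal_less_iff)
    qed
    moreover have "measure lborel (E - C) = measure lborel E - measure lborel C"
      by (rule measurable_measure_Diff) (use fmeasurable_borel_bounded[OF E] Cb C in auto)
    ultimately show "measure lborel E \<le> measure lborel (E \<inter> {x. x + z \<in> E}) + norm z * P + e"
      using compact_case[OF cC C(2)] by linarith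
  qed
qed

text \<open>The translation estimate is averaged over \<open>z\<close> in a ball; by Fubini the overlaps of \<open>E\<close> with its
  translates integrate to at most the square of the volume of \<open>E\<close>.\<close>

lemma isoperimetric_ball:
  fixes E :: "'a::euclidean_space set"
  assumes E: "E \<in> sets borel" "bounded E" and P: "perimeter_le E P" and r: "r > 0"
  shows "measure lborel E * measure lborel (ball (0::'a) r)
    \<le> (measure lborel E)\<^sup>2 + r * P * measure lborel (ball (0::'a) r)"
proof -
  let ?m = "measure lborel E" and ?B = "ball (0::'a) r"
  have [measurable]: "E \<in> sets borel" "?B \<in> sets borel" using E by auto
  have em: "emeasure lborel E = ennreal ?m" "emeasure lborel ?B = ennreal (measure lborel ?B)"
    using emeasure_bounded_finite[OF E(2)] emeasure_bounded_finite[OF bounded_ball[of "0::'a" r]]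
    by (simp_all add: emeasure_eq_ennreal_measure)
  \<comment> \<open>Integrated over \<open>x\<close> this is the overlap of \<open>E\<close> with
    its translate, integrated over \<open>z\<close> the volume of \<open>E\<close>. Extended
    nonnegative values allow the exchange of the two integrals without an integrability
    proof.\<close>
  define k where "k x z = (indicator E x * indicator E (x + z) :: ennreal)" for x z :: 'a
  have km: "(\<lambda>(x, z). k x z) \<in> borel_measurable (lborel \<Otimes>\<^sub>M lborel)" unfolding k_def by measurable
  have km': "(\<lambda>(z, x). k x z) \<in> borel_measurable (lborel \<Otimes>\<^sub>M lborel)" unfolding k_def by measurable
  have rP: "r * P \<ge> 0" using r perimeter_le_nonneg[OF P] by simp
  have pt: "ennreal ?m * indicator ?B z \<le> (\<integral>\<^sup>+x. k x z \<partial>lborel) + ennreal (r * P) * indicator ?B z" for z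
  proof (cases "z \<in> ?B")
    case True
    have S: "E \<inter> {x. x + z \<in> E} \<in> sets borel" by measurable
    have "(\<integral>\<^sup>+x. k x z \<partial>lborel) = (\<integral>\<^sup>+x. indicator (E \<inter> {x. x + z \<in> E}) x \<partial>lborel)"
      unfolding k_def by (intro nn_integral_cong) (auto simp: indicator_def)
    also have "\<dots> = emeasure lborel (E \<inter> {x. x + z \<in> E})" using S by simp
    also have "\<dots> = ennreal (measure lborel (E \<inter> {x. x + z \<in> E}))"
      using emeasure_bounded_finite[OF bounded_subset[OF E(2), of "E \<inter> {x. x + z \<in> E}"]]
      by (simp add: emeasure_eq_ennreal_measure)
    finally have k: "(\<integral>\<^sup>+x. k x z \<partial>lborel) = ennreal (measure lborel (E \<inter> {x. x + z \<in> E}))" .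
    have "norm z * P \<le> r * P"
      using True perimeter_le_nonneg[OF P] by (intro mult_right_mono) auto
    then have "?m \<le> measure lborel (E \<inter> {x. x + z \<in> E}) + r * P"
      using translation_estimate[OF E P, of z] by linarith
    then have "ennreal ?m \<le> ennreal (measure lborel (E \<inter> {x. x + z \<in> E}) + r * P)" by (rule ennreal_leI)
    then show ?thesis unfolding k using True rP by (simp add: ennreal_plus)
  qed simp
  have "ennreal (?m * measure lborel ?B) = (\<integral>\<^sup>+z. ennreal ?m * indicator ?B z \<partial>lborel)"
    by (simp add: nn_integral_cmult_indicator em ennreal_mult)
  also have "\<dots> \<le> (\<integral>\<^sup>+z. (\<integral>\<^sup>+x. k x z \<partial>lborel) + ennreal (r * P) * indicator ?B z \<partial>lborel)"
    by (intro nn_integral_mono pt)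
  also have "\<dots> = (\<integral>\<^sup>+z. (\<integral>\<^sup>+x. k x z \<partial>lborel) \<partial>lborel) + (\<integral>\<^sup>+z. ennreal (r * P) * indicator ?B z \<partial>lborel)"
  proof (rule nn_integral_add)
    show "(\<lambda>z. \<integral>\<^sup>+x. k x z \<partial>lborel) \<in> borel_measurable lborel"
      by (rule lborel.borel_measurable_nn_integral[OF km'])
  qed measurable
  also have "(\<integral>\<^sup>+z. (\<integral>\<^sup>+x. k x z \<partial>lborel) \<partial>lborel) = (\<integral>\<^sup>+x. (\<integral>\<^sup>+z. k x z \<partial>lborel) \<partial>lborel)"
    using lborel_pair.Fubini'[OF km] by simp
  \<comment> \<open>In the overlap term \<open>z\<close> has been allowed to run over the whole
    space and not only over \<open>?B\<close>; hence translation invariance gives the full volume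
    for every \<open>x\<close> in \<open>E\<close>.\<close>
  also have "\<dots> = (\<integral>\<^sup>+x. ennreal ?m * indicator E x \<partial>lborel)"
  proof (rule nn_integral_cong)
    fix x
    have "(\<integral>\<^sup>+z. indicator E (x + z) \<partial>lborel) = (\<integral>\<^sup>+y. indicator E y \<partial>distr lborel borel ((+) x))"
      by (subst nn_integral_distr) auto
    also have "\<dots> = ennreal ?m" by (simp add: lborel_distr_plus em)
    finally have i: "(\<integral>\<^sup>+z. indicator E (x + z) \<partial>lborel) = ennreal ?m" .
    have "(\<lambda>z. indicator E (x + z) :: ennreal) \<in> borel_measurable lborel" by measurable
    then show "(\<integral>\<^sup>+z. k x z \<partial>lborel) = ennreal ?m * indicator E x"
      unfolding k_def by (simp add: nn_integral_cmult i mult.commute)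
  qed
  also have "\<dots> + (\<integral>\<^sup>+z. ennreal (r * P) * indicator ?B z \<partial>lborel) = ennreal (?m\<^sup>2 + r * P * measure lborel ?B)"
    using rP by (simp add: nn_integral_cmult_indicator em ennreal_mult power2_eq_square ennreal_plus)
  finally show ?thesis
    by (rule ennreal_le_iff[THEN iffD1, rotated]) (use rP in simp)
qed

text \<open>For a ball of twice the volume of \<open>E\<close>, the quadratic term in
  \<open>isoperimetric_ball\<close> is half of the left side and can be absorbed. The volume is left
  on both sides, so that the estimate also holds for null sets; for positive volume, division gives
  the usual form.\<close>

lemma isoperimetric_inequality:
  obtains c where "c > 0"
    "\<And>(E::'a::euclidean_space set) P. E \<in> sets borel \<Longrightarrow> bounded E \<Longrightarrow> perimeter_le E P \<Longrightarrow>
       measure lborel E \<le> c * measure lborel E powr (1 / DIM('a)) * P"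
proof -
  define \<omega> where "\<omega> = measure lborel (ball (0::'a) 1)"
  have \<omega>: "\<omega> > 0" unfolding \<omega>_def using content_ball_pos[of 1 "0::'a"] by simp
  show thesis
  proof (rule that[of "2 * (2 / \<omega>) powr (1 / DIM('a))"])
    fix E :: "'a set" and P assume E: "E \<in> sets borel" "bounded E" and P: "perimeter_le E P"
    define m where "m = measure lborel E"
    show "measure lborel E \<le> 2 * (2 / \<omega>) powr (1 / DIM('a)) * measure lborel E powr (1 / DIM('a)) * P"
    proof (cases "m = 0")
      case False
      then have m: "m > 0" unfolding m_def by (simp add: less_le)
      \<comment> \<open>The radius for which the ball has volume \<open>2 * m\<close>.\<close>
      define r where "r = (2 * m / \<omega>) powr (1 / DIM('a))"
      have r: "r > 0" using m \<omega> by (simp add: r_def)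
      have "r ^ DIM('a) = 2 * m / \<omega>"
        unfolding r_def using m \<omega> by (simp add: powr_realpow[symmetric] powr_powr)
      then have B: "measure lborel (ball (0::'a) r) = 2 * m"
        using content_ball_conv_unit_ball[of r "0::'a"] r \<omega> by (simp add: \<omega>_def[symmetric])
      have "m * (2 * m) \<le> m\<^sup>2 + r * P * (2 * m)"
        using isoperimetric_ball[OF E P r] unfolding B m_def[symmetric] .
      then have "m * m \<le> m * (2 * r * P)" by (simp add: power2_eq_square algebra_simps)
      then have "m \<le> 2 * r * P" using m by simp
      also have "r = (2 / \<omega>) powr (1 / DIM('a)) * m powr (1 / DIM('a))"
        unfolding r_def using m \<omega> by (simp add: powr_mult[symmetric])
      finally show ?thesis by (simp add: m_def mult.assoc)
    qed (simp add: m_def)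
  qed (use \<omega> in simp)
qed

subsection \<open>Decay of the volume outside balls\<close>

text \<open>Convexity up to the boundary: if one of the points is 0, the claim says
  \<open>(k * z) powr p \<le> k * z powr p\<close>, which holds because
  \<open>k powr p \<le> k\<close> for weights \<open>k\<close> between 0 and 1.\<close>

lemma powr_convex_nonneg:
  fixes p l x y :: real
  assumes p: "p \<ge> 1" and l: "0 \<le> l" "l \<le> 1" and xy: "0 \<le> x" "0 \<le> y"
  shows "(l * x + (1 - l) * y) powr p \<le> l * x powr p + (1 - l) * y powr p"
proof -
  have scale: "(k * z) powr p \<le> k * z powr p" if "0 \<le> k" "k \<le> 1" "0 \<le> z" for k z :: real
  proof (cases "k = 0")
    case False
    have "k powr p \<le> k powr 1" using False that p by (intro powr_mono') auto
    then have "k powr p * z powr p \<le> k * z powr p" using False that by (intro mult_right_mono) auto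
    then show ?thesis using that by (simp add: powr_mult)
  qed simp
  show ?thesis
  proof (cases "x = 0 \<or> y = 0")
    case True
    then show ?thesis using scale[of l x] scale[of "1 - l" y] l xy p by auto
  next
    case False
    then show ?thesis
      using convex_onD[OF powr_convex[OF p], of "1 - l" x y] l xy by simp
  qed
qed

text \<open>The radius \<open>T\<close> is fixed before \<open>m\<close>, hence serves all
  minimizers and all \<open>R\<close> at once. Dropping \<open>- m (t + h)\<close> on the right
  gives a recursion with exponent \<open>1 / \<alpha> > 1\<close>; started from a small value it
  decays geometrically in spite of the factors \<open>h powr - p\<close>, which grow only
  geometrically when the step is halved.\<close>

lemma De_Giorgi_iteration:
  fixes \<rho> C V \<alpha> p :: real
  assumes C: "C > 0" and V: "V \<ge> 0" and \<alpha>: "0 < \<alpha>" "\<alpha> < 1"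
  obtains T where "T \<ge> \<rho>"
    "\<And>m. (\<And>t. 0 \<le> m t) \<Longrightarrow> (\<And>s t. s \<le> t \<Longrightarrow> m t \<le> m s) \<Longrightarrow> m \<rho> \<le> V \<Longrightarrow>
      (\<And>t h. \<rho> \<le> t \<Longrightarrow> 0 < h \<Longrightarrow> h \<le> 1 \<Longrightarrow> m (t + h) powr \<alpha> \<le> C * h powr - p * (m t - m (t + h))) \<Longrightarrow>
      m T = 0"
proof -
  \<comment> \<open>chosen such that the bound \<open>m (\<rho> + N + 1 - 2\<^sup>-\<^sup>k) \<le> \<delta> * \<theta> ^ k\<close> reproduces itself\<close>
  define \<theta> where "\<theta> = (2::real) powr (- (\<bar>p\<bar> / (1 - \<alpha>)) - 1)"
  define \<delta> where "\<delta> = (\<theta> powr \<alpha> / (C * 2 powr p)) powr (1 / (1 - \<alpha>))"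
  have \<theta>: "0 < \<theta>" "\<theta> < 1" "2 powr p * \<theta> powr (1 - \<alpha>) \<le> 1"
  proof -
    show "0 < \<theta>" unfolding \<theta>_def by simp
    have "- (\<bar>p\<bar> / (1 - \<alpha>)) - 1 < 0" using divide_nonneg_pos[of "\<bar>p\<bar>" "1 - \<alpha>"] \<alpha> by linarith
    then show "\<theta> < 1" unfolding \<theta>_def by (simp add: powr_less_one)
    have "2 powr p * \<theta> powr (1 - \<alpha>) = 2 powr (p + (- (\<bar>p\<bar> / (1 - \<alpha>)) - 1) * (1 - \<alpha>))"
      unfolding \<theta>_def by (simp add: powr_powr powr_add)
    also have "p + (- (\<bar>p\<bar> / (1 - \<alpha>)) - 1) * (1 - \<alpha>) = p - \<bar>p\<bar> - (1 - \<alpha>)"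
      using \<alpha> by (simp only: left_diff_distrib mult_minus_left) simp
    also have "2 powr (p - \<bar>p\<bar> - (1 - \<alpha>)) \<le> 2 powr (0::real)" using \<alpha> by (intro powr_mono) auto
    finally show "2 powr p * \<theta> powr (1 - \<alpha>) \<le> 1" by simp
  qed
  have \<delta>: "\<delta> > 0" "C * 2 powr p * \<delta> powr (1 - \<alpha>) = \<theta> powr \<alpha>"
    unfolding \<delta>_def using C \<theta> \<alpha> by (simp_all add: powr_powr)
  \<comment> \<open>While \<open>m\<close> exceeds \<open>\<delta>\<close>, each unit step lowers
    \<open>C * m\<close> by at least \<open>\<delta> powr \<alpha>\<close>; starting from at most
    \<open>C * V\<close>, this cannot happen \<open>N\<close> times.\<close>
  obtain N :: nat where N: "C * V < N * \<delta> powr \<alpha>"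
    using ex_less_of_nat_mult[of "\<delta> powr \<alpha>" "C * V"] \<delta> by auto
  show thesis
  proof (rule that[of "\<rho> + N + 1"])
    fix m :: "real \<Rightarrow> real"
    assume nn: "\<And>t. 0 \<le> m t" and anti: "\<And>s t. s \<le> t \<Longrightarrow> m t \<le> m s" and mV: "m \<rho> \<le> V"
      and step: "\<And>t h. \<rho> \<le> t \<Longrightarrow> 0 < h \<Longrightarrow> h \<le> 1 \<Longrightarrow> m (t + h) powr \<alpha> \<le> C * h powr - p * (m t - m (t + h))"
    have small: "m (\<rho> + N) \<le> \<delta>"
    proof (rule ccontr)
      assume "\<not> m (\<rho> + N) \<le> \<delta>"
      then have big: "\<delta> < m (\<rho> + N)" by simp
      have "j * \<delta> powr \<alpha> \<le> C * (m \<rho> - m (\<rho> + j))" if "j \<le> N" for j :: nat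
        using that
      proof (induction j)
        case (Suc j)
        have "m (\<rho> + N) \<le> m (\<rho> + j + 1)" by (rule anti) (use Suc in simp)
        then have "\<delta> \<le> m (\<rho> + j + 1)" using big by simp
        then have "\<delta> powr \<alpha> \<le> m (\<rho> + j + 1) powr \<alpha>" using \<delta> \<alpha> by (intro powr_mono2) auto
        also have "\<dots> \<le> C * 1 powr - p * (m (\<rho> + j) - m (\<rho> + j + 1))" by (rule step) auto
        finally show ?case using Suc by (simp add: algebra_simps)
      qed simp
      from this[of N] have "N * \<delta> powr \<alpha> \<le> C * (m \<rho> - m (\<rho> + N))" by simp
      also have "\<dots> \<le> C * V" using C mV nn[of "\<rho> + N"] by (intro mult_left_mono) auto
      finally show False using N by simp
    qed
    have decay: "m (\<rho> + N + 1 - (1/2) ^ k) \<le> \<delta> * \<theta> ^ k" for k :: nat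
    proof (induction k)
      case (Suc k)
      define t where "t = \<rho> + N + 1 - (1/2) ^ k"
      define h where "h = (1/2 :: real) ^ Suc k"
      have h: "0 < h" "h \<le> 1" "t + h = \<rho> + N + 1 - (1/2) ^ Suc k" unfolding h_def t_def
        using power_le_one[of "1/2::real" "Suc k"] by auto
      have t: "\<rho> \<le> t" unfolding t_def using power_le_one[of "1/2::real" k] by simp
      have hp: "h powr - p = 2 powr p * (2 powr p) ^ k"
      proof -
        have "h = 2 powr (- real (Suc k))"
          unfolding h_def powr_minus powr_realpow[OF zero_less_numeral] by (simp add: power_one_over inverse_eq_divide)
        then have "h powr - p = 2 powr (p + real k * p)" by (simp add: powr_powr algebra_simps)
        also have "\<dots> = 2 powr p * (2 powr p) powr real k" by (simp add: powr_add powr_powr mult.commute)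
        finally show ?thesis by (simp add: powr_realpow)
      qed
      have "m (t + h) powr \<alpha> \<le> C * h powr - p * (m t - m (t + h))" by (rule step[OF t h(1,2)])
      also have "\<dots> \<le> C * h powr - p * (\<delta> * \<theta> ^ k)"
        using C nn[of "t + h"] Suc.IH unfolding t_def[symmetric] by (intro mult_left_mono) auto
      \<comment> \<open>\<open>\<delta>\<close> and then \<open>\<theta> ^ k\<close> are split with
        exponents \<open>1 - \<alpha>\<close> and \<open>\<alpha>\<close>. The first parts absorb
        the constants: \<open>C * 2 powr p * \<delta> powr (1 - \<alpha>)\<close> is the factor
        \<open>\<theta> powr \<alpha>\<close> missing at index \<open>k + 1\<close>, and
        \<open>2 powr p * \<theta> powr (1 - \<alpha>)\<close> is at most 1.\<close>
      also have "\<dots> = (C * 2 powr p * \<delta> powr (1 - \<alpha>)) * \<delta> powr \<alpha> * ((2 powr p) ^ k * \<theta> ^ k)"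
      proof -
        have "\<delta> = \<delta> powr (1 - \<alpha>) * \<delta> powr \<alpha>" using \<delta>(1) by (simp add: powr_add[symmetric])
        then show ?thesis unfolding hp by (simp add: mult_ac)
      qed
      also have "\<dots> = \<theta> powr \<alpha> * \<delta> powr \<alpha> * ((2 powr p * \<theta> powr (1 - \<alpha>)) ^ k * (\<theta> powr \<alpha>) ^ k)"
      proof -
        have "\<theta> = \<theta> powr (1 - \<alpha>) * \<theta> powr \<alpha>" using \<theta>(1) by (simp add: powr_add[symmetric])
        then have "\<theta> ^ k = (\<theta> powr (1 - \<alpha>)) ^ k * (\<theta> powr \<alpha>) ^ k" by (metis power_mult_distrib)
        then show ?thesis unfolding \<delta>(2) by (simp add: power_mult_distrib mult_ac)
      qed
      also have "\<dots> \<le> \<theta> powr \<alpha> * \<delta> powr \<alpha> * (1 * (\<theta> powr \<alpha>) ^ k)"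
        using \<theta> by (intro mult_left_mono mult_right_mono power_le_one) auto
      also have "\<dots> = (\<delta> * \<theta> ^ Suc k) powr \<alpha>"
      proof -
        have "(\<theta> ^ k) powr \<alpha> = (\<theta> powr \<alpha>) ^ k"
          using \<theta>(1) by (simp add: powr_realpow[symmetric] powr_powr mult.commute)
        then show ?thesis using \<theta>(1) \<delta>(1) by (simp add: powr_mult mult_ac)
      qed
      finally have "m (t + h) powr \<alpha> \<le> (\<delta> * \<theta> ^ Suc k) powr \<alpha>" .
      then have "m (t + h) \<le> \<delta> * \<theta> ^ Suc k"
        using powr_less_mono2[of \<alpha> "\<delta> * \<theta> ^ Suc k" "m (t + h)"] \<alpha> \<delta>(1) \<theta>(1) by (meson less_eq_real_def mult_nonneg_nonneg not_less zero_le_power)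
      then show ?case unfolding h(3) .
    qed (use small in simp)
    have "m (\<rho> + N + 1) \<le> \<delta> * \<theta> ^ k" for k
      using anti[of "\<rho> + N + 1 - (1/2) ^ k" "\<rho> + N + 1"] decay[of k] by simp
    moreover have "(\<lambda>k. \<delta> * \<theta> ^ k) \<longlonglongrightarrow> \<delta> * 0"
      using \<theta> by (intro tendsto_mult tendsto_const LIMSEQ_power_zero) auto
    ultimately have "m (\<rho> + N + 1) \<le> 0"
      by (intro LIMSEQ_le_const[of "\<lambda>k. \<delta> * \<theta> ^ k" 0]) auto
    then show "m (\<rho> + N + 1) = 0" using nn[of "\<rho> + N + 1"] by simp
  qed simp
qed

text \<open>Convexity of the power \<open>p\<close> absorbs the factor \<open>\<eta>\<close> in front of the gradient: the first summand on the
  right carries no constant larger than one, so that it cancels against the energy of the minimizer.\<close>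

lemma truncation_energy_bound:
  fixes p a b q L :: real and N :: nat
  assumes p: "1 < p" "p \<le> real N" and q: "0 \<le> q" "q \<le> 1" and nn: "0 \<le> a" "0 \<le> b" "0 \<le> L"
  shows "((1 - q ^ N) * a + b * (real N * q ^ (N - 1) * L)) powr p \<le> a powr p + (b * real N * L) powr p"
proof (cases "q = 0")
  case True
  \<comment> \<open>\<open>p > 1\<close> forces \<open>N\<close> to be at least 2, so both powers of
    \<open>q = 0\<close> vanish and the left side is \<open>a powr p\<close>.\<close>
  have "N - 1 \<noteq> 0" "N \<noteq> 0" using p by auto
  then show ?thesis using True by (simp add: power_0_left)
next
  case False
  have N: "N \<ge> 1" using p by (cases N) auto
  \<comment> \<open>Chosen so that the second summand becomes \<open>y\<close> with weight
    \<open>q ^ N\<close>, the complement of the weight \<open>1 - q ^ N\<close> of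
    \<open>a\<close>.\<close>
  define y where "y = b * real N * L / q"
  have y: "y \<ge> 0" using nn q by (simp add: y_def)
  have "q ^ N = q * q ^ (N - 1)" using N by (metis One_nat_def Suc_pred less_eq_Suc_le power_Suc)
  then have eq: "b * (real N * q ^ (N - 1) * L) = (1 - (1 - q ^ N)) * y"
    using False by (simp add: y_def)
  have l: "0 \<le> 1 - q ^ N" "1 - q ^ N \<le> 1" using q by (auto intro: power_le_one)
  have "((1 - q ^ N) * a + b * (real N * q ^ (N - 1) * L)) powr p
      \<le> (1 - q ^ N) * a powr p + (1 - (1 - q ^ N)) * y powr p"
    unfolding eq by (rule powr_convex_nonneg[OF _ l nn(1) y]) (use p in simp)
  also have "(1 - q ^ N) * a powr p \<le> 1 * a powr p" using l by (intro mult_right_mono) auto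
  \<comment> \<open>The weight \<open>q ^ N\<close> meets the factor \<open>q powr - p\<close>
    hidden in \<open>y powr p\<close>. Their product stays bounded near \<open>q = 0\<close> because
    \<open>N\<close> is at least \<open>p\<close>; this is the reason for the power in
    \<open>cutoff\<close>.\<close>
  also have "(1 - (1 - q ^ N)) * y powr p = q powr (real N - p) * (b * real N * L) powr p"
  proof -
    have "y powr p = (b * real N * L) powr p / q powr p"
      unfolding y_def using nn q by (simp add: powr_divide)
    moreover have "q ^ N = q powr real N" using False q by (simp add: powr_realpow)
    ultimately show ?thesis using False q by (simp add: powr_diff)
  qed
  also have "\<dots> \<le> 1 * (b * real N * L) powr p"
  proof (rule mult_right_mono)
    show "q powr (real N - p) \<le> 1" using q p False by (intro powr_le1) auto
  qed simp
  finally show ?thesis by simp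
qed

subsection \<open>Competitors\<close>

text \<open>Replaces the chosen weak gradient by an explicit one and moves the integral to the whole
  space, where the pointwise energy estimates are integrated.\<close>

lemma nn_integral_weak_gradient:
  fixes U :: "'a::euclidean_space set"
  assumes U: "open U" and G: "has_weak_gradient U v G"
  shows "(\<integral>\<^sup>+x\<in>U. ennreal (norm (weak_gradient U v x) powr p) \<partial>lebesgue)
    = (\<integral>\<^sup>+x. ennreal (norm (indicator U x *\<^sub>R G x) powr p) \<partial>lebesgue)"
proof (rule nn_integral_cong_AE)
  show "AE x in lebesgue. ennreal (norm (weak_gradient U v x) powr p) * indicator U x
      = ennreal (norm (indicator U x *\<^sub>R G x) powr p)"
    using weak_gradient_AE_unique[OF U weak_gradient_properties[OF G] G]
    by eventually_elim (auto simp: indicator_def)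
qed

lemma indicator_scaleR_measurable:
  fixes U :: "'a::euclidean_space set" and G :: "'a \<Rightarrow> 'a"
  assumes "open U" "has_weak_gradient U v G"
  shows "(\<lambda>x. indicator U x *\<^sub>R G x) \<in> borel_measurable lebesgue"
  using has_weak_gradient_measurable(2)[OF assms] assms(1) by (simp add: borel_measurable_restrict_space_iff)

text \<open>The sequence that approximates \<open>u\<close> and is one near \<open>K\<close> serves
  for both closures in \<open>admissible\<close>: \<open>\<Phi> 1 = 1\<close> and
  \<open>\<eta> = 1\<close> on \<open>W\<close> keep the truncated approximants equal to one near
  \<open>K\<close>.\<close>

lemma truncated_admissible:
  fixes K :: "'a::euclidean_space set"
  assumes u: "u \<in> admissible R K"
    and G: "square_integrable (ball 0 R) u" "square_integrable (ball 0 R) G" "has_weak_gradient (ball 0 R) u G"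
    and \<Phi>: "smooth \<Phi>" "\<Phi> 0 = 0" "\<Phi> 1 = 1" "\<And>s. \<bar>dir_deriv 1 \<Phi> s\<bar> \<le> c" "\<And>s. \<bar>\<Phi> s\<bar> \<le> b"
    and \<eta>: "smooth \<eta>" "\<And>x. \<bar>\<eta> x\<bar> \<le> 1" "\<And>x. norm (gradient \<eta> x) \<le> B"
    and W: "open W" "K \<subseteq> W" "\<And>x. x \<in> W \<Longrightarrow> \<eta> x = 1"
  shows "(\<lambda>x. \<Phi> (u x) * \<eta> x) \<in> admissible R K"
    and "has_weak_gradient (ball 0 R) (\<lambda>x. \<Phi> (u x) * \<eta> x)
      (\<lambda>x. (\<eta> x * dir_deriv 1 \<Phi> (u x)) *\<^sub>R G x + \<Phi> (u x) *\<^sub>R gradient \<eta> x)"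
proof -
  let ?U = "ball (0::'a) R" and ?A = "{\<phi> \<in> test_functions (ball 0 R). \<exists>V. open V \<and> K \<subseteq> V \<and> (\<forall>x\<in>V. \<phi> x = 1)}"
  have "u \<in> H1_closure ?U ?A" using u unfolding admissible_def eq_one_on_def by blast
  then obtain \<phi> where \<phi>: "\<And>k::nat. \<phi> k \<in> ?A" and lim: "(\<lambda>k. H1_norm ?U (\<lambda>x. \<phi> k x - u x)) \<longlonglongrightarrow> 0"
    unfolding H1_closure_def by blast
  have t\<phi>: "\<phi> k \<in> test_functions ?U" for k using \<phi>[of k] by blast
  obtain r :: "nat \<Rightarrow> nat" where r:
    "\<And>k. (\<lambda>x. \<Phi> (\<phi> k x) * \<eta> x) \<in> test_functions ?U"
    "(\<lambda>k. H1_norm ?U (\<lambda>x. \<Phi> (\<phi> (r k) x) * \<eta> x - \<Phi> (u x) * \<eta> x)) \<longlonglongrightarrow> 0"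
    "has_weak_gradient ?U (\<lambda>x. \<Phi> (u x) * \<eta> x) (\<lambda>x. (\<eta> x * dir_deriv 1 \<Phi> (u x)) *\<^sub>R G x + \<Phi> (u x) *\<^sub>R gradient \<eta> x)"
    "(\<lambda>x. \<Phi> (u x) * \<eta> x) \<in> H1 ?U"
    by (rule H1_truncate[OF open_ball bounded_ball t\<phi> G lim \<Phi>(1,2,4,5) \<eta>]) (rule that, assumption+)
  have inA: "(\<lambda>x. \<Phi> (\<phi> k x) * \<eta> x) \<in> ?A" for k
  proof -
    obtain V where V: "open V" "K \<subseteq> V" "\<And>x. x \<in> V \<Longrightarrow> \<phi> k x = 1" using \<phi>[of k] by blast
    have "open (V \<inter> W)" "K \<subseteq> V \<inter> W" "\<forall>x\<in>V \<inter> W. \<Phi> (\<phi> k x) * \<eta> x = 1"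
      using V W \<Phi>(3) by auto
    then show ?thesis using r(1)[of k] by blast
  qed
  have 1: "(\<lambda>x. \<Phi> (u x) * \<eta> x) \<in> H1_closure ?U ?A"
    unfolding H1_closure_def using r(2,4) inA
    by (intro CollectI conjI exI[of _ "\<lambda>k x. \<Phi> (\<phi> (r k) x) * \<eta> x"]) auto
  have 2: "(\<lambda>x. \<Phi> (u x) * \<eta> x) \<in> H1_closure ?U (test_functions ?U)"
    unfolding H1_closure_def using r(1,2,4)
    by (intro CollectI conjI exI[of _ "\<lambda>k x. \<Phi> (\<phi> (r k) x) * \<eta> x"]) auto
  have 3: "\<Phi> (u x) * \<eta> x = 0" if "x \<notin> ?U" for x
  proof -
    have "u x = 0" using u that unfolding admissible_def H10_def by blast
    then show ?thesis using \<Phi>(2) by simp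
  qed
  show "(\<lambda>x. \<Phi> (u x) * \<eta> x) \<in> admissible R K"
    unfolding admissible_def H10_def eq_one_on_def
    by (intro CollectI conjI allI impI 1 2 3)
  show "has_weak_gradient ?U (\<lambda>x. \<Phi> (u x) * \<eta> x)
      (\<lambda>x. (\<eta> x * dir_deriv 1 \<Phi> (u x)) *\<^sub>R G x + \<Phi> (u x) *\<^sub>R gradient \<eta> x)" by (rule r(3))
qed

lemma test_function_admissible:
  fixes K :: "'a::euclidean_space set"
  assumes \<phi>: "\<phi> \<in> test_functions (ball 0 R)" and V: "open V" "K \<subseteq> V" "\<And>x. x \<in> V \<Longrightarrow> \<phi> x = 1"
  shows "\<phi> \<in> admissible R K"
proof -
  let ?U = "ball (0::'a) R"
  note tf = test_function_facts[OF open_ball bounded_ball \<phi>]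
  have "H1_norm ?U (\<lambda>x. \<phi> x - \<phi> x) = 0"
    using H1_norm_eq[OF open_ball has_weak_gradient_diff[OF open_ball tf(3) tf(3)]] by simp
  then have lim: "(\<lambda>k::nat. H1_norm ?U (\<lambda>x. \<phi> x - \<phi> x)) \<longlonglongrightarrow> 0" by simp
  have H1: "\<phi> \<in> H1 ?U" using tf unfolding H1_def by blast
  have cl: "\<phi> \<in> H1_closure ?U A" if "\<phi> \<in> A" for A
    unfolding H1_closure_def using H1 lim that by (intro CollectI conjI exI[of _ "\<lambda>k. \<phi>"]) auto
  obtain D where "D \<subseteq> ?U" "\<And>x. x \<notin> D \<Longrightarrow> \<phi> x = 0"
    using test_function_compact_support[OF \<phi>] by metis
  then have z: "\<phi> x = 0" if "x \<notin> ?U" for x using that by blast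
  have A: "\<phi> \<in> {\<phi> \<in> test_functions ?U. \<exists>V. open V \<and> K \<subseteq> V \<and> (\<forall>x\<in>V. \<phi> x = 1)}"
    using \<phi> V by blast
  have "\<phi> \<in> H10 ?U" unfolding H10_def by (intro CollectI conjI allI impI cl \<phi> z)
  moreover have "eq_one_on ?U K \<phi>" unfolding eq_one_on_def by (rule cl[OF A])
  ultimately show ?thesis by (simp add: admissible_def)
qed

text \<open>Continuity is known only inside the ball; as \<open>u\<close> vanishes outside, the
  positivity set is nevertheless open in the whole space.\<close>

lemma positivity_set_facts:
  fixes K :: "'a::euclidean_space set"
  assumes "continuous_minimizer p R K u"
  shows "open {x. u x > 0}" "{x. u x > 0} \<subseteq> ball 0 R" "{x. u x > 0} \<in> sets borel" "bounded {x. u x > 0}"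
proof -
  have z: "\<And>x. x \<notin> ball 0 R \<Longrightarrow> u x = 0" and c: "continuous_on (ball 0 R) u"
    using assms unfolding continuous_minimizer_def admissible_def H10_def by auto
  show sub: "{x. u x > 0} \<subseteq> ball 0 R" using z by (metis less_irrefl mem_Collect_eq subsetI)
  have "open (ball 0 R \<inter> u -` {0<..})"
    by (rule continuous_open_preimage[OF c open_ball]) simp
  moreover have "ball 0 R \<inter> u -` {0<..} = {x. u x > 0}" using sub by auto
  ultimately show op: "open {x. u x > 0}" by simp
  then show "{x. u x > 0} \<in> sets borel" by (rule borel_open)
  show "bounded {x. u x > 0}" by (rule bounded_subset[OF bounded_ball sub])
qed

text \<open>Minimality against the truncated and cut off \<open>u\<close>, whose positivity set is
  the inner part of \<open>E\<close> for every slope \<open>c\<close>. Only the factor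
  \<open>c powr p\<close> in front of the energy of \<open>u\<close> depends on \<open>c\<close>,
  and it tends to 1.\<close>

lemma minimizer_cut:
  fixes K :: "'a::euclidean_space set"
  assumes min: "continuous_minimizer p R K u" and fin: "functional_I p R u < \<infinity>"
    and p: "1 < p" "p \<le> real N" and ts: "0 \<le> t" "t < s" and K: "K \<subseteq> ball 0 t"
    and Q: "perimeter ({x. u x > 0} \<inter> ball 0 s) < \<infinity>"
  shows "perimeter {x. u x > 0} \<le> perimeter ({x. u x > 0} \<inter> ball 0 s)
    + ennreal ((4 * real N * (cutoff_slope / (s - t))) powr p * measure lborel ({x. u x > 0} \<inter> (ball 0 s - ball 0 t)))"
proof -
  let ?U = "ball (0::'a) R"
  define E where "E = {x. u x > 0}"
  note Ef = positivity_set_facts[OF min, folded E_def]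
  have u: "u \<in> admissible R K" and opt: "\<And>v. v \<in> admissible R K \<Longrightarrow> functional_I p R u \<le> functional_I p R v"
    using min unfolding continuous_minimizer_def by auto
  have "u \<in> H1 ?U" using u unfolding admissible_def eq_one_on_def H1_closure_def by blast
  then obtain G where G: "square_integrable ?U u" "square_integrable ?U G" "has_weak_gradient ?U u G"
    unfolding H1_def by blast
  have N: "N \<ge> 1" using p by (cases N) auto
  define \<eta> where "\<eta> = cutoff N t s (0::'a)"
  define L where "L = cutoff_slope / (s - t)"
  have L: "L > 0" using cutoff_slope(1) ts by (simp add: L_def)
  have \<eta>01: "0 \<le> \<eta> x" "\<eta> x \<le> 1" for x unfolding \<eta>_def using cutoff_bounds[OF N ts] by auto
  have s\<eta>: "smooth \<eta>" unfolding \<eta>_def by (rule smooth_cutoff[OF N ts])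
  define q where "q x = step (((norm (x - (0::'a)))\<^sup>2 - t\<^sup>2) / (s\<^sup>2 - t\<^sup>2))" for x
  have q: "0 \<le> q x" "q x \<le> 1" "\<eta> x = 1 - q x ^ N" for x
    unfolding q_def \<eta>_def cutoff_def using step_bounds by auto
  have g\<eta>: "norm (gradient \<eta> x) \<le> real N * q x ^ (N - 1) * L" for x
    using cutoff_gradient_le[OF N ts, where c=0 and x=x] unfolding q_def \<eta>_def L_def .
  have g\<eta>B: "norm (gradient \<eta> x) \<le> real N * L" for x
  proof -
    have "real N * q x ^ (N - 1) * L \<le> real N * 1 * L"
      using q L by (intro mult_right_mono mult_left_mono power_le_one) auto
    then show ?thesis using g\<eta>[of x] by simp
  qed
  define A where "A = (\<integral>\<^sup>+x. ennreal (norm (indicator ?U x *\<^sub>R G x) powr p) \<partial>lebesgue)"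
  define X where "X = (4 * real N * L) powr p * measure lborel (E \<inter> (ball 0 s - ball 0 t))"
  have X0: "X \<ge> 0" unfolding X_def by simp
  have Fu: "functional_I p R u = A + perimeter E"
    unfolding functional_I_def A_def E_def nn_integral_weak_gradient[OF open_ball G(3)] ..
  define S where "S = E \<inter> (ball 0 s - ball 0 t)"
  have Sb: "S \<in> sets borel" unfolding S_def using Ef by auto
  have Sfin: "emeasure lborel S < \<infinity>"
    by (rule emeasure_bounded_finite[OF bounded_subset[OF Ef(4)]]) (auto simp: S_def)
  \<comment> \<open>Slopes are restricted to \<open>c \<le> 2\<close>, so that the truncation is
    bounded by \<open>2 * c \<le> 4\<close> and the shell term \<open>X\<close> with its factor 4 is
    the same for all of them.\<close>
  have compare: "A + perimeter E \<le> ennreal (c powr p) * A + ennreal X + perimeter (E \<inter> ball 0 s)"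
    if c: "1 < c" "c \<le> 2" for c
  proof -
    obtain \<Phi> :: "real \<Rightarrow> real" where \<Phi>:
      "smooth \<Phi>" "\<And>s. s \<le> 0 \<Longrightarrow> \<Phi> s = 0" "\<And>s. s > 0 \<Longrightarrow> \<Phi> s > 0" "\<Phi> 1 = 1"
      "\<And>s. 0 \<le> dir_deriv 1 \<Phi> s" "\<And>s. dir_deriv 1 \<Phi> s \<le> c" "\<And>s. \<Phi> s \<le> 2 * c"
      by (rule smooth_truncation_exists[OF c(1)]) (rule that, assumption+)
    have \<Phi>0: "\<Phi> s \<ge> 0" for s using \<Phi>(2,3)[of s] by (cases "s \<le> 0") auto
    define v where "v = (\<lambda>x. \<Phi> (u x) * \<eta> x)"
    define H where "H = (\<lambda>x. (\<eta> x * dir_deriv 1 \<Phi> (u x)) *\<^sub>R G x + \<Phi> (u x) *\<^sub>R gradient \<eta> x)"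
    have vH: "v \<in> admissible R K" "has_weak_gradient ?U v H"
    proof -
      have 1: "\<Phi> 0 = 0" using \<Phi>(2) by simp
      have 2: "\<bar>dir_deriv 1 \<Phi> s\<bar> \<le> c" "\<bar>\<Phi> s\<bar> \<le> 2 * c" for s
        using \<Phi>(5,6,7)[of s] \<Phi>0[of s] by auto
      have 3: "\<bar>\<eta> x\<bar> \<le> 1" for x using \<eta>01[of x] by simp
      have 4: "\<eta> x = 1" if "x \<in> ball 0 t" for x
        unfolding \<eta>_def by (rule cutoff_eq_1[OF N ts]) (use that in simp)
      show "v \<in> admissible R K" "has_weak_gradient ?U v H"
        unfolding v_def H_def
        by (rule truncated_admissible[OF u G \<Phi>(1) 1 \<Phi>(4) 2 s\<eta> 3 g\<eta>B open_ball K 4], assumption)+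
    qed
    have pos: "{x. v x > 0} = E \<inter> ball 0 s"
    proof -
      have "\<eta> x > 0 \<longleftrightarrow> x \<in> ball 0 s" for x
        unfolding \<eta>_def using cutoff_pos_iff[OF N ts, of 0 x] by simp
      moreover have "\<Phi> (u x) > 0 \<longleftrightarrow> x \<in> E" for x
        using \<Phi>(2,3)[of "u x"] by (cases "u x > 0") (auto simp: E_def)
      moreover have "v x > 0 \<longleftrightarrow> \<Phi> (u x) > 0 \<and> \<eta> x > 0" for x
        using \<Phi>0[of "u x"] \<eta>01(1)[of x] unfolding v_def zero_less_mult_iff by linarith
      ultimately show ?thesis by blast
    qed
    have pt: "norm (indicator ?U x *\<^sub>R H x) powr p
        \<le> c powr p * norm (indicator ?U x *\<^sub>R G x) powr p + (4 * real N * L) powr p * indicator S x" for x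
    proof (cases "x \<in> ?U")
      case True
      define a where "a = dir_deriv 1 \<Phi> (u x) * norm (G x)"
      \<comment> \<open>A bound for the factor \<open>\<Phi> (u x)\<close> of the gradient of
        \<open>\<eta>\<close>. Outside \<open>S\<close> one of the two factors vanishes, which is
        why only the volume of \<open>E\<close> in the shell is paid.\<close>
      define b where "b = (if x \<in> S then 2 * c else 0)"
      have a0: "0 \<le> a" unfolding a_def using \<Phi>(5) by simp
      have b0: "0 \<le> b" unfolding b_def using c by simp
      have b1: "\<Phi> (u x) * norm (gradient \<eta> x) \<le> b * (real N * q x ^ (N - 1) * L)"
      proof (cases "x \<in> S")
        case True
        then show ?thesis unfolding b_def using \<Phi>(7)[of "u x"] g\<eta>[of x] c \<Phi>0[of "u x"]
          by (auto intro!: mult_mono)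
      next
        case False
        then consider "x \<notin> E" | "norm x \<le> t \<or> norm x \<ge> s" by (auto simp: S_def)
        then have z0: "\<Phi> (u x) * norm (gradient \<eta> x) = 0"
        proof cases
          case 1
          then show ?thesis using \<Phi>(2)[of "u x"] by (simp add: E_def)
        next
          case 2
          then show ?thesis using cutoff_gradient_eq_0[OF N ts, where c=0 and x=x] by (simp add: \<eta>_def)
        qed
        show ?thesis unfolding z0 using False by (simp add: b_def)
      qed
      have "norm (H x) \<le> norm ((\<eta> x * dir_deriv 1 \<Phi> (u x)) *\<^sub>R G x) + norm (\<Phi> (u x) *\<^sub>R gradient \<eta> x)"
        unfolding H_def by (rule norm_triangle_ineq)
      also have "\<dots> = (1 - q x ^ N) * a + \<Phi> (u x) * norm (gradient \<eta> x)"
        unfolding a_def using \<eta>01[of x] \<Phi>(5) \<Phi>0 q(3)[of x] by (simp add: abs_mult)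
      also have "\<dots> \<le> (1 - q x ^ N) * a + b * (real N * q x ^ (N - 1) * L)" using b1 by simp
      finally have "norm (H x) powr p \<le> ((1 - q x ^ N) * a + b * (real N * q x ^ (N - 1) * L)) powr p"
        using p by (intro powr_mono2) auto
      also have "\<dots> \<le> a powr p + (b * real N * L) powr p"
        by (rule truncation_energy_bound[OF p q(1,2) a0 b0]) (use L in simp)
      also have "a powr p \<le> (c * norm (G x)) powr p"
        using \<Phi>(5,6)[of "u x"] a0 p unfolding a_def by (intro powr_mono2 mult_right_mono) auto
      also have "(c * norm (G x)) powr p = c powr p * norm (G x) powr p"
        using c by (simp add: powr_mult)
      also have "(b * real N * L) powr p \<le> (4 * real N * L) powr p * indicator S x"
      proof (cases "x \<in> S")
        case True
        then show ?thesis
          unfolding b_def using c p L by (simp, intro powr_mono2 mult_right_mono) auto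
      qed (simp add: b_def)
      finally show ?thesis using True by simp
    qed simp
    have Gm: "(\<lambda>x. ennreal (norm (indicator ?U x *\<^sub>R G x) powr p)) \<in> borel_measurable lebesgue"
      using indicator_scaleR_measurable[OF open_ball G(3)] by measurable
    have Sm: "(\<lambda>x. indicator S x :: ennreal) \<in> borel_measurable lebesgue"
      by (rule borel_measurable_indicator) (use Sb in simp)
    have "(\<integral>\<^sup>+x. ennreal (norm (indicator ?U x *\<^sub>R H x) powr p) \<partial>lebesgue)
        \<le> (\<integral>\<^sup>+x. ennreal (c powr p) * ennreal (norm (indicator ?U x *\<^sub>R G x) powr p)
            + ennreal ((4 * real N * L) powr p) * indicator S x \<partial>lebesgue)"
    proof (rule nn_integral_mono)
      fix x
      have "ennreal (norm (indicator ?U x *\<^sub>R H x) powr p)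
        \<le> ennreal (c powr p * norm (indicator ?U x *\<^sub>R G x) powr p + (4 * real N * L) powr p * indicator S x)"
        by (rule ennreal_leI[OF pt])
      also have "\<dots> = ennreal (c powr p) * ennreal (norm (indicator ?U x *\<^sub>R G x) powr p)
            + ennreal ((4 * real N * L) powr p) * indicator S x"
        by (subst ennreal_plus) (auto simp: ennreal_mult' ennreal_indicator)
      finally show "ennreal (norm (indicator ?U x *\<^sub>R H x) powr p)
        \<le> ennreal (c powr p) * ennreal (norm (indicator ?U x *\<^sub>R G x) powr p)
            + ennreal ((4 * real N * L) powr p) * indicator S x" .
    qed
    also have "\<dots> = ennreal (c powr p) * A + ennreal ((4 * real N * L) powr p) * emeasure lebesgue S"
      unfolding A_def using Gm Sm Sb by (simp add: nn_integral_add nn_integral_cmult nn_integral_cmult_indicator)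
    also have "ennreal ((4 * real N * L) powr p) * emeasure lebesgue S = ennreal X"
    proof -
      have "emeasure lebesgue S = emeasure lborel S" using Sb by simp
      also have "\<dots> = ennreal (measure lborel S)" using Sfin by (intro emeasure_eq_ennreal_measure) auto
      finally show ?thesis unfolding X_def S_def[symmetric] by (simp add: ennreal_mult)
    qed
    finally have "functional_I p R v \<le> ennreal (c powr p) * A + ennreal X + perimeter (E \<inter> ball 0 s)"
      unfolding functional_I_def pos nn_integral_weak_gradient[OF open_ball vH(2)] by (rule add_right_mono)
    then show ?thesis using opt[OF vH(1)] unfolding Fu by (rule order_trans[rotated])
  qed
  \<comment> \<open>\<open>G\<close> is known to be square integrable only; its energy with exponent
    \<open>p\<close> is finite because that of \<open>u\<close> is. The comparison is moved to real
    numbers since this energy is about to be cancelled.\<close>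
  have Afin: "A < \<infinity>" and Pfin: "perimeter E < \<infinity>" using fin unfolding Fu by (auto simp: less_top)
  obtain a where a: "A = ennreal a" "a \<ge> 0" using Afin by (cases A) auto
  obtain e where e: "perimeter E = ennreal e" "e \<ge> 0" using Pfin by (cases "perimeter E") auto
  obtain f where f: "perimeter (E \<inter> ball 0 s) = ennreal f" "f \<ge> 0"
    using Q[folded E_def] by (cases "perimeter (E \<inter> ball 0 s)") auto
  have real: "a + e \<le> c powr p * a + X + f" if "1 < c" "c \<le> 2" for c
  proof -
    have "ennreal (a + e) \<le> ennreal (c powr p * a + X + f)"
      using compare[OF that] a e f X0 by (simp add: ennreal_plus ennreal_mult)
    then show ?thesis by (rule ennreal_le_iff[THEN iffD1, rotated]) (use a f X0 in simp)
  qed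
  \<comment> \<open>The slopes \<open>1 + 1 / (k + 1)\<close> lie in the allowed range and tend to
    1; in the limit the energy \<open>a\<close> appears with factor one on both sides.\<close>
  have "a + e \<le> 1 powr p * a + X + f"
  proof (rule LIMSEQ_le_const)
    have "(\<lambda>k. 1 + 1 / real (Suc k)) \<longlonglongrightarrow> 1 + 0"
      using LIMSEQ_inverse_real_of_nat by (intro tendsto_add tendsto_const) (simp add: inverse_eq_divide)
    then show "(\<lambda>k. (1 + 1 / real (Suc k)) powr p * a + X + f) \<longlonglongrightarrow> 1 powr p * a + X + f"
      by (intro tendsto_intros) auto
    show "\<exists>N. \<forall>k\<ge>N. a + e \<le> (1 + 1 / real (Suc k)) powr p * a + X + f"
      using real[of "1 + 1 / real (Suc _)"] by auto
  qed
  then have "e \<le> f + X" by simp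
  then have "ennreal e \<le> ennreal f + ennreal X" using f X0 by (simp add: ennreal_plus[symmetric] ennreal_leI del: ennreal_plus)
  then show ?thesis unfolding E_def[symmetric] e f X_def L_def .
qed

lemma integral_zero_field: "(LINT x|lborel. indicator E x * divergence (\<lambda>x::'a::euclidean_space. 0) x) = 0"
  by (simp add: divergence_def dir_deriv_eq[OF has_derivative_const])

text \<open>With \<open>B\<close> from cutting and \<open>D\<close> from the competitor, the
  perimeter of the part of \<open>E\<close> outside \<open>s\<close> is at most
  \<open>B + D\<close>, and the isoperimetric inequality turns this into the recursion.
  \<open>C\<close> depends only on \<open>p\<close> and the dimension.\<close>

lemma minimizer_volume_decay:
  fixes p :: real
  assumes p: "1 < p"
  obtains C where "C > 0"
    "\<And>R (K::'a::euclidean_space set) u t h. continuous_minimizer p R K u \<Longrightarrow> functional_I p R u < \<infinity> \<Longrightarrow>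
      0 \<le> t \<Longrightarrow> K \<subseteq> ball 0 t \<Longrightarrow> 0 < h \<Longrightarrow> h \<le> 1 \<Longrightarrow>
      measure lborel ({x. u x > 0} - ball 0 (t + h)) powr (1 - 1 / DIM('a))
      \<le> C * h powr - p * (measure lborel ({x. u x > 0} - ball 0 t) - measure lborel ({x. u x > 0} - ball 0 (t + h)))"
proof -
  define M where "M = cutoff_slope"
  have M: "M > 0" unfolding M_def by (rule cutoff_slope(1))
  obtain c where c: "c > 0"
    "\<And>(E::'a set) P. E \<in> sets borel \<Longrightarrow> bounded E \<Longrightarrow> perimeter_le E P \<Longrightarrow>
       measure lborel E \<le> c * measure lborel E powr (1 / DIM('a)) * P"
    by (rule isoperimetric_inequality) (rule that, assumption+)
  \<comment> \<open>The exponent of the cutoff must be at least \<open>p\<close>; taking it as a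
    function of \<open>p\<close> alone keeps \<open>C\<close> independent of the minimizer.\<close>
  define N where "N = nat \<lceil>p\<rceil>"
  have pN: "p \<le> real N" unfolding N_def by linarith
  then have N: "N \<ge> 1" using p by (cases N) auto
  \<comment> \<open>\<open>4 * M\<close> comes from \<open>B\<close>, with \<open>2 * M\<close> from
    \<open>perimeter_cut\<close> and a shell of width \<open>h / 2\<close>;
    \<open>8 * real N * M\<close> comes from \<open>D\<close>, where \<open>4 * real N * M\<close>
    is divided by \<open>s - t > h / 2\<close>.\<close>
  define C where "C = c * (4 * M + (8 * real N * M) powr p)"
  show thesis
  proof (rule that[of C])
    show "C > 0" unfolding C_def using c(1) M by (intro mult_pos_pos add_pos_nonneg) auto
    fix R t h :: real and K :: "'a set" and u :: "'a \<Rightarrow> real"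
    assume min: "continuous_minimizer p R K u" and fin: "functional_I p R u < \<infinity>"
      and t: "0 \<le> t" and K: "K \<subseteq> ball 0 t" and h: "0 < h" "h \<le> 1"
    define E where "E = {x. u x > 0}"
    note Ef = positivity_set_facts[OF min, folded E_def]
    define f where "f r = measure lborel (E \<inter> ball 0 r)" for r
    define m where "m r = measure lborel (E - ball 0 r)" for r
    have bB: "E \<inter> ball 0 r \<in> sets borel" "bounded (E \<inter> ball 0 r)" "E - ball 0 r \<in> sets borel" "bounded (E - ball 0 r)" for r
      using Ef(3,4) by (auto intro: bounded_subset[OF Ef(4)])
    have fE: "E \<in> fmeasurable lborel" by (rule fmeasurable_borel_bounded[OF Ef(3,4)])
    have mf: "m r = measure lborel E - f r" for r
    proof -
      have "E - ball 0 r = E - E \<inter> ball 0 r" by auto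
      then show ?thesis
        unfolding m_def f_def by (simp only:) (rule measurable_measure_Diff[OF fE], use bB in auto)
    qed
    have f_mono: "f r \<le> f r'" if "r \<le> r'" for r r'
      unfolding f_def
      by (rule measure_mono_fmeasurable[OF _ _ fmeasurable_borel_bounded[OF bB(1,2)]]) (use that bB in auto)
    define X where "X = m t - m (t + h)"
    have X: "X = f (t + h) - f t" "X \<ge> 0" unfolding X_def mf using f_mono[of t "t + h"] h by auto
    have pfin: "perimeter E < \<infinity>" using fin unfolding functional_I_def E_def by (auto simp: less_top)
    then obtain P where P: "perimeter E = ennreal P" "P \<ge> 0" by (cases "perimeter E") auto
    then have PE: "perimeter_le E P" using perimeter_le_ennreal_iff[OF Ef(3,4) P(2)] by simp
    \<comment> \<open>The cut is made in the outer half of the step, so that the cutoff, which is 1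
      up to radius \<open>t\<close>, has room of width more than \<open>h / 2\<close> to reach 0 at
      \<open>s\<close>.\<close>
    define B where "B = 2 * M * (f (t + h) - f (t + h / 2)) / ((t + h) - (t + h / 2))"
    have "\<exists>s. t + h / 2 < s \<and> s \<le> t + h \<and> (\<forall>T1\<in>perimeter_fields. \<forall>T2\<in>perimeter_fields.
        (LINT x|lborel. indicator (E \<inter> ball 0 s) x * divergence T1 x)
        + (LINT x|lborel. indicator (E - ball 0 s) x * divergence T2 x) \<le> P + B)"
      unfolding B_def f_def M_def by (rule perimeter_cut[OF Ef(3) PE]) (use t h in auto)
    then obtain s where s: "t + h / 2 < s" "s \<le> t + h"
      and cut: "\<And>T1 T2. T1 \<in> perimeter_fields \<Longrightarrow> T2 \<in> perimeter_fields \<Longrightarrow>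
        (LINT x|lborel. indicator (E \<inter> ball 0 s) x * divergence T1 x)
        + (LINT x|lborel. indicator (E - ball 0 s) x * divergence T2 x) \<le> P + B"
      by blast
    have ts: "t < s" using s h by simp
    \<comment> \<open>The zero field outside isolates the inner part and gives the finiteness of its
      perimeter required by \<open>minimizer_cut\<close>.\<close>
    have inner: "perimeter_le (E \<inter> ball 0 s) (P + B)"
      unfolding perimeter_le_def using cut[OF _ zero_field] by (simp add: integral_zero_field)
    have "perimeter (E \<inter> ball 0 s) \<le> ennreal (P + B)"
      using perimeter_le_ennreal_iff[OF bB(1,2) perimeter_le_nonneg[OF inner]] inner by simp
    then have Qfin: "perimeter (E \<inter> ball 0 s) < \<infinity>" by (simp add: le_less_trans)
    then obtain S where S: "perimeter (E \<inter> ball 0 s) = ennreal S" "S \<ge> 0"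
      by (cases "perimeter (E \<inter> ball 0 s)") auto
    define D where "D = (4 * real N * (M / (s - t))) powr p * measure lborel (E \<inter> (ball 0 s - ball 0 t))"
    have D0: "D \<ge> 0" unfolding D_def by simp
    have "perimeter E \<le> perimeter (E \<inter> ball 0 s) + ennreal D"
      unfolding D_def E_def M_def
      by (rule minimizer_cut[OF min fin p pN t ts K Qfin[unfolded E_def]])
    then have "ennreal P \<le> ennreal (S + D)" unfolding P S using S(2) D0 by simp
    then have PSD: "P \<le> S + D" by (rule ennreal_le_iff[THEN iffD1, rotated]) (use S(2) D0 in simp)
    have outer: "perimeter_le (E - ball 0 s) (B + D)"
      unfolding perimeter_le_def
    proof
      fix T2 :: "'a \<Rightarrow> 'a" assume T2: "T2 \<in> perimeter_fields"
      let ?I = "LINT x|lborel. indicator (E - ball 0 s) x * divergence T2 x"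
      \<comment> \<open>For a fixed outer field, its contribution \<open>?I\<close> is subtracted
        from the bound valid for all inner fields. This yields \<open>S \<le> P + B - ?I\<close>,
        and with \<open>P \<le> S + D\<close> both unknown perimeters drop out.\<close>
      have le: "perimeter_le (E \<inter> ball 0 s) (P + B - ?I)"
        unfolding perimeter_le_def
      proof
        fix T1 :: "'a \<Rightarrow> 'a" assume "T1 \<in> perimeter_fields"
        from cut[OF this T2]
        show "(LINT x|lborel. indicator (E \<inter> ball 0 s) x * divergence T1 x) \<le> P + B - ?I" by linarith
      qed
      then have "ennreal S \<le> ennreal (P + B - ?I)"
        using perimeter_le_ennreal_iff[OF bB(1,2) perimeter_le_nonneg[OF le]] S(1) by metis
      then have "S \<le> P + B - ?I"
        by (rule ennreal_le_iff[THEN iffD1, OF perimeter_le_nonneg[OF le]])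
      then show "?I \<le> B + D" using PSD by linarith
    qed
    \<comment> \<open>For steps of length at most 1 and \<open>p > 1\<close>, the perimeter term of
      order \<open>1 / h\<close> is absorbed by the energy term of order
      \<open>h powr - p\<close>.\<close>
    have h1: "1 / h \<le> h powr - p"
    proof -
      have "h powr - 1 \<le> h powr - p" using h p by (intro powr_mono') auto
      then show ?thesis using h by (simp add: powr_minus_divide)
    qed
    have Bb: "B \<le> 4 * M * h powr - p * X"
    proof -
      have "f (t + h) - f (t + h / 2) \<le> X" unfolding X(1) using f_mono[of t "t + h / 2"] h by simp
      then have "2 * M * (f (t + h) - f (t + h / 2)) * (2 * (1 / h)) \<le> 2 * M * X * (2 * h powr - p)"
        using M X(2) h h1 by (intro mult_mono mult_left_mono) auto
      moreover have "B = 2 * M * (f (t + h) - f (t + h / 2)) * (2 * (1 / h))"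
        unfolding B_def using h by (simp add: field_simps)
      ultimately show ?thesis by (simp add: mult_ac)
    qed
    have Db: "D \<le> (8 * real N * M) powr p * h powr - p * X"
    proof -
      have "E \<inter> (ball 0 s - ball 0 t) = E \<inter> ball 0 s - E \<inter> ball 0 t" by auto
      then have "measure lborel (E \<inter> (ball 0 s - ball 0 t)) = f s - f t"
        unfolding f_def using ts bB(1)
        by (simp only:) (rule measurable_measure_Diff[OF fmeasurable_borel_bounded[OF bB(1,2)]], auto)
      also have "\<dots> \<le> X" unfolding X(1) using f_mono[OF s(2)] by simp
      finally have ann: "measure lborel (E \<inter> (ball 0 s - ball 0 t)) \<le> X" .
      have "M / (s - t) \<le> M / (h / 2)" using s h M by (intro divide_left_mono) auto
      then have "4 * real N * (M / (s - t)) \<le> 4 * real N * (M / (h / 2))" by (intro mult_left_mono) auto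
      also have "\<dots> = 8 * real N * M / h" by simp
      finally have "(4 * real N * (M / (s - t))) powr p \<le> (8 * real N * M / h) powr p"
        using M ts p by (intro powr_mono2) auto
      also have "\<dots> = (8 * real N * M) powr p * h powr - p"
        using M h powr_divide[of "8 * real N * M" h p] by (simp add: powr_minus_divide)
      finally show ?thesis unfolding D_def using ann by (intro mult_mono) auto
    qed
    have BD: "c * (B + D) \<le> C * h powr - p * X"
    proof -
      have "B + D \<le> (4 * M + (8 * real N * M) powr p) * (h powr - p * X)"
        using Bb Db by (simp add: algebra_simps)
      then show ?thesis unfolding C_def using c(1) by (simp add: mult.assoc)
    qed
    have "m (t + h) powr (1 - 1 / DIM('a)) \<le> C * h powr - p * X"
    proof (cases "m (t + h) = 0")
      case True
      have "0 \<le> B + D" by (rule perimeter_le_nonneg[OF outer])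
      then have "0 \<le> c * (B + D)" using c(1) by simp
      then show ?thesis using BD True by simp
    next
      case False
      \<comment> \<open>The isoperimetric inequality applies where the cut was made, at
        \<open>s\<close>; the volume outside \<open>t + h\<close> is not larger, as \<open>s\<close>
        is at most \<open>t + h\<close>.\<close>
      define y where "y = m s"
      have my: "m (t + h) \<le> y" unfolding y_def mf using f_mono[OF s(2)] by simp
      have mpos: "m (t + h) > 0" using False unfolding m_def by (simp add: less_le)
      then have y: "y > 0" using my by simp
      have "y \<le> c * y powr (1 / DIM('a)) * (B + D)"
        unfolding y_def m_def by (rule c(2)[OF bB(3,4) outer])
      moreover have "y = y powr (1 - 1 / DIM('a)) * y powr (1 / DIM('a))"
        using y by (simp add: powr_add[symmetric])
      ultimately have "y powr (1 - 1 / DIM('a)) * y powr (1 / DIM('a)) \<le> (c * (B + D)) * y powr (1 / DIM('a))"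
        by (simp add: mult_ac)
      then have "y powr (1 - 1 / DIM('a)) \<le> c * (B + D)"
        using y by (simp add: mult_le_cancel_right)
      moreover have "m (t + h) powr (1 - 1 / DIM('a)) \<le> y powr (1 - 1 / DIM('a))"
        using my mpos by (intro powr_mono2) auto
      ultimately show ?thesis using BD by linarith
    qed
    then show "measure lborel ({x. u x > 0} - ball 0 (t + h)) powr (1 - 1 / DIM('a))
      \<le> C * h powr - p * (measure lborel ({x. u x > 0} - ball 0 t) - measure lborel ({x. u x > 0} - ball 0 (t + h)))"
      unfolding X_def m_def E_def .
  qed
qed

text \<open>A single cutoff that is one on \<open>ball 0 \<rho>\<close> and supported in
  \<open>cball 0 s\<close> with \<open>s\<close> at most \<open>\<rho> + 1\<close> is admissible for
  every larger \<open>R\<close>, and its energy does not see \<open>R\<close>. Hence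
  \<open>E0\<close> can be fixed before \<open>R\<close>, \<open>K\<close> and
  \<open>u\<close>.\<close>

lemma competitor_energy_bound:
  fixes \<rho> p :: real
  assumes \<rho>: "\<rho> > 0" and p: "0 < p"
  obtains E0 where "E0 \<ge> 0"
    "\<And>R (K::'a::euclidean_space set) u. K \<subseteq> ball 0 \<rho> \<Longrightarrow> \<rho> + 1 < R \<Longrightarrow>
      continuous_minimizer p R K u \<Longrightarrow> functional_I p R u \<le> ennreal E0"
proof -
  \<comment> \<open>A ball of finite perimeter is obtained by cutting the whole space, which has
    perimeter bound 0, with the zero field outside; the perimeter of a ball need not be
    computed.\<close>
  have "\<exists>s Q. \<rho> < s \<and> s \<le> \<rho> + 1 \<and> perimeter_le (ball (0::'a) s) Q"
    using perimeter_cut[of UNIV 0 \<rho> "\<rho> + 1"] \<rho> zero_field[where 'a='a] perimeter_le_UNIV[where 'a='a]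
    unfolding perimeter_le_def by (fastforce simp: integral_zero_field)
  then obtain s Q where s: "\<rho> < s" "s \<le> \<rho> + 1" and Q: "perimeter_le (ball (0::'a) s) Q" by blast
  have \<rho>0: "0 \<le> \<rho>" using \<rho> by simp
  define \<eta> where "\<eta> = cutoff 1 \<rho> s (0::'a)"
  note cut = order_refl[of "1::nat"] \<rho>0 s(1)
  define L where "L = cutoff_slope / (s - \<rho>)"
  have L: "L > 0" using cutoff_slope(1) s by (simp add: L_def)
  define E0 where "E0 = L powr p * measure lborel (ball (0::'a) s) + Q"
  have Q0: "Q \<ge> 0" by (rule perimeter_le_nonneg[OF Q])
  show thesis
  proof (rule that[of E0])
    show "E0 \<ge> 0" unfolding E0_def using Q0 by simp
    fix R :: real and K :: "'a set" and u :: "'a \<Rightarrow> real"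
    assume K: "K \<subseteq> ball 0 \<rho>" and R: "\<rho> + 1 < R" and min: "continuous_minimizer p R K u"
    have supp: "{x. \<eta> x \<noteq> 0} \<subseteq> cball 0 s"
    proof -
      have "\<eta> x = 0" if "norm x > s" for x
        unfolding \<eta>_def by (rule cutoff_eq_0[OF cut]) (use that in simp)
      then show ?thesis by force
    qed
    have "compactly_contained {x. \<eta> x \<noteq> 0} (ball 0 R)"
      by (rule compactly_containedI[OF supp compact_cball]) (use s R in auto)
    then have \<eta>: "\<eta> \<in> test_functions (ball 0 R)"
      unfolding test_functions_iff using smooth_cutoff[OF cut] by (simp add: \<eta>_def)
    have one: "\<eta> x = 1" if "x \<in> ball 0 \<rho>" for x
      unfolding \<eta>_def by (rule cutoff_eq_1[OF cut]) (use that in simp)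
    have "\<eta> \<in> admissible R K"
      by (rule test_function_admissible[OF \<eta> open_ball K one])
    then have "functional_I p R u \<le> functional_I p R \<eta>"
      using min unfolding continuous_minimizer_def by blast
    also have "functional_I p R \<eta> \<le> ennreal (L powr p * measure lborel (ball (0::'a) s)) + ennreal Q"
      unfolding functional_I_def
    proof (rule add_mono)
      have pt: "ennreal (norm (indicator (ball 0 R) x *\<^sub>R gradient \<eta> x) powr p)
          \<le> ennreal (L powr p) * indicator (ball 0 s) x" for x
      proof (cases "x \<in> ball 0 s")
        case True
        then have "x \<in> ball 0 R" using s R by simp
        have "norm (gradient \<eta> x) \<le> L"
          using cutoff_gradient_le[OF cut, where c=0 and x=x] unfolding \<eta>_def L_def by simp
        then have "norm (gradient \<eta> x) powr p \<le> L powr p" using p by (intro powr_mono2) auto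
        then show ?thesis using True \<open>x \<in> ball 0 R\<close> by (simp add: ennreal_leI)
      next
        case False
        then have "gradient \<eta> x = 0" using cutoff_gradient_eq_0[OF cut, where c=0 and x=x] by (simp add: \<eta>_def)
        then show ?thesis by simp
      qed
      have "(\<integral>\<^sup>+x\<in>ball 0 R. ennreal (norm (weak_gradient (ball 0 R) \<eta> x) powr p) \<partial>lebesgue)
          = (\<integral>\<^sup>+x. ennreal (norm (indicator (ball 0 R) x *\<^sub>R gradient \<eta> x) powr p) \<partial>lebesgue)"
        by (rule nn_integral_weak_gradient[OF open_ball test_function_facts(3)[OF open_ball bounded_ball \<eta>]])
      also have "\<dots> \<le> (\<integral>\<^sup>+x. ennreal (L powr p) * indicator (ball (0::'a) s) x \<partial>lebesgue)"
        by (intro nn_integral_mono pt)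
      also have "\<dots> = ennreal (L powr p) * emeasure lborel (ball (0::'a) s)"
        by (subst nn_integral_cmult_indicator) auto
      also have "emeasure lborel (ball (0::'a) s) = ennreal (measure lborel (ball (0::'a) s))"
        using emeasure_bounded_finite[OF bounded_ball[of "0::'a" s]] by (intro emeasure_eq_ennreal_measure) auto
      finally show "(\<integral>\<^sup>+x\<in>ball 0 R. ennreal (norm (weak_gradient (ball 0 R) \<eta> x) powr p) \<partial>lebesgue)
          \<le> ennreal (L powr p * measure lborel (ball (0::'a) s))"
        by (simp add: ennreal_mult)
      have "{x. \<eta> x > 0} = ball 0 s"
        unfolding \<eta>_def cutoff_pos_iff[OF cut] by auto
      moreover have "perimeter (ball (0::'a) s) \<le> ennreal Q"
        by (rule perimeter_le_ennreal_iff[OF _ bounded_ball Q0, THEN iffD2, OF _ Q]) simp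
      ultimately show "perimeter {x. \<eta> x > 0} \<le> ennreal Q" by (simp only:)
    qed
    also have "\<dots> = ennreal E0" unfolding E0_def using Q0 by (simp add: ennreal_plus)
    finally show "functional_I p R u \<le> ennreal E0" .
  qed
qed

theorem corollary18:
  fixes K :: "'a::euclidean_space set" and p :: real
  assumes "DIM('a) \<ge> 2"
    and "1 < p"
    and "compact K"
    and "interior (convex hull K) \<noteq> {}"
  shows "\<exists>R0. \<forall>R\<ge>R0. K \<subseteq> ball 0 R \<longrightarrow>
    (\<forall>u. continuous_minimizer p R K u \<longrightarrow> compactly_contained {x. u x > 0} (ball 0 R))"
proof -
  define \<alpha> where "\<alpha> = 1 - 1 / real DIM('a)"
  \<comment> \<open>Positivity of the exponent is where the dimension has to be at least
    two.\<close>
  have \<alpha>: "0 < \<alpha>" "\<alpha> < 1" using assms(1) by (auto simp: \<alpha>_def)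
  obtain \<rho> where \<rho>: "\<rho> > 0" "K \<subseteq> ball 0 \<rho>"
    using bounded_subset_ballD[OF compact_imp_bounded[OF assms(3)], of 0] by blast
  obtain C where C: "C > 0"
    "\<And>R (K::'a set) u t h. continuous_minimizer p R K u \<Longrightarrow> functional_I p R u < \<infinity> \<Longrightarrow>
      0 \<le> t \<Longrightarrow> K \<subseteq> ball 0 t \<Longrightarrow> 0 < h \<Longrightarrow> h \<le> 1 \<Longrightarrow>
      measure lborel ({x. u x > 0} - ball 0 (t + h)) powr (1 - 1 / DIM('a))
      \<le> C * h powr - p * (measure lborel ({x. u x > 0} - ball 0 t) - measure lborel ({x. u x > 0} - ball 0 (t + h)))"
    by (rule minimizer_volume_decay[OF assms(2)]) (rule that, assumption+)
  obtain E0 where E0: "E0 \<ge> 0"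
    "\<And>R (K::'a set) u. K \<subseteq> ball 0 \<rho> \<Longrightarrow> \<rho> + 1 < R \<Longrightarrow>
      continuous_minimizer p R K u \<Longrightarrow> functional_I p R u \<le> ennreal E0"
    by (rule competitor_energy_bound[OF \<rho>(1), of p])
      (use assms(2) in simp, rule that, assumption+)
  obtain c where c: "c > 0"
    "\<And>(E::'a set) P. E \<in> sets borel \<Longrightarrow> bounded E \<Longrightarrow> perimeter_le E P \<Longrightarrow>
       measure lborel E \<le> c * measure lborel E powr (1 / DIM('a)) * P"
    by (rule isoperimetric_inequality) (rule that, assumption+)
  \<comment> \<open>The isoperimetric inequality and the energy bound give that the volume of
    \<open>E\<close> to the power \<open>\<alpha>\<close> is at most \<open>c * E0\<close>; this
    makes the initial volume independent of \<open>R\<close>.\<close>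
  define V where "V = (c * E0) powr (1 / \<alpha>)"
  have V: "V \<ge> 0" by (simp add: V_def)
  show ?thesis
  proof (rule De_Giorgi_iteration[OF C(1) V \<alpha>, of \<rho> p])
    fix T assume T: "T \<ge> \<rho>"
    "\<And>m. (\<And>t. 0 \<le> m t) \<Longrightarrow> (\<And>s t. s \<le> t \<Longrightarrow> m t \<le> m s) \<Longrightarrow> m \<rho> \<le> V \<Longrightarrow>
      (\<And>t h. \<rho> \<le> t \<Longrightarrow> 0 < h \<Longrightarrow> h \<le> 1 \<Longrightarrow> m (t + h) powr \<alpha> \<le> C * h powr - p * (m t - m (t + h))) \<Longrightarrow>
      m T = 0"
    show ?thesis
    \<comment> \<open>The margin 2 gives \<open>R > \<rho> + 1\<close>, as the energy bound
      requires, and room for \<open>cball 0 T\<close> inside the open ball of radius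
      \<open>R\<close>.\<close>
    proof (intro exI[of _ "T + 2"] allI impI)
      fix R u
      assume R: "T + 2 \<le> R" and min: "continuous_minimizer p R K u"
      define E where "E = {x. u x > 0}"
      note Ef = positivity_set_facts[OF min, folded E_def]
      have en: "functional_I p R u \<le> ennreal E0"
        by (rule E0(2)[OF \<rho>(2) _ min]) (use R T(1) in simp)
      then have fin: "functional_I p R u < \<infinity>" by (simp add: le_less_trans)
      have "perimeter E \<le> functional_I p R u" unfolding functional_I_def E_def by simp
      then have "perimeter E \<le> ennreal E0" using en by (rule order_trans)
      then have PE: "perimeter_le E E0" using perimeter_le_ennreal_iff[OF Ef(3,4) E0(1)] by simp
      have vol: "measure lborel E \<le> V"
      proof (cases "measure lborel E = 0")
        case False
        define y where "y = measure lborel E"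
        have y: "y > 0" using False by (simp add: y_def less_le)
        have "y = y powr \<alpha> * y powr (1 / DIM('a))"
          using y by (simp add: powr_add[symmetric] \<alpha>_def)
        moreover have "y \<le> c * y powr (1 / DIM('a)) * E0"
          unfolding y_def by (rule c(2)[OF Ef(3,4) PE])
        ultimately have "y powr \<alpha> * y powr (1 / DIM('a)) \<le> (c * E0) * y powr (1 / DIM('a))"
          by (simp add: mult_ac)
        then have "y powr \<alpha> \<le> c * E0" using y by (simp add: mult_le_cancel_right)
        then have "(y powr \<alpha>) powr (1 / \<alpha>) \<le> V" unfolding V_def using \<alpha> by (intro powr_mono2) auto
        then show ?thesis using y \<alpha> by (simp add: powr_powr y_def)
      qed (simp add: V_def)
      have fm: "E - S \<in> fmeasurable lborel" if "S \<in> sets borel" for S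
        by (rule fmeasurable_borel_bounded) (use Ef that in \<open>auto intro: bounded_subset[OF Ef(4)]\<close>)
      have zero: "measure lborel (E - ball 0 T) = 0"
      proof (rule T(2)[of "\<lambda>t. measure lborel (E - ball 0 t)"])
        show "measure lborel (E - ball 0 t) \<le> measure lborel (E - ball 0 s)" if "s \<le> t" for s t
          by (rule measure_mono_fmeasurable[OF _ _ fm]) (use that Ef(3) in auto)
        have "measure lborel (E - ball 0 \<rho>) \<le> measure lborel E"
          by (rule measure_mono_fmeasurable) (use fm[of "{}"] Ef(3) in auto)
        then show "measure lborel (E - ball 0 \<rho>) \<le> V" using vol by simp
        show "measure lborel (E - ball 0 (t + h)) powr \<alpha>
            \<le> C * h powr - p * (measure lborel (E - ball 0 t) - measure lborel (E - ball 0 (t + h)))"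
          if "\<rho> \<le> t" "0 < h" "h \<le> 1" for t h
          unfolding \<alpha>_def E_def
          by (rule C(2)[OF min fin]) (use that \<rho> in auto)
      qed simp
      \<comment> \<open>\<open>E\<close> is open, so a point beyond the closed ball would bring with
        it a small ball of positive volume, contradicting \<open>zero\<close>.\<close>
      have "E \<subseteq> cball 0 T"
      proof (rule ccontr)
        assume "\<not> E \<subseteq> cball 0 T"
        then obtain x where x: "x \<in> E - cball 0 T" by blast
        have "open (E - cball 0 T)" using Ef(1) by (intro open_Diff closed_cball)
        then obtain e where e: "e > 0" "ball x e \<subseteq> E - cball 0 T"
          using x by (meson openE)
        have "measure lborel (ball x e) \<le> measure lborel (E - ball 0 T)"
          by (rule measure_mono_fmeasurable[OF _ _ fm]) (use e(2) in auto)
        then show False using content_ball_pos[OF e(1), of x] zero by simp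
      qed
      then show "compactly_contained {x. u x > 0} (ball 0 R)"
        unfolding E_def[symmetric]
        by (rule compactly_containedI[OF _ compact_cball]) (use R in auto)
    qed
  qed
qed

end
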